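(* Let $k\ge 1$ and let $\mathcal I$ be a complete marriage instance with men $m_1,\dots,m_k$ and women $w_1,\dots,w_k$, and let $n=2k$. Let $A,b$ and $C^*$ be the matrices and vector associated to $\mathcal I$ as described in the context (so that $\{x\in\mathbb R^{n+k^2}_{\ge 0}: Ax=b\}$ is the matching polytope of the instance graph with loops). Then there exists a cardinal pivoting rule such that Scarf's algorithm on input $(A,b,C^* )$ terminates after a number of iterations, and in a running time, bounded by a polynomial in $n$. In particular, its output is the characteristic vector of a stable matching of $\mathcal I$.
   Context: Instance: men $M=\{m_1,\dots,m_k\}$, women $W=\{w_1,\dots,w_k\}$; write $v_i=m_i$ and $v_{k+i}=w_i$ for $i\in[k]$, $n=2k$. Every man strictly ranks all women and every woman strictly ranks all men (all pairs acceptable). The graph $G$ has vertex set $M\cup W$ and edge set consisting of $n$ loops $e_1,\dots,e_n$ ($e_i$ is the loop at $v_i$) and the $k^2$ valid edges $(m,w)$, $m\in M,w\in W$; every agent prefers each valid edge containing it to its own loop. Columns are indexed by $[n+k^2]$: column $j\le n$ is the loop $e_j$, and for $i\in[k]$ the columns $n+k(i-1)+1,\dots,n+ki$ are the edges $(m_i,w)$ listed in decreasing order of $m_i$'s preference. $A$ is the $n\times(n+k^2)$ matrix with $a_{ij}=1$ iff $v_i$ is an endpoint of $e_j$ and $0$ otherwise; $b=(1,\dots,1)^T$. A matching is a set $\mu$ of edges (loops allowed) such that every node lies in exactly one edge of $\mu$ (a loop means unmatched); it is stable if there is no valid edge $(m,w)\notin\mu$ such that both $m$ and $w$ prefer $(m,w)$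 to their edge in $\mu$. Matrix $C^*=(c_{ij})$: if $v_i$ is an endpoint of $e_j$ and $e_j$ is the $\ell$-th best edge for $v_i$ among the $k+1$ edges containing $v_i$ (loop last), then $c_{ij}=k+1-\ell$ (so $c_{ii}=0$ and incident valid edges get values in $\{1,\dots,k\}$); if $e_j$ is a valid edge not incident to $v_i$, $c_{ij}$ takes values in $\mathcal L=\{k+1,\dots,k^2\}$, assigned in decreasing order from left to right (smaller column index gets larger value); if $e_j$ is a loop with $j\ne i$, $c_{ij}$ takes values in $\{k^2+1,\dots,k^2+2k-1\}$, assigned in decreasing order from left to right. Scarf's algorithm: a feasible basis is a set $B$ of $n$ linearly independent columns of $A$ with $A_B^{-1}b\ge 0$. A set $D$ of $n$ columns is an ordinal basis of $C$ if, with $u_i=\min_{j\in D}c_{ij}$, for every column $h$ there is $i$ with $u_i\ge c_{ih}$. Start with $B=\{1,\dots,n\}$, $D=\{j_0,2,\dots,n\}$ where $j_0$ maximizes $c_{1j}$ over $j>n$. While $B\neq D$, let $\{j_t\}=D\setminus B$; (cardinal pivot) choose $j_\ell\in B$ with $B\setminus\{j_\ell\}\cup\{j_t\}$ a feasible basis and replace $B$ by it (the choice of $j_\ell$, possibly non-unique due to degeneracy, is the cardinal pivoting rule); if now $B\ne D$, (ordinal pivot) replace $D$ by $D\setminus\{j_\ell\}\cup\{j^*\}$ where $j^*\notin D$ is the unique column making this an ordinal basis. At termination $B=D$ and the output is the basic feasible solution of $B$. *)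

theory Defs
  imports
    "Jordan_Normal_Form.Matrix"
    "Jordan_Normal_Form.VS_Connect"
    "HOL-Computational_Algebra.Polynomial"
begin

section \<open>Scarf's algorithm\<close>

text \<open>Rows and columns are numbered from \<open>0\<close>; sets of columns are sets of column indices.\<close>

text \<open>This makes \<open>x\<close> the vector with \<open>x\<^sub>B = A\<^sub>B\<^sup>-\<^sup>1 b\<close> and zeros
  outside \<open>B\<close>, provided the columns in \<open>B\<close> are linearly independent.\<close>

definition basic_solution :: "real mat \<Rightarrow> real vec \<Rightarrow> nat set \<Rightarrow> real vec \<Rightarrow> bool" where
  "basic_solution A b B x \<longleftrightarrow>
     x \<in> carrier_vec (dim_col A) \<and> A *\<^sub>v x = b \<and> (\<forall>j < dim_col A. j \<notin> B \<longrightarrow> x $ j = 0)"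

definition feasible_basis :: "real mat \<Rightarrow> real vec \<Rightarrow> nat set \<Rightarrow> bool" where
  "feasible_basis A b B \<longleftrightarrow>
     B \<subseteq> {..<dim_col A} \<and> card B = dim_row A \<and> inj_on (col A) B \<and>
     \<not> module.lin_dep class_ring (module_vec TYPE(real) (dim_row A)) (col A ` B) \<and>
     (\<exists>x. basic_solution A b B x \<and> x \<ge> 0\<^sub>v (dim_col A))"

definition ordinal_basis :: "nat mat \<Rightarrow> nat set \<Rightarrow> bool" where
  "ordinal_basis C D \<longleftrightarrow>
     D \<subseteq> {..<dim_col C} \<and> card D = dim_row C \<and>
     (\<forall>h < dim_col C. \<exists>i < dim_row C. Min ((\<lambda>j. C $$ (i, j)) ` D) \<ge> C $$ (i, h))"

text \<open>A rule maps the current pair \<open>(B, D)\<close> to the column leaving \<open>B\<close>. It has to be a legal choice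
  for every feasible basis and every entering column, not just along one run.\<close>

type_synonym pivoting_rule = "nat set \<Rightarrow> nat set \<Rightarrow> nat"

definition cardinal_pivoting_rule :: "real mat \<Rightarrow> real vec \<Rightarrow> pivoting_rule \<Rightarrow> bool" where
  "cardinal_pivoting_rule A b \<rho> \<longleftrightarrow>
     (\<forall>B D j. feasible_basis A b B \<and> D \<subseteq> {..<dim_col A} \<and> D - B = {j} \<longrightarrow>
        \<rho> B D \<in> B \<and> feasible_basis A b (insert j (B - {\<rho> B D})))"

definition scarf_initial :: "nat mat \<Rightarrow> nat set \<times> nat set \<Rightarrow> bool" where
  "scarf_initial C s \<longleftrightarrow>
     (let n = dim_row C in
      \<exists>j\<^sub>0. is_arg_max (\<lambda>j. C $$ (0, j)) (\<lambda>j. n \<le> j \<and> j < dim_col C) j\<^sub>0 \<and>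
           s = ({..<n}, insert j\<^sub>0 {1..<n}))"

text \<open>One pass through the loop: a cardinal pivot followed, unless \<open>B\<close> has become equal to \<open>D\<close>,
  by an ordinal pivot.\<close>

definition scarf_iteration ::
    "real mat \<Rightarrow> real vec \<Rightarrow> nat mat \<Rightarrow> pivoting_rule \<Rightarrow>
     nat set \<times> nat set \<Rightarrow> nat set \<times> nat set \<Rightarrow> bool" where
  "scarf_iteration A b C \<rho> = (\<lambda>(B, D) (B', D').
     B \<noteq> D \<and>
     (\<exists>j\<^sub>t j\<^sub>l. D - B = {j\<^sub>t} \<and> j\<^sub>l = \<rho> B D \<and> j\<^sub>l \<in> B \<and>
        B' = insert j\<^sub>t (B - {j\<^sub>l}) \<and> feasible_basis A b B' \<and>
        (if B' = D then D' = D
         else (\<exists>!j. j \<notin> D \<and> ordinal_basis C (insert j (D - {j\<^sub>l}))) \<and>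
              D' = insert (THE j. j \<notin> D \<and> ordinal_basis C (insert j (D - {j\<^sub>l}))) (D - {j\<^sub>l}))))"

text \<open>A terminating run, given as the list of all successive pairs \<open>(B, D)\<close>; it consists of
  \<open>length r - 1\<close> iterations.\<close>

definition scarf_run ::
    "real mat \<Rightarrow> real vec \<Rightarrow> nat mat \<Rightarrow> pivoting_rule \<Rightarrow> (nat set \<times> nat set) list \<Rightarrow> bool" where
  "scarf_run A b C \<rho> r \<longleftrightarrow>
     r \<noteq> [] \<and> scarf_initial C (hd r) \<and> successively (scarf_iteration A b C \<rho>) r \<and>
     fst (last r) = snd (last r)"


section \<open>Complete marriage instances\<close>

text \<open>Men and women are numbered \<open>0, \<dots>, k - 1\<close>. The list \<open>mp m\<close> contains all women in decreasing
  order of preference of man \<open>m\<close>, and \<open>wp w\<close> all men in decreasing order of preference of woman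
  \<open>w\<close>. As nodes of the graph, man \<open>m\<close> is \<open>m\<close> and woman \<open>w\<close> is \<open>k + w\<close>. Edges are sets of nodes,
  the loop at \<open>v\<close> being \<open>{v}\<close>.\<close>

definition complete_instance :: "nat \<Rightarrow> (nat \<Rightarrow> nat list) \<Rightarrow> (nat \<Rightarrow> nat list) \<Rightarrow> bool" where
  "complete_instance k mp wp \<longleftrightarrow>
     (\<forall>i < k. distinct (mp i) \<and> set (mp i) = {..<k} \<and> distinct (wp i) \<and> set (wp i) = {..<k})"

definition loops :: "nat \<Rightarrow> nat set set" where
  "loops k = {{v} | v. v < 2 * k}"

definition valid_edges :: "nat \<Rightarrow> nat set set" where
  "valid_edges k = {{m, k + w} | m w. m < k \<and> w < k}"

definition edge_list ::
    "nat \<Rightarrow> (nat \<Rightarrow> nat list) \<Rightarrow> (nat \<Rightarrow> nat list) \<Rightarrow> nat \<Rightarrow> nat set list" where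
  \<comment> \<open>the edges containing node \<open>v\<close>, best first\<close>
  "edge_list k mp wp v =
     (if v < k then map (\<lambda>w. {v, k + w}) (mp v) else map (\<lambda>m. {m, v}) (wp (v - k))) @ [{v}]"

definition edge_rank ::
    "nat \<Rightarrow> (nat \<Rightarrow> nat list) \<Rightarrow> (nat \<Rightarrow> nat list) \<Rightarrow> nat \<Rightarrow> nat set \<Rightarrow> nat" where
  \<comment> \<open>the \<open>\<ell>\<close> such that \<open>e\<close> is the \<open>\<ell>\<close>-th best edge for \<open>v\<close>, counting from \<open>1\<close>\<close>
  "edge_rank k mp wp v e = Suc (LEAST l. edge_list k mp wp v ! l = e)"

definition prefers ::
    "nat \<Rightarrow> (nat \<Rightarrow> nat list) \<Rightarrow> (nat \<Rightarrow> nat list) \<Rightarrow> nat \<Rightarrow> nat set \<Rightarrow> nat set \<Rightarrow> bool" where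
  "prefers k mp wp v e f \<longleftrightarrow>
     e \<in> set (edge_list k mp wp v) \<and> f \<in> set (edge_list k mp wp v) \<and>
     edge_rank k mp wp v e < edge_rank k mp wp v f"

definition matching :: "nat \<Rightarrow> nat set set \<Rightarrow> bool" where
  "matching k \<mu> \<longleftrightarrow> \<mu> \<subseteq> loops k \<union> valid_edges k \<and> (\<forall>v < 2 * k. \<exists>!e. e \<in> \<mu> \<and> v \<in> e)"

definition stable_matching ::
    "nat \<Rightarrow> (nat \<Rightarrow> nat list) \<Rightarrow> (nat \<Rightarrow> nat list) \<Rightarrow> nat set set \<Rightarrow> bool" where
  "stable_matching k mp wp \<mu> \<longleftrightarrow>
     matching k \<mu> \<and>
     \<not> (\<exists>e \<in> valid_edges k. e \<notin> \<mu> \<and>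
          (\<forall>v \<in> e. prefers k mp wp v e (THE f. f \<in> \<mu> \<and> v \<in> f)))"


section \<open>The matrices associated with an instance\<close>

definition num_cols :: "nat \<Rightarrow> nat" where
  "num_cols k = 2 * k + k\<^sup>2"

definition col_edge :: "nat \<Rightarrow> (nat \<Rightarrow> nat list) \<Rightarrow> nat \<Rightarrow> nat set" where
  "col_edge k mp j =
     (if j < 2 * k then {j}
      else let m = (j - 2 * k) div k in {m, k + mp m ! ((j - 2 * k) mod k)})"

text \<open>The 0/1 objects are polymorphic: they are used over \<open>real\<close> for the polyhedron
  and over \<open>nat\<close> when they are handed to a program.\<close>

definition incidence_mat :: "nat \<Rightarrow> (nat \<Rightarrow> nat list) \<Rightarrow> 'a::zero_neq_one mat" where
  "incidence_mat k mp =
     mat (2 * k) (num_cols k) (\<lambda>(i, j). if i \<in> col_edge k mp j then 1 else 0)"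

definition ones_vec :: "nat \<Rightarrow> 'a::one vec" where
  "ones_vec k = vec (2 * k) (\<lambda>_. 1)"

definition char_vec :: "nat \<Rightarrow> (nat \<Rightarrow> nat list) \<Rightarrow> nat set set \<Rightarrow> 'a::zero_neq_one vec" where
  "char_vec k mp \<mu> = vec (num_cols k) (\<lambda>j. if col_edge k mp j \<in> \<mu> then 1 else 0)"

text \<open>In row \<open>i\<close> there are \<open>k\<^sup>2 - k\<close> valid edges not incident to node \<open>i\<close>; from left to right they get
  the values \<open>k\<^sup>2, k\<^sup>2 - 1, \<dots>, k + 1\<close>. The \<open>2 k - 1\<close> loops at other nodes get, from left to right,
  \<open>k\<^sup>2 + 2 k - 1, \<dots>, k\<^sup>2 + 1\<close>. The cardinalities below count the columns of the same kind
  to the left of column \<open>j\<close>.\<close>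

definition ordinal_mat :: "nat \<Rightarrow> (nat \<Rightarrow> nat list) \<Rightarrow> (nat \<Rightarrow> nat list) \<Rightarrow> nat mat" where
  "ordinal_mat k mp wp =
     mat (2 * k) (num_cols k) (\<lambda>(i, j).
       if i \<in> col_edge k mp j then k + 1 - edge_rank k mp wp i (col_edge k mp j)
       else if 2 * k \<le> j then k\<^sup>2 - card {h. 2 * k \<le> h \<and> h < j \<and> i \<notin> col_edge k mp h}
       else k\<^sup>2 + 2 * k - 1 - card {h. h < j \<and> h \<noteq> i})"


section \<open>Running time\<close>

text \<open>Programs over binary trees: a one-variable version of the WHILE language of Neil D. Jones
  (Computability and Complexity from a Programming Perspective, MIT Press 1997), written with
  combinators. Every operation has unit cost; \<open>Pair\<close> only allocates one cell with two pointers.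
  The decision problems solvable in polynomial time in this model are those in P.\<close>

datatype tree = Null | Node tree tree

datatype prog =
    Id | Empty | Left | Right
  | Pair prog prog | Then prog prog | Cond prog prog prog | Loop prog prog

text \<open>\<open>exec p x t y\<close>: on input \<open>x\<close>, program \<open>p\<close> halts after \<open>t\<close> steps with output \<open>y\<close>.
  As a truth value, \<open>Null\<close> is false and every other tree is true.\<close>

inductive exec :: "prog \<Rightarrow> tree \<Rightarrow> nat \<Rightarrow> tree \<Rightarrow> bool" where
  "exec Id x 1 x"
| "exec Empty x 1 Null"
| "exec Left (Node x y) 1 x"
| "exec Left Null 1 Null"
| "exec Right (Node x y) 1 y"
| "exec Right Null 1 Null"
| "\<lbrakk>exec p x s y; exec q x t z\<rbrakk> \<Longrightarrow> exec (Pair p q) x (s + t + 1) (Node y z)"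
| "\<lbrakk>exec p x s y; exec q y t z\<rbrakk> \<Longrightarrow> exec (Then p q) x (s + t + 1) z"
| "\<lbrakk>exec c x s y; y \<noteq> Null; exec p x t z\<rbrakk> \<Longrightarrow> exec (Cond c p q) x (s + t + 1) z"
| "\<lbrakk>exec c x s Null; exec q x t z\<rbrakk> \<Longrightarrow> exec (Cond c p q) x (s + t + 1) z"
| "exec c x s Null \<Longrightarrow> exec (Loop c p) x (s + 1) x"
| "\<lbrakk>exec c x s y; y \<noteq> Null; exec p x t x'; exec (Loop c p) x' u z\<rbrakk>
     \<Longrightarrow> exec (Loop c p) x (s + t + u + 1) z"

text \<open>Numbers are encoded in unary; all numbers occurring in the input are at most \<open>k\<^sup>2 + 2 k\<close>.\<close>

fun enc_nat :: "nat \<Rightarrow> tree" where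
  "enc_nat 0 = Null"
| "enc_nat (Suc n) = Node Null (enc_nat n)"

fun enc_list :: "('a \<Rightarrow> tree) \<Rightarrow> 'a list \<Rightarrow> tree" where
  "enc_list f [] = Null"
| "enc_list f (x # xs) = Node (f x) (enc_list f xs)"

definition enc_set :: "nat set \<Rightarrow> tree" where
  "enc_set S = enc_list enc_nat (sorted_list_of_set S)"

definition enc_vec :: "nat vec \<Rightarrow> tree" where
  "enc_vec v = enc_list enc_nat (list_of_vec v)"

definition enc_mat :: "nat mat \<Rightarrow> tree" where
  "enc_mat M = enc_list enc_vec (rows M)"

definition enc_input :: "nat mat \<Rightarrow> nat vec \<Rightarrow> nat mat \<Rightarrow> tree" where
  "enc_input A b C = Node (enc_mat A) (Node (enc_vec b) (enc_mat C))"

text \<open>A program carrying out Scarf's algorithm has to produce all intermediate pairs \<open>(B, D)\<close>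
  of the run as well as the final vector.\<close>

definition enc_output :: "(nat set \<times> nat set) list \<Rightarrow> nat vec \<Rightarrow> tree" where
  "enc_output r x = Node (enc_list (\<lambda>(B, D). Node (enc_set B) (enc_set D)) r) (enc_vec x)"

end

theory Submission
  imports Defs "Jordan_Normal_Form.DL_Rank"
begin

text \<open>With the pivoting rule below, Scarf's algorithm simulates the man-proposing deferred acceptance
  algorithm in which the men arrive one after the other in the order \<open>1, \<dots>, k - 1, 0\<close> and skip
  proposals to women who have already rejected a better man. The ordinal basis consists of the
  latest proposal of every man that has arrived, the best rejected edge of every woman (her loop,
  if she has not rejected anybody) and, as long as man \<open>0\<close> is missing, the loops of the latest
  arrival and of the other missing men; the feasible basis is obtained from it by exchanging the
  pending proposal for the loop of man \<open>0\<close>. Every iteration moves a man down his list or lets a new man arrive, so there are at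
  most \<open>k\<^sup>2 + 1\<close> iterations. Since an ordinal pivot is unique if it exists, each one can be found by
  trying all columns.\<close>

section \<open>Feasible bases\<close>

text \<open>The arrival order is dictated by the columns. In row \<open>0\<close> the valid edges at
  other men decrease from left to right, so the minimum of that row over \<open>D\<close> sits at
  the edge of the latest arrival; it can pass only to a man further right or, in the end, to man
  \<open>0\<close>, whose own edges are smaller still. Skipped proposals are forced as well: an edge
  worse than a woman's rejected one would undercut it in her row. The obstacle is degeneracy. The
  ratio test leaves many choices open, so the feasibility of every basis of the run is shown
  directly, from a 0/1 solution supported on it and the vanishing of every node potential orthogonal
  to its columns. Potentials are followed from edge to edge. For rejected edges this could run in
  circles, which the time stamps exclude; for the pending man, whose edge is missing from
  \<open>B\<close>, it follows the chain of rejections that leads to him from the latest arrival.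
  Shifting partners along the same chain gives the 0/1 solution. The rule must also be legal off the
  run, where the ratio test supplies some column. The program never solves a linear system: it reads
  the matching off the final \<open>D\<close> by row minima.\<close>

definition basis_mat :: "'a mat \<Rightarrow> nat set \<Rightarrow> 'a mat" where
  "basis_mat A B = mat (dim_row A) (card B) (\<lambda>(i, a). A $$ (i, sorted_list_of_set B ! a))"

lemma bij_betw_sorted_nth:
  assumes "finite (B :: nat set)"
  shows "bij_betw ((!) (sorted_list_of_set B)) {..<card B} B"
  using bij_betw_nth[of "sorted_list_of_set B" "{..<card B}" B] assms by simp

lemma cols_basis_mat:
  assumes "B \<subseteq> {..<dim_col A}"
  shows "cols (basis_mat A B) = map (col A) (sorted_list_of_set B)"
proof (rule nth_equalityI)
  have fin: "finite B" using assms finite_subset by blast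
  then show len: "length (cols (basis_mat A B)) = length (map (col A) (sorted_list_of_set B))"
    by (simp add: basis_mat_def)
  fix a assume "a < length (cols (basis_mat A B))"
  then have a: "a < card B" by (simp add: basis_mat_def)
  then have "sorted_list_of_set B ! a \<in> B"
    using fin by (metis length_sorted_list_of_set nth_mem set_sorted_list_of_set)
  then have "sorted_list_of_set B ! a < dim_col A" using assms by auto
  with a show "cols (basis_mat A B) ! a = map (col A) (sorted_list_of_set B) ! a"
    by (auto simp: basis_mat_def fin intro!: eq_vecI)
qed

lemma independent_columns_iff_det:
  fixes A :: "real mat"
  assumes B: "B \<subseteq> {..<dim_col A}" and card: "card B = dim_row A"
  shows "inj_on (col A) B \<and>
      \<not> module.lin_dep class_ring (module_vec TYPE(real) (dim_row A)) (col A ` B)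
    \<longleftrightarrow> det (basis_mat A B) \<noteq> 0"
proof -
  define n where "n = dim_row A"
  interpret vec_space "TYPE(real)" n .
  have fin: "finite B" using B finite_subset by blast
  have M: "basis_mat A B \<in> carrier_mat n n" by (simp add: basis_mat_def n_def card)
  have set: "set (cols (basis_mat A B)) = col A ` B"
    using cols_basis_mat[OF B] fin by simp
  have dist: "distinct (cols (basis_mat A B)) \<longleftrightarrow> inj_on (col A) B"
    using cols_basis_mat[OF B] fin by (simp add: distinct_map)
  show ?thesis
  proof
    assume "inj_on (col A) B \<and>
      \<not> module.lin_dep class_ring (module_vec TYPE(real) (dim_row A)) (col A ` B)"
    then have "distinct (cols (basis_mat A B))" "lin_indpt (set (cols (basis_mat A B)))"
      using dist set by (auto simp: n_def)
    then have "rank (basis_mat A B) = n" using lin_indpt_full_rank[OF M] by simp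
    then show "det (basis_mat A B) \<noteq> 0" using det_rank_iff[OF M] by simp
  next
    assume d: "det (basis_mat A B) \<noteq> 0"
    then have r: "rank (basis_mat A B) = n" using det_rank_iff[OF M] by simp
    then have "distinct (cols (basis_mat A B))" using non_distinct_low_rank[OF M] by auto
    moreover from this have "lin_indpt (set (cols (basis_mat A B)))"
      using full_rank_lin_indpt[OF M r] by simp
    ultimately show "inj_on (col A) B \<and>
      \<not> module.lin_dep class_ring (module_vec TYPE(real) (dim_row A)) (col A ` B)"
      using dist set by (auto simp: n_def)
  qed
qed

lemma basis_mat_mult:
  fixes A :: "real mat"
  assumes "finite B" "i < dim_row A"
  shows "(basis_mat A B *\<^sub>v vec (card B) (\<lambda>a. f (sorted_list_of_set B ! a))) $ i
    = (\<Sum>j\<in>B. A $$ (i, j) * f j)"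
proof -
  have "(basis_mat A B *\<^sub>v vec (card B) (\<lambda>a. f (sorted_list_of_set B ! a))) $ i
    = (\<Sum>a<card B. A $$ (i, sorted_list_of_set B ! a) * f (sorted_list_of_set B ! a))"
    using assms by (auto simp: basis_mat_def scalar_prod_def lessThan_atLeast0 intro!: sum.cong)
  also have "\<dots> = (\<Sum>j\<in>B. A $$ (i, j) * f j)"
    using sum.reindex_bij_betw[OF bij_betw_sorted_nth[OF assms(1)], of "\<lambda>j. A $$ (i, j) * f j"] .
  finally show ?thesis .
qed

text \<open>Coefficients can be indexed by columns instead of positions because the enumeration of
  \<open>B\<close> is injective; sums over \<open>B\<close> then replace matrix products.\<close>

lemma ex_sorted_nth_representation:
  assumes "finite (B :: nat set)" "v \<in> carrier_vec (card B)"
  shows "\<exists>f. v = vec (card B) (\<lambda>a. f (sorted_list_of_set B ! a))"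
proof -
  define g where "g = the_inv_into {..<card B} ((!) (sorted_list_of_set B))"
  have "g (sorted_list_of_set B ! a) = a" if "a < card B" for a
    using bij_betw_sorted_nth[OF assms(1)] that
    unfolding g_def by (intro the_inv_into_f_f) (auto simp: bij_betw_def)
  then show ?thesis using assms(2) by (intro exI[of _ "\<lambda>j. v $ g j"] eq_vecI) auto
qed

lemma det_basis_mat_nonzero_iff:
  fixes A :: "real mat"
  assumes "finite B" "card B = dim_row A"
  shows "det (basis_mat A B) \<noteq> 0 \<longleftrightarrow>
    (\<forall>f. (\<forall>i<dim_row A. (\<Sum>j\<in>B. A $$ (i, j) * f j) = 0) \<longrightarrow> (\<forall>j\<in>B. f j = 0))"
proof -
  define n where "n = dim_row A"
  have M: "basis_mat A B \<in> carrier_mat n n" by (simp add: basis_mat_def n_def assms(2))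
  let ?v = "\<lambda>f. vec (card B) (\<lambda>a. f (sorted_list_of_set B ! a)) :: real vec"
  have zero: "?v f = 0\<^sub>v n \<longleftrightarrow> (\<forall>j\<in>B. f j = 0)" for f
  proof -
    have "?v f = 0\<^sub>v n \<longleftrightarrow> (\<forall>a<card B. f (sorted_list_of_set B ! a) = 0)"
      by (auto simp: vec_eq_iff n_def assms(2))
    also have "\<dots> \<longleftrightarrow> (\<forall>j\<in>((!) (sorted_list_of_set B)) ` {..<card B}. f j = 0)" by auto
    also have "((!) (sorted_list_of_set B)) ` {..<card B} = B"
      using bij_betw_sorted_nth[OF assms(1)] by (simp add: bij_betw_def)
    finally show ?thesis .
  qed
  have ker: "basis_mat A B *\<^sub>v ?v f = 0\<^sub>v n \<longleftrightarrow> (\<forall>i<n. (\<Sum>j\<in>B. A $$ (i, j) * f j) = 0)" for f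
  proof -
    have "basis_mat A B *\<^sub>v ?v f = 0\<^sub>v n \<longleftrightarrow> (\<forall>i<n. (basis_mat A B *\<^sub>v ?v f) $ i = 0)"
      using M by (auto simp: vec_eq_iff)
    then show ?thesis using basis_mat_mult[OF assms(1), of _ A f] n_def by simp
  qed
  have "det (basis_mat A B) = 0 \<longleftrightarrow>
    (\<exists>v. v \<in> carrier_vec n \<and> v \<noteq> 0\<^sub>v n \<and> basis_mat A B *\<^sub>v v = 0\<^sub>v n)"
    by (rule det_0_iff_vec_prod_zero[OF M])
  also have "\<dots> \<longleftrightarrow> (\<exists>f. ?v f \<noteq> 0\<^sub>v n \<and> basis_mat A B *\<^sub>v ?v f = 0\<^sub>v n)"
  proof
    assume "\<exists>v. v \<in> carrier_vec n \<and> v \<noteq> 0\<^sub>v n \<and> basis_mat A B *\<^sub>v v = 0\<^sub>v n"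
    then obtain v where v: "v \<in> carrier_vec n" "v \<noteq> 0\<^sub>v n" "basis_mat A B *\<^sub>v v = 0\<^sub>v n" by blast
    then obtain f where "v = ?v f"
      using ex_sorted_nth_representation[OF assms(1), of v] assms(2) n_def by auto
    with v show "\<exists>f. ?v f \<noteq> 0\<^sub>v n \<and> basis_mat A B *\<^sub>v ?v f = 0\<^sub>v n" by auto
  next
    assume "\<exists>f. ?v f \<noteq> 0\<^sub>v n \<and> basis_mat A B *\<^sub>v ?v f = 0\<^sub>v n"
    then obtain f where "?v f \<noteq> 0\<^sub>v n" "basis_mat A B *\<^sub>v ?v f = 0\<^sub>v n" by blast
    moreover have "?v f \<in> carrier_vec n" by (simp add: assms(2) n_def)
    ultimately show "\<exists>v. v \<in> carrier_vec n \<and> v \<noteq> 0\<^sub>v n \<and> basis_mat A B *\<^sub>v v = 0\<^sub>v n" by blast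
  qed
  finally show ?thesis unfolding zero ker n_def[symmetric] by blast
qed

text \<open>Singularity passes to the transpose. A left kernel vector is a potential on the rows;
  for an incidence matrix each valid edge says that the potentials of its two ends cancel, which can
  be followed through the graph.\<close>

lemma det_basis_mat_nonzero_if_left_kernel_trivial:
  fixes A :: "real mat"
  assumes "finite B" "card B = dim_row A"
    and left: "\<And>\<pi>. (\<And>j. j \<in> B \<Longrightarrow> (\<Sum>i<dim_row A. A $$ (i, j) * \<pi> i) = 0) \<Longrightarrow> \<forall>i<dim_row A. \<pi> i = 0"
  shows "det (basis_mat A B) \<noteq> 0"
proof
  define n where "n = dim_row A"
  let ?M = "transpose_mat (basis_mat A B)"
  assume "det (basis_mat A B) = 0"
  moreover have M0: "basis_mat A B \<in> carrier_mat n n" by (simp add: basis_mat_def n_def assms)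
  ultimately have "det ?M = 0" by (simp add: det_transpose[OF M0])
  moreover have M: "?M \<in> carrier_mat n n" using M0 by simp
  ultimately obtain v where v: "v \<in> carrier_vec n" "v \<noteq> 0\<^sub>v n" "?M *\<^sub>v v = 0\<^sub>v n"
    using det_0_iff_vec_prod_zero[OF M] by blast
  have "(\<Sum>i<dim_row A. A $$ (i, j) * v $ i) = 0" if "j \<in> B" for j
  proof -
    have "(!) (sorted_list_of_set B) ` {..<card B} = B"
      using bij_betw_sorted_nth[OF assms(1)] unfolding bij_betw_def by (rule conjunct2)
    with that have "j \<in> (!) (sorted_list_of_set B) ` {..<card B}" by (simp only:)
    then obtain a where j: "j = sorted_list_of_set B ! a" and "a \<in> {..<card B}" by (rule imageE)
    then have a: "a < card B" by simp
    have dims: "card B = n" "dim_row A = n" "dim_vec v = n" using assms(2) n_def carrier_vecD[OF v(1)] by (simp_all only:)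
    have "0 = (?M *\<^sub>v v) $ a" unfolding v(3) using a dims(1) by simp
    also have "\<dots> = (\<Sum>i<n. A $$ (i, j) * v $ i)"
      unfolding j using a dims
      by (auto simp: basis_mat_def scalar_prod_def lessThan_atLeast0 intro!: sum.cong)
    finally show ?thesis using dims by simp
  qed
  then have "\<forall>i<n. v $ i = 0" unfolding n_def by (rule left)
  then have "v = 0\<^sub>v n" using v(1) by (intro eq_vecI) auto
  with v(2) show False by simp
qed

lemma basic_solution_iff:
  "basic_solution A b B x \<longleftrightarrow> x \<in> carrier_vec (dim_col A) \<and> dim_vec b = dim_row A \<and>
     (\<forall>i<dim_row A. (\<Sum>j<dim_col A. A $$ (i, j) * x $ j) = b $ i) \<and>
     (\<forall>j<dim_col A. j \<notin> B \<longrightarrow> x $ j = 0)"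
proof (cases "x \<in> carrier_vec (dim_col A)")
  case True
  then have "(A *\<^sub>v x) $ i = (\<Sum>j<dim_col A. A $$ (i, j) * x $ j)" if "i < dim_row A" for i
    using that by (auto simp: scalar_prod_def lessThan_atLeast0 intro!: sum.cong)
  then show ?thesis unfolding basic_solution_def vec_eq_iff[of "A *\<^sub>v x"] by auto
qed (simp add: basic_solution_def)

lemma feasible_basis_iff_det:
  "feasible_basis A b B \<longleftrightarrow>
     B \<subseteq> {..<dim_col A} \<and> card B = dim_row A \<and> det (basis_mat A B) \<noteq> 0 \<and>
     (\<exists>x. basic_solution A b B x \<and> x \<ge> 0\<^sub>v (dim_col A))"
  unfolding feasible_basis_def using independent_columns_iff_det by blast

lemma det_basis_mat_nonzero_solve:
  fixes A :: "real mat"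
  assumes "finite B" "card B = dim_row A" "det (basis_mat A B) \<noteq> 0"
  shows "\<exists>f. \<forall>i<dim_row A. (\<Sum>j\<in>B. A $$ (i, j) * f j) = c i"
proof -
  define n where "n = dim_row A"
  have M: "basis_mat A B \<in> carrier_mat n n" by (simp add: basis_mat_def n_def assms)
  from det_non_zero_imp_unit[OF M assms(3), unfolded Units_def ring_mat_def]
  obtain N where N: "N \<in> carrier_mat n n" "basis_mat A B * N = 1\<^sub>m n" by auto
  define v where "v = N *\<^sub>v vec n c"
  have v: "v \<in> carrier_vec n" using N by (simp add: v_def)
  have "basis_mat A B *\<^sub>v v = (basis_mat A B * N) *\<^sub>v vec n c"
    unfolding v_def using assoc_mult_mat_vec[OF M N(1)] by simp
  then have Mv: "basis_mat A B *\<^sub>v v = vec n c" using N(2) by simp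
  obtain f where f: "v = vec (card B) (\<lambda>a. f (sorted_list_of_set B ! a))"
    using ex_sorted_nth_representation[OF assms(1), of v] v assms(2) n_def by auto
  have "(\<Sum>j\<in>B. A $$ (i, j) * f j) = c i" if "i < dim_row A" for i
    using basis_mat_mult[OF assms(1) that, of f] Mv that unfolding f[symmetric] n_def by simp
  then show ?thesis by blast
qed

text \<open>The ratio test. A nonnegative matrix without zero columns has no nonzero nonnegative
  kernel vector, so the entering direction must decrease some basic variable.\<close>

lemma ex_legal_cardinal_pivot:
  fixes A :: "real mat"
  assumes feas: "feasible_basis A b B" and jN: "j < dim_col A" and jB: "j \<notin> B"
    and nonneg: "\<And>i j. i < dim_row A \<Longrightarrow> j < dim_col A \<Longrightarrow> A $$ (i, j) \<ge> 0"
    and nonzero: "\<exists>i<dim_row A. A $$ (i, j) > 0"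
  shows "\<exists>l\<in>B. feasible_basis A b (insert j (B - {l}))"
proof -
  define N where "N = dim_col A"
  define n where "n = dim_row A"
  from feas obtain x where B: "B \<subseteq> {..<N}" "card B = n" "det (basis_mat A B) \<noteq> 0"
    and x: "basic_solution A b B x" "x \<ge> 0\<^sub>v N"
    unfolding feasible_basis_iff_det N_def n_def by blast
  have fin: "finite B" using B(1) finite_subset by blast
  have x0: "x $ i \<ge> 0" if "i < N" for i using x(2) that by (auto simp: less_eq_vec_def)
  have xc: "x \<in> carrier_vec N" and xs: "\<forall>i<n. (\<Sum>j<N. A $$ (i, j) * x $ j) = b $ i"
    and xz: "\<forall>j<N. j \<notin> B \<longrightarrow> x $ j = 0" and db: "dim_vec b = n"
    using x(1) unfolding basic_solution_iff N_def n_def by auto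
  have kerB: "\<forall>j\<in>B. f j = 0" if "\<forall>i<n. (\<Sum>j\<in>B. A $$ (i, j) * f j) = 0" for f
    using det_basis_mat_nonzero_iff[OF fin] B that unfolding n_def by blast
  obtain f where f: "\<forall>i<n. (\<Sum>h\<in>B. A $$ (i, h) * f h) = - A $$ (i, j)"
    using det_basis_mat_nonzero_solve[OF fin, of A "\<lambda>i. - A $$ (i, j)"] B unfolding n_def by blast
  \<comment> \<open>The direction of the pivot: the entering variable grows at rate one and the
    basic variables compensate, so \<open>y\<close> lies in the kernel of \<open>A\<close>.\<close>
  define y where "y h = (if h = j then 1 else if h \<in> B then f h else 0)" for h
  have sumB: "(\<Sum>h<N. A $$ (i, h) * g h) = A $$ (i, j) * g j + (\<Sum>h\<in>B. A $$ (i, h) * g h)"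
    if "\<And>h. h < N \<Longrightarrow> h \<notin> B \<Longrightarrow> h \<noteq> j \<Longrightarrow> g h = 0" for g :: "nat \<Rightarrow> real" and i
  proof -
    have "(\<Sum>h<N. A $$ (i, h) * g h) = (\<Sum>h\<in>insert j B. A $$ (i, h) * g h)"
      by (rule sum.mono_neutral_right) (use B(1) jN that in \<open>auto simp: N_def\<close>)
    then show ?thesis using fin jB by simp
  qed
  have yB: "(\<Sum>h\<in>B. A $$ (i, h) * y h) = (\<Sum>h\<in>B. A $$ (i, h) * f h)" for i
    by (rule sum.cong) (use jB in \<open>auto simp: y_def\<close>)
  have yker: "(\<Sum>h<N. A $$ (i, h) * y h) = 0" if "i < n" for i
    using sumB[of y i] yB[of i] f that by (auto simp: y_def)
  have neg: "\<exists>h\<in>B. y h < 0"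
  proof (rule ccontr)
    assume c: "\<not> ?thesis"
    obtain i where i: "i < n" "A $$ (i, j) > 0" using nonzero n_def by auto
    have "(\<Sum>h\<in>B. A $$ (i, h) * y h) \<ge> 0"
      by (rule sum_nonneg) (use c B(1) nonneg i in \<open>force simp: N_def n_def not_less\<close>)
    then show False using yker[OF i(1)] sumB[of y i] i(2) by (auto simp: y_def split: if_splits)
  qed
  define S where "S = {h\<in>B. y h < 0}"
  have S: "finite S" "S \<noteq> {}" using fin neg by (auto simp: S_def)
  define l where "l = arg_min_on (\<lambda>h. x $ h / - y h) S"
  have l: "l \<in> S" unfolding l_def by (rule arg_min_if_finite(1)[OF S])
  have min: "x $ l / - y l \<le> x $ h / - y h" if "h \<in> S" for h
    unfolding l_def using arg_min_least[OF S that, of "\<lambda>h. x $ h / - y h"] .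
  \<comment> \<open>The longest feasible step along \<open>y\<close>; it is zero when
    \<open>x $ l\<close> is already zero.\<close>
  define \<theta> where "\<theta> = x $ l / - y l"
  have lB: "l \<in> B" "y l < 0" using l by (auto simp: S_def)
  have \<theta>0: "\<theta> \<ge> 0" unfolding \<theta>_def using x0[of l] lB B(1) by (intro divide_nonneg_pos) auto
  define z where "z = vec N (\<lambda>h. x $ h + \<theta> * y h)"
  let ?B' = "insert j (B - {l})"
  have z0: "z $ h \<ge> 0" if "h < N" for h
  proof (cases "y h < 0")
    case True
    then have "h \<in> S" by (auto simp: S_def y_def split: if_splits)
    then have "\<theta> \<le> x $ h / - y h" using min unfolding \<theta>_def by blast
    then have "\<theta> * - y h \<le> x $ h" using True by (simp add: field_simps)
    then show ?thesis using that by (simp add: z_def)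
  next
    case False
    then have "0 \<le> \<theta> * y h" using \<theta>0 by simp
    then show ?thesis using that x0[OF that] by (simp add: z_def)
  qed
  have "(\<Sum>h<N. A $$ (i, h) * z $ h) = b $ i" if i: "i < n" for i
  proof -
    have "(\<Sum>h<N. A $$ (i, h) * z $ h) = (\<Sum>h<N. A $$ (i, h) * x $ h + \<theta> * (A $$ (i, h) * y h))"
      by (rule sum.cong) (auto simp: z_def algebra_simps)
    also have "\<dots> = (\<Sum>h<N. A $$ (i, h) * x $ h) + \<theta> * (\<Sum>h<N. A $$ (i, h) * y h)"
      by (simp add: sum.distrib sum_distrib_left)
    finally show ?thesis using xs yker i by simp
  qed
  moreover have "z $ h = 0" if "h < N" "h \<notin> ?B'" for h
    using that xz lB by (auto simp: z_def y_def \<theta>_def split: if_splits)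
  ultimately have sol: "basic_solution A b ?B' z"
    unfolding basic_solution_iff using db by (simp add: N_def n_def z_def)
  have B': "?B' \<subseteq> {..<N}" "card ?B' = n" "finite ?B'"
    using B jN fin jB card_Suc_Diff1[OF fin lB(1)] by (auto simp: N_def card_insert_if)
  have "\<forall>h\<in>?B'. g h = 0" if g: "\<forall>i<n. (\<Sum>h\<in>?B'. A $$ (i, h) * g h) = 0" for g
  proof -
    define g' where "g' h = (if h \<in> ?B' then g h else 0)" for h
    \<comment> \<open>Subtracting the multiple of \<open>y\<close> that cancels the entering
      coordinate turns a kernel vector of the new basis into one of the old basis. At
      \<open>l\<close>, where \<open>g'\<close> vanishes and \<open>y\<close> does not, this forces
      the multiple to be zero.\<close>
    define d where "d h = g' h - g j * y h" for h
    have "(\<Sum>h\<in>B. A $$ (i, h) * d h) = 0" if i: "i < n" for i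
    proof -
      have "(\<Sum>h<N. A $$ (i, h) * g' h) = (\<Sum>h\<in>?B'. A $$ (i, h) * g' h)"
        by (rule sum.mono_neutral_right) (use B' in \<open>auto simp: g'_def\<close>)
      also have "\<dots> = (\<Sum>h\<in>?B'. A $$ (i, h) * g h)" by (rule sum.cong) (auto simp: g'_def)
      finally have g'0: "(\<Sum>h<N. A $$ (i, h) * g' h) = 0" using g i by simp
      have "(\<Sum>h<N. A $$ (i, h) * d h)
        = (\<Sum>h<N. A $$ (i, h) * g' h) - g j * (\<Sum>h<N. A $$ (i, h) * y h)"
        by (simp add: d_def algebra_simps sum_subtractf sum_distrib_left)
      also have "\<dots> = 0" using g'0 yker[OF i] by simp
      finally show ?thesis using sumB[of d i] by (auto simp: d_def g'_def y_def)
    qed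
    then have d0: "\<forall>h\<in>B. d h = 0" using kerB by blast
    then have "g j * y l = 0" using lB jB by (auto simp: d_def g'_def split: if_splits)
    then have "g j = 0" using lB by simp
    moreover from this d0 have "g' h = 0" if "h \<in> B" for h using that by (simp add: d_def)
    ultimately show ?thesis unfolding g'_def by (metis DiffD1 insertE)
  qed
  then have "det (basis_mat A ?B') \<noteq> 0"
    using det_basis_mat_nonzero_iff[OF B'(3), of A] B'(2) unfolding n_def by blast
  moreover have "z \<ge> 0\<^sub>v N" using z0 by (auto simp: less_eq_vec_def z_def)
  ultimately have "feasible_basis A b ?B'"
    unfolding feasible_basis_iff_det using B' sol by (auto simp: N_def n_def)
  then show ?thesis using lB by blast
qed

section \<open>Ordinal bases\<close>

text \<open>With at least one row \<open>D\<close> is nonempty, so \<open>Min\<close> is a genuine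
  minimum.\<close>

lemma ordinal_basis_iff:
  assumes "dim_row C > 0"
  shows "ordinal_basis C D \<longleftrightarrow> D \<subseteq> {..<dim_col C} \<and> card D = dim_row C \<and>
     (\<forall>h<dim_col C. \<exists>i<dim_row C. \<forall>j\<in>D. C $$ (i, h) \<le> C $$ (i, j))"
proof -
  have "Min ((\<lambda>j. C $$ (i, j)) ` D) \<ge> C $$ (i, h) \<longleftrightarrow> (\<forall>j\<in>D. C $$ (i, h) \<le> C $$ (i, j))"
    if "D \<subseteq> {..<dim_col C}" "card D = dim_row C" for i h
  proof -
    have "finite D" using that finite_subset by blast
    moreover have "D \<noteq> {}" using that assms by auto
    ultimately show ?thesis by auto
  qed
  then show ?thesis unfolding ordinal_basis_def by blast
qed

text \<open>The rows are in bijection with the columns of an ordinal basis, a row corresponding to the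
  column attaining its minimum. Removing a column leaves exactly two rows sharing their minimizer,
  and a completing column takes over one of these rows; two columns taking over the same row
  cannot both be undominated.\<close>

locale row_injective =
  fixes C :: "nat mat"
  assumes inj: "i < dim_row C \<Longrightarrow> j < dim_col C \<Longrightarrow> j' < dim_col C \<Longrightarrow>
    C $$ (i, j) = C $$ (i, j') \<Longrightarrow> j = j'"
    and rows: "dim_row C > 0"
begin

lemma ordinal_basis_row:
  assumes D: "ordinal_basis C D" and d: "d \<in> D"
  shows "\<exists>i<dim_row C. \<forall>j\<in>D. C $$ (i, d) \<le> C $$ (i, j)"
  using assms unfolding ordinal_basis_iff[OF rows] by blast

text \<open>As entries within a row are distinct, choosing for each column a row where it is minimal
  is injective; \<open>D\<close> has as many columns as there are rows, so the choice is bijective.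
  Both rows are thus chosen for some column of \<open>D\<close>, and in either case that column is
  \<open>d\<close>.\<close>

lemma ordinal_basis_row_unique:
  assumes D: "ordinal_basis C D" and d: "d \<in> D"
    and i: "i < dim_row C" "\<forall>j\<in>D. C $$ (i, d) \<le> C $$ (i, j)"
    and i': "i' < dim_row C" "\<forall>j\<in>D. C $$ (i', d) \<le> C $$ (i', j)"
  shows "i = i'"
proof -
  have D1: "D \<subseteq> {..<dim_col C}" "card D = dim_row C" using D unfolding ordinal_basis_iff[OF rows] by auto
  obtain g where g: "\<And>d. d \<in> D \<Longrightarrow> g d < dim_row C \<and> (\<forall>j\<in>D. C $$ (g d, d) \<le> C $$ (g d, j))"
    using ordinal_basis_row[OF D] by metis
  have "inj_on g D"
  proof (rule inj_onI)
    fix a b assume "a \<in> D" "b \<in> D" "g a = g b"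
    then have "C $$ (g a, a) = C $$ (g a, b)" using g by (metis le_antisym)
    then show "a = b" using inj g \<open>a \<in> D\<close> \<open>b \<in> D\<close> D1 by blast
  qed
  then have "card (g ` D) = dim_row C" using D1 by (simp add: card_image)
  moreover have "g ` D \<subseteq> {..<dim_row C}" using g by auto
  ultimately have "g ` D = {..<dim_row C}" by (intro card_subset_eq) auto
  then obtain a a' where a: "a \<in> D" "g a = i" and a': "a' \<in> D" "g a' = i'"
    using i(1) i'(1) by (metis imageE lessThan_iff)
  have "C $$ (i, a) = C $$ (i, d)" using g[OF a(1)] a d i by (metis le_antisym)
  then have "a = d" using inj i(1) a(1) d D1 by blast
  have "C $$ (i', a') = C $$ (i', d)" using g[OF a'(1)] a' d i' by (metis le_antisym)
  then have "a' = d" using inj i'(1) a'(1) d D1 by blast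
  then show ?thesis using a a' \<open>a = d\<close> by simp
qed

lemma ordinal_pivot_unique:
  assumes x: "x \<notin> E" "ordinal_basis C (insert x E)"
    and y: "y \<notin> E" "ordinal_basis C (insert y E)"
    and z: "z \<notin> E" "ordinal_basis C (insert z E)"
    and xy: "x \<noteq> y" and xz: "x \<noteq> z"
  shows "y = z"
proof -
  have cols: "x < dim_col C" "y < dim_col C" "z < dim_col C" "E \<subseteq> {..<dim_col C}"
    using x y z unfolding ordinal_basis_iff[OF rows] by auto
  \<comment> \<open>The row that a completing column takes over. The inequality can be strict
    because \<open>u\<close> lies outside \<open>E\<close> and entries within a row are
    distinct.\<close>
  define role where "role u i \<longleftrightarrow> i < dim_row C \<and> (\<forall>j\<in>E. C $$ (i, u) < C $$ (i, j))" for u i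
  have role_ex: "\<exists>i. role u i" if u: "u \<notin> E" "ordinal_basis C (insert u E)" for u
  proof -
    have uc: "u < dim_col C" using u(2) unfolding ordinal_basis_iff[OF rows] by auto
    obtain i where i: "i < dim_row C" "\<forall>j\<in>insert u E. C $$ (i, u) \<le> C $$ (i, j)"
      using ordinal_basis_row[OF u(2)] by blast
    have "C $$ (i, u) < C $$ (i, j)" if "j \<in> E" for j
      using i inj[OF i(1) uc] that u(1) cols(4) by (metis insertCI le_neq_implies_less lessThan_iff subsetD)
    then show ?thesis using i(1) unfolding role_def by blast
  qed
  have role_unique: "role u i \<Longrightarrow> role u i' \<Longrightarrow> i = i'" if u: "u \<notin> E" "ordinal_basis C (insert u E)" for u i i'
    using ordinal_basis_row_unique[OF u(2), of u i i'] unfolding role_def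
    by (simp add: less_imp_le)
  have same_role: "u = v" if u: "u \<notin> E" "ordinal_basis C (insert u E)" "role u i"
    and v: "v \<notin> E" "ordinal_basis C (insert v E)" "role v i" for u v i
  proof -
    \<comment> \<open>Some row dominates \<open>v\<close> with respect to \<open>insert u E\<close>.
      There \<open>v\<close> is minimal in \<open>insert v E\<close> too, so it is the row
      \<open>i\<close> of \<open>v\<close>, where the entry of \<open>u\<close> is too
      small.\<close>
    have *: "\<not> C $$ (i, u) < C $$ (i, v)" if u: "u \<notin> E" "ordinal_basis C (insert u E)" "role u i"
      and v: "v \<notin> E" "ordinal_basis C (insert v E)" "role v i" for u v
    proof
      assume less: "C $$ (i, u) < C $$ (i, v)"
      have "v < dim_col C" using v(2) unfolding ordinal_basis_iff[OF rows] by auto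
      then obtain i' where i': "i' < dim_row C" "\<forall>j\<in>insert u E. C $$ (i', v) \<le> C $$ (i', j)"
        using u(2) unfolding ordinal_basis_iff[OF rows] by blast
      then have "\<forall>j\<in>insert v E. C $$ (i', v) \<le> C $$ (i', j)" by simp
      moreover have "\<forall>j\<in>insert v E. C $$ (i, v) \<le> C $$ (i, j)"
        using v(3) unfolding role_def by (simp add: less_imp_le)
      ultimately have "i' = i"
        using ordinal_basis_row_unique[OF v(2), of v i' i] i'(1) v(3) role_def by simp
      then show False using i' less by auto
    qed
    have "C $$ (i, u) = C $$ (i, v)" using *[OF u v] *[OF v u] by simp
    moreover have "u < dim_col C" "v < dim_col C" "i < dim_row C"
      using u v unfolding ordinal_basis_iff[OF rows] role_def by auto
    ultimately show ?thesis using inj by blast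
  qed
  have E_row: "\<exists>d\<in>E. (\<forall>j\<in>E. C $$ (i, d) \<le> C $$ (i, j))" if "E \<noteq> {}" for i
  proof -
    have "finite E" using cols(4) finite_subset by blast
    then show ?thesis
      using arg_min_if_finite(1)[of E "\<lambda>j. C $$ (i, j)"] arg_min_least[of E _ "\<lambda>j. C $$ (i, j)"] that
      by blast
  qed
  obtain a where a: "role x a" using role_ex[OF x] by blast
  obtain b where b: "role y b" using role_ex[OF y] by blast
  obtain c where c: "role z c" using role_ex[OF z] by blast
  have ab: "a \<noteq> b" using same_role[OF x a y] b xy by blast
  have ac: "a \<noteq> c" using same_role[OF x a z] c xz by blast
  have "b = c"
  proof (cases "E = {}")
    case True
    then have "dim_row C = 1" using x(2) unfolding ordinal_basis_iff[OF rows] by simp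
    then show ?thesis using b c unfolding role_def by simp
  next
    case False
    \<comment> \<open>Over \<open>E\<close> alone, \<open>d\<close> is minimal both in row
      \<open>a\<close>, which \<open>x\<close> vacates, and in the row \<open>s\<close> that it has
      in \<open>insert x E\<close>. A completing column must take one of these two rows;
      \<open>y\<close> and \<open>z\<close> do not take \<open>a\<close>, so both take
      \<open>s\<close>.\<close>
    obtain d where d: "d \<in> E" "\<forall>j\<in>E. C $$ (a, d) \<le> C $$ (a, j)" using E_row[OF False] by blast
    have not_min: "s = b" if s: "s < dim_row C" "s \<noteq> a" "\<forall>j\<in>E. C $$ (s, d) \<le> C $$ (s, j)"
      and b: "role y b" "y \<notin> E" "ordinal_basis C (insert y E)" "a \<noteq> b" for s y b
    proof (rule ccontr)
      assume "s \<noteq> b"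
      have above: "C $$ (t, d) \<le> C $$ (t, y)" if "t < dim_row C" "t \<noteq> b" "\<forall>j\<in>E. C $$ (t, d) \<le> C $$ (t, j)" for t
      proof (rule ccontr)
        assume "\<not> ?thesis"
        then have "role y t" using that unfolding role_def by (meson leI le_trans not_le order_less_le_trans)
        then show False using role_unique[OF b(2,3,1)] that(2) by blast
      qed
      have "s = a"
        by (rule ordinal_basis_row_unique[OF b(3), of d])
          (use d above s a b \<open>s \<noteq> b\<close> in \<open>auto simp: role_def\<close>)
      then show False using s by simp
    qed
    obtain s where s: "s < dim_row C" "\<forall>j\<in>insert x E. C $$ (s, d) \<le> C $$ (s, j)"
      using ordinal_basis_row[OF x(2), of d] d by blast
    have "s \<noteq> a" using s a d unfolding role_def by (metis insertI1 leD)
    then have "s = b" "s = c" using not_min[of s] s b c y z ab ac by auto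
    then show ?thesis by simp
  qed
  then show ?thesis using same_role[OF y b z] c by blast
qed

end

section \<open>Polynomial-time functions on trees\<close>

definition nat_poly :: "(nat \<Rightarrow> nat) \<Rightarrow> bool" where
  "nat_poly p \<longleftrightarrow> (\<exists>q :: nat poly. p = poly q)"

lemma nat_poly_const: "nat_poly (\<lambda>_. c)"
  unfolding nat_poly_def by (intro exI[of _ "[:c:]"]) auto

lemma nat_poly_id: "nat_poly (\<lambda>x. x)"
  unfolding nat_poly_def by (intro exI[of _ "[:0, 1:]"]) auto

lemma nat_poly_add:
  assumes "nat_poly p" "nat_poly q"
  shows "nat_poly (\<lambda>x. p x + q x)"
proof -
  obtain P Q where "p = poly P" "q = poly Q" using assms unfolding nat_poly_def by auto
  then show ?thesis unfolding nat_poly_def by (intro exI[of _ "P + Q"]) (simp add: fun_eq_iff)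
qed

lemma nat_poly_mult:
  assumes "nat_poly p" "nat_poly q"
  shows "nat_poly (\<lambda>x. p x * q x)"
proof -
  obtain P Q where "p = poly P" "q = poly Q" using assms unfolding nat_poly_def by auto
  then show ?thesis unfolding nat_poly_def by (intro exI[of _ "P * Q"]) (simp add: fun_eq_iff)
qed

lemma nat_poly_compose:
  assumes "nat_poly p" "nat_poly q"
  shows "nat_poly (\<lambda>x. p (q x))"
proof -
  obtain P Q where "p = poly P" "q = poly Q" using assms unfolding nat_poly_def by auto
  then show ?thesis unfolding nat_poly_def
    by (intro exI[of _ "pcompose P Q"]) (simp add: fun_eq_iff poly_pcompose)
qed

lemma nat_poly_Suc: "nat_poly p \<Longrightarrow> nat_poly (\<lambda>x. Suc (p x))"
  using nat_poly_add[OF _ nat_poly_const[of 1], of p] by simp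

lemma nat_poly_power:
  assumes "nat_poly p"
  shows "nat_poly (\<lambda>x. p x ^ m)"
proof -
  obtain P where "p = poly P" using assms unfolding nat_poly_def by auto
  then show ?thesis unfolding nat_poly_def by (intro exI[of _ "P ^ m"]) (simp add: fun_eq_iff)
qed

lemmas nat_poly_intros = nat_poly_const nat_poly_id nat_poly_add nat_poly_mult nat_poly_Suc
  nat_poly_power

text \<open>Coefficients in \<open>nat\<close> are nonnegative. Monotonicity lets a size bound be
  substituted into a time bound.\<close>

lemma nat_poly_mono: "nat_poly p \<Longrightarrow> mono p"
proof -
  have "mono (poly (q :: nat poly))" for q
    by (induction q) (auto simp: mono_def intro!: add_mono mult_mono)
  then show "nat_poly p \<Longrightarrow> mono p" unfolding nat_poly_def by auto
qed

text \<open>Bounding the size of the output as well as the time is necessary for closure under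
  composition: \<open>Pair Id Id\<close> doubles the size of a tree in constant time.\<close>

definition ptime :: "(tree \<Rightarrow> tree) \<Rightarrow> bool" where
  "ptime f \<longleftrightarrow> (\<exists>P p. nat_poly p \<and>
     (\<forall>x. size (f x) \<le> p (size x) \<and> (\<exists>t \<le> p (size x). exec P x t (f x))))"

lemma ptimeI:
  assumes "nat_poly p" "nat_poly q"
    and "\<And>x. size (f x) \<le> p (size x)" "\<And>x. \<exists>t \<le> q (size x). exec P x t (f x)"
  shows "ptime f"
proof -
  let ?r = "\<lambda>x. p x + q x"
  have "nat_poly ?r" using assms by (intro nat_poly_intros)
  moreover have "size (f x) \<le> ?r (size x) \<and> (\<exists>t \<le> ?r (size x). exec P x t (f x))" for x
    using assms(3,4)[of x] by (meson trans_le_add1 trans_le_add2)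
  ultimately show ?thesis unfolding ptime_def by blast
qed

lemma ptimeE:
  assumes "ptime f"
  obtains b F where "nat_poly b" "mono b" "\<forall>x. size (f x) \<le> b (size x)"
    "\<forall>x. \<exists>t \<le> b (size x). exec F x t (f x)"
  using assms nat_poly_mono unfolding ptime_def by blast

fun tleft :: "tree \<Rightarrow> tree" where
  "tleft (Node x y) = x"
| "tleft Null = Null"

fun tright :: "tree \<Rightarrow> tree" where
  "tright (Node x y) = y"
| "tright Null = Null"

lemma size_tleft: "size (tleft x) \<le> size x" by (cases x) auto
lemma size_tright: "size (tright x) \<le> size x" by (cases x) auto

lemma ptime_id: "ptime (\<lambda>x. x)"
  by (rule ptimeI[of "\<lambda>x. x" "\<lambda>x. 1" _ Id])
    (auto intro!: nat_poly_intros exI[of _ 1] exec.intros simp del: One_nat_def)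

lemma ptime_Null: "ptime (\<lambda>x. Null)"
  by (rule ptimeI[of "\<lambda>x. x" "\<lambda>x. 1" _ Empty])
    (auto intro!: nat_poly_intros exI[of _ 1] exec.intros simp del: One_nat_def)

lemma ptime_compose:
  assumes "ptime f" "ptime g"
  shows "ptime (\<lambda>x. g (f x))"
proof -
  obtain p F where p: "nat_poly p" "mono p" "\<And>x. size (f x) \<le> p (size x)"
    "\<And>x. \<exists>t \<le> p (size x). exec F x t (f x)" using assms(1) by (rule ptimeE) blast
  obtain q Q where q: "nat_poly q" "mono q" "\<And>x. size (g x) \<le> q (size x)"
    "\<And>x. \<exists>t \<le> q (size x). exec Q x t (g x)" using assms(2) by (rule ptimeE) blast
  have le: "q (size (f x)) \<le> q (p (size x))" for x using p(3) q(2) by (simp add: monoD)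
  show ?thesis
  proof (rule ptimeI[of "\<lambda>x. q (p x)" "\<lambda>x. p x + q (p x) + 1" _ "Then F Q"])
    show "nat_poly (\<lambda>x. q (p x))" "nat_poly (\<lambda>x. p x + q (p x) + 1)"
      by (intro nat_poly_compose[OF q(1) p(1)] nat_poly_intros p(1))+
    fix x
    show "size (g (f x)) \<le> q (p (size x))" using le q(3) order_trans by blast
    obtain s t where "s \<le> p (size x)" "exec F x s (f x)" "t \<le> q (size (f x))"
      "exec Q (f x) t (g (f x))" using p(4) q(4) by blast
    then show "\<exists>t\<le>p (size x) + q (p (size x)) + 1. exec (Then F Q) x t (g (f x))"
      using le[of x] by (intro exI[of _ "s + t + 1"]) (auto intro: exec.intros simp del: One_nat_def)
  qed
qed

lemma ptime_Node:
  assumes "ptime f" "ptime g"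
  shows "ptime (\<lambda>x. Node (f x) (g x))"
proof -
  obtain p F where p: "nat_poly p" "mono p" "\<And>x. size (f x) \<le> p (size x)"
    "\<And>x. \<exists>t \<le> p (size x). exec F x t (f x)" using assms(1) by (rule ptimeE) blast
  obtain q Q where q: "nat_poly q" "mono q" "\<And>x. size (g x) \<le> q (size x)"
    "\<And>x. \<exists>t \<le> q (size x). exec Q x t (g x)" using assms(2) by (rule ptimeE) blast
  show ?thesis
  proof (rule ptimeI[of "\<lambda>x. p x + q x + 1" "\<lambda>x. p x + q x + 1" _ "Pair F Q"])
    show "nat_poly (\<lambda>x. p x + q x + 1)" "nat_poly (\<lambda>x. p x + q x + 1)"
      by (intro nat_poly_intros p(1) q(1))+
    fix x
    show "size (Node (f x) (g x)) \<le> p (size x) + q (size x) + 1"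
      using p(3)[of x] q(3)[of x] by simp
    obtain s t where "s \<le> p (size x)" "exec F x s (f x)" "t \<le> q (size x)"
      "exec Q x t (g x)" using p(4) q(4) by blast
    then show "\<exists>t\<le>p (size x) + q (size x) + 1. exec (Pair F Q) x t (Node (f x) (g x))"
      by (intro exI[of _ "s + t + 1"]) (auto intro: exec.intros simp del: One_nat_def)
  qed
qed

lemma ptime_if:
  assumes "ptime c" "ptime f" "ptime g"
  shows "ptime (\<lambda>x. if c x \<noteq> Null then f x else g x)"
proof -
  obtain p F where p: "nat_poly p" "mono p" "\<And>x. size (f x) \<le> p (size x)"
    "\<And>x. \<exists>t \<le> p (size x). exec F x t (f x)" using assms(2) by (rule ptimeE) blast
  obtain q Q where q: "nat_poly q" "mono q" "\<And>x. size (g x) \<le> q (size x)"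
    "\<And>x. \<exists>t \<le> q (size x). exec Q x t (g x)" using assms(3) by (rule ptimeE) blast
  obtain r R where r: "nat_poly r" "mono r" "\<And>x. size (c x) \<le> r (size x)"
    "\<And>x. \<exists>t \<le> r (size x). exec R x t (c x)" using assms(1) by (rule ptimeE) blast
  show ?thesis
  proof (rule ptimeI[of "\<lambda>x. p x + q x" "\<lambda>x. r x + (p x + q x) + 1" _ "Cond R F Q"])
    show "nat_poly (\<lambda>x. p x + q x)" "nat_poly (\<lambda>x. r x + (p x + q x) + 1)"
      by (intro nat_poly_intros p(1) q(1) r(1))+
    fix x
    show "size (if c x \<noteq> Null then f x else g x) \<le> p (size x) + q (size x)"
      using p(3)[of x] q(3)[of x] by simp
    obtain s t u where *: "s \<le> p (size x)" "exec F x s (f x)" "t \<le> q (size x)"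
      "exec Q x t (g x)" "u \<le> r (size x)" "exec R x u (c x)" using p(4) q(4) r(4) by blast
    show "\<exists>t\<le>r (size x) + (p (size x) + q (size x)) + 1.
        exec (Cond R F Q) x t (if c x \<noteq> Null then f x else g x)"
    proof (cases "c x = Null")
      case True
      then show ?thesis using * exec.intros(10)[of R x u Q t "g x" F]
        by (intro exI[of _ "u + t + 1"]) auto
    next
      case False
      then show ?thesis using * exec.intros(9)[of R x u "c x" F s "f x" Q]
        by (intro exI[of _ "u + s + 1"]) auto
    qed
  qed
qed

lemma ptime_Left: "ptime tleft"
proof (rule ptimeI[of "\<lambda>x. x" "\<lambda>x. 1" _ Left])
  fix x show "\<exists>t\<le>1. exec Left x t (tleft x)"
    by (cases x) (auto intro!: exI[of _ 1] exec.intros simp del: One_nat_def)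
qed (auto intro!: nat_poly_intros size_tleft simp del: One_nat_def)

lemma ptime_Right: "ptime tright"
proof (rule ptimeI[of "\<lambda>x. x" "\<lambda>x. 1" _ Right])
  fix x show "\<exists>t\<le>1. exec Right x t (tright x)"
    by (cases x) (auto intro!: exI[of _ 1] exec.intros simp del: One_nat_def)
qed (auto intro!: nat_poly_intros size_tright simp del: One_nat_def)

lemmas ptime_tleft = ptime_compose[OF _ ptime_Left]
lemmas ptime_tright = ptime_compose[OF _ ptime_Right]

section \<open>Bounded iteration over encoded lists\<close>

fun telems :: "tree \<Rightarrow> tree list" where
  "telems Null = []"
| "telems (Node x y) = x # telems y"

abbreviation tlist :: "tree list \<Rightarrow> tree" where
  "tlist \<equiv> enc_list (\<lambda>x. x)"

lemma telems_tlist: "telems (tlist xs) = xs" by (induction xs) auto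
lemma tlist_telems: "tlist (telems x) = x" by (induction x) auto
lemma length_telems: "length (telems x) \<le> size x" by (induction x) auto
lemma size_telems: "e \<in> set (telems x) \<Longrightarrow> size e \<le> size x"
  by (induction x) (auto intro: le_SucI trans_le_add1 trans_le_add2)

lemma enc_list_tlist: "enc_list f xs = tlist (map f xs)" by (induction xs) auto

text \<open>Iterating a polynomial-time \<open>g\<close> can square or double the accumulator in
  every round, so a polynomial bound on all intermediate accumulators is demanded as a hypothesis.
  Given it, each round costs a fixed polynomial, and there are at most as many rounds as
  \<open>l x\<close> has nodes.\<close>

lemma ptime_fold:
  assumes l: "ptime l" and a: "ptime a" and g: "ptime g" and b: "nat_poly b"
    and bound: "\<And>x m. size (fold (\<lambda>e acc. g (Node x (Node e acc))) (take m (telems (l x))) (a x)) \<le> b (size x)"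
  shows "ptime (\<lambda>x. fold (\<lambda>e acc. g (Node x (Node e acc))) (telems (l x)) (a x))"
proof -
  let ?h = "\<lambda>x e acc. g (Node x (Node e acc))"
  obtain pl L where L: "nat_poly pl" "mono pl" "\<And>x. size (l x) \<le> pl (size x)"
    "\<And>x. \<exists>t \<le> pl (size x). exec L x t (l x)" using l by (rule ptimeE) blast
  obtain pa A where A: "nat_poly pa" "mono pa" "\<And>x. size (a x) \<le> pa (size x)"
    "\<And>x. \<exists>t \<le> pa (size x). exec A x t (a x)" using a by (rule ptimeE) blast
  \<comment> \<open>A loop state consists of the parameter \<open>x\<close>, the unread elements and
    the accumulator; \<open>x\<close> is carried along because \<open>g\<close> may consult
    it.\<close>
  define body where "body s = Node (tleft s) (Node (tright (tleft (tright s)))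
      (g (Node (tleft s) (Node (tleft (tleft (tright s))) (tright (tright s))))))" for s
  have "ptime body" unfolding body_def
    by (intro ptime_Node ptime_tleft ptime_tright ptime_id ptime_compose[OF _ g])
  then obtain pg G where G: "nat_poly pg" "mono pg" "\<And>x. size (body x) \<le> pg (size x)"
    "\<And>x. \<exists>t \<le> pg (size x). exec G x t (body x)" by (rule ptimeE) blast
  define c where "c = Then Right Left"
  have c: "exec c (Node x (Node r acc)) 3 r" for x r acc
    using exec.intros(8)[of Right "Node x (Node r acc)" 1 "Node r acc" Left 1 r]
    unfolding c_def by (auto intro: exec.intros simp del: One_nat_def)
  \<comment> \<open>\<open>M\<close> bounds the body on every state passed. A round adds 3 steps for
    the test and 1 for the loop itself; the closing 4 is the last, failing test.\<close>
  have loop: "\<exists>t \<le> length es * (M + 4) + 4. exec (Loop c G) (Node x (Node (tlist es) acc)) t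
      (Node x (Node Null (fold (?h x) es acc)))"
    if "\<And>m. m \<le> length es \<Longrightarrow>
      pg (size (Node x (Node (tlist (drop m es)) (fold (?h x) (take m es) acc)))) \<le> M"
    for x M es acc
    using that
  proof (induction es arbitrary: acc)
    case Nil
    show ?case using exec.intros(11)[OF c[of x Null acc], of G]
      by (intro exI[of _ 4]) simp
  next
    case (Cons e es)
    let ?s = "Node x (Node (tlist (e # es)) acc)"
    have "pg (size (Node x (Node (tlist (drop m es)) (fold (?h x) (take m es) (?h x e acc))))) \<le> M"
      if "m \<le> length es" for m using Cons.prems[of "Suc m"] that by simp
    then obtain u where u: "u \<le> length es * (M + 4) + 4" "exec (Loop c G)
      (Node x (Node (tlist es) (?h x e acc))) u (Node x (Node Null (fold (?h x) es (?h x e acc))))"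
      using Cons.IH by blast
    obtain t where t: "t \<le> pg (size ?s)" "exec G ?s t (body ?s)" using G(4) by blast
    have "t \<le> M" using t(1) Cons.prems[of 0] by simp
    moreover have "body ?s = Node x (Node (tlist es) (?h x e acc))" by (simp add: body_def)
    ultimately show ?case
      using exec.intros(12)[OF c[of x "tlist (e # es)" acc] _ t(2), of u] u
      by (intro exI[of _ "3 + t + u + 1"]) auto
  qed
  define P where "P = Then (Then (Pair Id (Pair L A)) (Loop c G)) (Then Right Right)"
  define Mx where "Mx s = pg (s + pl s + b s + 2)" for s
  let ?T = "\<lambda>s. (1 + (pl s + pa s + 1) + 1) + (pl s * (Mx s + 4) + 4) + 1 + 3 + 1"
  have np: "nat_poly Mx" unfolding Mx_def
    by (intro nat_poly_compose[OF G(1)] nat_poly_intros L A b)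
  show ?thesis
  proof (rule ptimeI[of b ?T _ P])
    show "nat_poly b" by (rule b)
    show "nat_poly ?T" by (intro nat_poly_intros L A np)
    fix x
    show "size (fold (?h x) (telems (l x)) (a x)) \<le> b (size x)"
      using bound[of x "length (telems (l x))"] by simp
    let ?es = "telems (l x)"
    have "pg (size (Node x (Node (tlist (drop m ?es)) (fold (?h x) (take m ?es) (a x))))) \<le> Mx (size x)"
      for m
    proof -
      have "size (tlist (drop m es)) \<le> size (tlist es)" for es
        by (induction es arbitrary: m) (auto simp: drop_Cons split: nat.splits intro: le_SucI trans_le_add2)
      from this[of ?es] have "size (tlist (drop m ?es)) \<le> pl (size x)"
        unfolding tlist_telems using L(3)[of x] by simp
      then show ?thesis unfolding Mx_def using bound[of x m] by (intro monoD[OF G(2)]) simp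
    qed
    then obtain t where t: "t \<le> length ?es * (Mx (size x) + 4) + 4" "exec (Loop c G)
       (Node x (Node (tlist ?es) (a x))) t (Node x (Node Null (fold (?h x) ?es (a x))))"
      using loop[of ?es x "a x" "Mx (size x)"] by blast
    have le: "length ?es \<le> pl (size x)" using length_telems[of "l x"] L(3)[of x] by simp
    have t': "t \<le> pl (size x) * (Mx (size x) + 4) + 4"
      by (rule order_trans[OF t(1) add_right_mono[OF mult_le_mono1[OF le]]])
    obtain s1 s2 where s: "s1 \<le> pl (size x)" "exec L x s1 (l x)" "s2 \<le> pa (size x)" "exec A x s2 (a x)"
      using L(4) A(4) by blast
    have "exec (Pair Id (Pair L A)) x (1 + (s1 + s2 + 1) + 1) (Node x (Node (tlist ?es) (a x)))"
      unfolding tlist_telems using s by (intro exec.intros)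
    from exec.intros(8)[OF exec.intros(8)[OF this t(2)]
      exec.intros(8)[OF exec.intros(5) exec.intros(5)]]
    have "exec P x ((1 + (s1 + s2 + 1) + 1) + t + 1 + (1 + 1 + 1) + 1) (fold (?h x) ?es (a x))"
      unfolding P_def .
    moreover have "(1 + (s1 + s2 + 1) + 1) + t + 1 + (1 + 1 + 1) + 1 \<le> ?T (size x)"
      using s t' by linarith
    ultimately show "\<exists>t\<le>?T (size x). exec P x t (fold (?h x) ?es (a x))" by blast
  qed
qed

text \<open>Only the number of list elements of \<open>n\<close> counts. Applied to two unary
  numbers this is truncated subtraction, applied to a list it prepares the access to an element by
  its index.\<close>

definition tdrop :: "tree \<Rightarrow> tree \<Rightarrow> tree" where
  "tdrop n x = fold (\<lambda>_. tright) (telems n) x"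

lemma size_fold_tright: "size (fold (\<lambda>_. tright) es x) \<le> size x"
  by (induction es arbitrary: x) (auto intro: order_trans[OF _ size_tright])

lemma ptime_tdrop:
  assumes "ptime f" "ptime g"
  shows "ptime (\<lambda>x. tdrop (f x) (g x))"
proof -
  obtain pa A where A: "nat_poly pa" "mono pa" "\<And>x. size (g x) \<le> pa (size x)"
    "\<And>x. \<exists>t \<le> pa (size x). exec A x t (g x)" using assms(2) by (rule ptimeE) blast
  have "ptime (\<lambda>x. fold (\<lambda>e acc. (\<lambda>s. tright (tright (tright s))) (Node x (Node e acc))) (telems (f x)) (g x))"
  proof (rule ptime_fold[OF assms _ A(1)])
    show "ptime (\<lambda>s. tright (tright (tright s)))" by (intro ptime_tright ptime_id)
    fix x m
    have "size (fold (\<lambda>_. tright) (take m (telems (f x))) (g x)) \<le> size (g x)"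
      by (rule size_fold_tright)
    also have "\<dots> \<le> pa (size x)" by (rule A)
    finally show "size (fold (\<lambda>e acc. tright (tright (tright (Node x (Node e acc)))))
      (take m (telems (f x))) (g x)) \<le> pa (size x)" by simp
  qed
  then show ?thesis by (simp add: tdrop_def)
qed

lemma size_fold_Node: "size (fold Node es a) = size (tlist es) + size a"
  by (induction es arbitrary: a) auto

definition trev :: "tree \<Rightarrow> tree" where
  "trev x = fold Node (telems x) Null"

lemma trev_tlist: "trev (tlist xs) = tlist (rev xs)"
proof -
  have "fold Node xs (tlist ys) = tlist (rev xs @ ys)" for ys
    by (induction xs arbitrary: ys) (metis fold_simps(1) append_Nil rev.simps(1), metis append.assoc append_Cons append_Nil enc_list.simps(2) fold_simps(2) rev.simps(2))
  from this[of "[]"] show ?thesis unfolding trev_def telems_tlist by simp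
qed

lemma size_tlist_take: "size (tlist (take m es)) \<le> size (tlist es)"
  by (induction es arbitrary: m) (auto simp: take_Cons split: nat.splits)

lemma ptime_trev:
  assumes "ptime f"
  shows "ptime (\<lambda>x. trev (f x))"
proof -
  obtain pa A where A: "nat_poly pa" "mono pa" "\<And>x. size (f x) \<le> pa (size x)"
    "\<And>x. \<exists>t \<le> pa (size x). exec A x t (f x)" using assms by (rule ptimeE) blast
  have "ptime (\<lambda>x. fold (\<lambda>e acc. tright (Node x (Node e acc))) (telems (f x)) Null)"
  proof (rule ptime_fold[OF assms ptime_Null _ A(1)])
    show "ptime tright" by (rule ptime_Right)
    fix x m
    have "size (fold Node (take m (telems (f x))) Null) \<le> size (f x)"
      using size_tlist_take[of m "telems (f x)"] by (simp add: size_fold_Node tlist_telems)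
    also have "\<dots> \<le> pa (size x)" by (rule A)
    finally show "size (fold (\<lambda>e acc. tright (Node x (Node e acc))) (take m (telems (f x))) Null)
       \<le> pa (size x)" by simp
  qed
  then show ?thesis by (simp add: trev_def)
qed

lemma fold_filter_Node:
  "fold (\<lambda>e acc. if c e then Node e acc else acc) es a = fold Node (filter c es) a"
  by (induction es arbitrary: a) auto

lemma size_tlist_filter: "size (tlist (filter c es)) \<le> size (tlist es)"
  by (induction es) auto

text \<open>Collecting the elements by a fold reverses them, hence the final \<open>trev\<close>.
  Every intermediate list consists of elements of the input list and is no larger than it.\<close>

lemma ptime_filter:
  assumes l: "ptime l" and c: "ptime c"
  shows "ptime (\<lambda>x. tlist (filter (\<lambda>e. c (Node x e) \<noteq> Null) (telems (l x))))"
proof -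
  obtain pa A where A: "nat_poly pa" "mono pa" "\<And>x. size (l x) \<le> pa (size x)"
    "\<And>x. \<exists>t \<le> pa (size x). exec A x t (l x)" using l by (rule ptimeE) blast
  define g where "g s = (if c (Node (tleft s) (tleft (tright s))) \<noteq> Null then tright s else tright (tright s))" for s
  have g: "ptime g" unfolding g_def
    by (intro ptime_if ptime_compose[OF _ c] ptime_Node ptime_tleft ptime_tright ptime_id)
  have geq: "g (Node x (Node e acc)) = (if c (Node x e) \<noteq> Null then Node e acc else acc)" for x e acc
    by (auto simp: g_def)
  have "ptime (\<lambda>x. fold (\<lambda>e acc. g (Node x (Node e acc))) (telems (l x)) Null)"
  proof (rule ptime_fold[OF l ptime_Null g A(1)])
    fix x m
    have "size (fold (\<lambda>e acc. g (Node x (Node e acc))) (take m (telems (l x))) Null) \<le> size (l x)"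
      using order_trans[OF size_tlist_filter size_tlist_take, of "\<lambda>e. c (Node x e) \<noteq> Null" m "telems (l x)"]
      by (simp add: geq fold_filter_Node size_fold_Node tlist_telems)
    also have "\<dots> \<le> pa (size x)" by (rule A)
    finally show "size (fold (\<lambda>e acc. g (Node x (Node e acc))) (take m (telems (l x))) Null)
       \<le> pa (size x)" .
  qed
  then have "ptime (\<lambda>x. trev (fold (\<lambda>e acc. g (Node x (Node e acc))) (telems (l x)) Null))"
    by (rule ptime_trev)
  moreover have "fold (\<lambda>e acc. g (Node x (Node e acc))) (telems (l x)) Null
      = trev (tlist (filter (\<lambda>e. c (Node x e) \<noteq> Null) (telems (l x))))" for x
    by (simp add: geq fold_filter_Node trev_def telems_tlist)
  ultimately show ?thesis by (simp add: trev_tlist)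
qed

lemma fold_map_Node:
  "fold (\<lambda>e acc. Node (h e) acc) es a = fold Node (map h es) a"
  by (induction es arbitrary: a) auto

lemma ptime_map:
  assumes l: "ptime l" and h: "ptime h"
  shows "ptime (\<lambda>x. tlist (map (\<lambda>e. h (Node x e)) (telems (l x))))"
proof -
  obtain pa A where A: "nat_poly pa" "mono pa" "\<And>x. size (l x) \<le> pa (size x)"
    "\<And>x. \<exists>t \<le> pa (size x). exec A x t (l x)" using l by (rule ptimeE) blast
  obtain ph H where H: "nat_poly ph" "mono ph" "\<And>x. size (h x) \<le> ph (size x)"
    "\<And>x. \<exists>t \<le> ph (size x). exec H x t (h x)" using h by (rule ptimeE) blast
  define g where "g s = Node (h (Node (tleft s) (tleft (tright s)))) (tright (tright s))" for s
  have g: "ptime g" unfolding g_def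
    by (intro ptime_compose[OF _ h] ptime_Node ptime_tleft ptime_tright ptime_id)
  have gfold: "fold (\<lambda>e acc. g (Node x (Node e acc))) es Null
      = fold Node (map (\<lambda>e. h (Node x e)) es) Null" for x es
    using fold_map_Node[of "\<lambda>e. h (Node x e)" es Null] by (simp add: g_def)
  \<comment> \<open>Number of elements times the size of an image plus its list cell. An element is
    no larger than the list, which bounds the argument \<open>Node x e\<close> of
    \<open>h\<close>.\<close>
  let ?b = "\<lambda>s. pa s * (ph (s + pa s + 1) + 1)"
  have b: "nat_poly ?b" by (intro nat_poly_intros nat_poly_compose[OF H(1)] A(1))
  have "ptime (\<lambda>x. fold (\<lambda>e acc. g (Node x (Node e acc))) (telems (l x)) Null)"
  proof (rule ptime_fold[OF l ptime_Null g b])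
    fix x m
    have sum: "size (tlist (map (\<lambda>e. h (Node x e)) es)) \<le> length es * (ph (size x + pa (size x) + 1) + 1)"
      if "set es \<subseteq> set (telems (l x))" for es
      using that
    proof (induction es)
      case (Cons e es)
      have "size (h (Node x e)) \<le> ph (size (Node x e))" by (rule H)
      also have "\<dots> \<le> ph (size x + pa (size x) + 1)"
        using size_telems[of e "l x"] A(3)[of x] Cons.prems by (intro monoD[OF H(2)]) auto
      finally show ?case using Cons by auto
    qed simp
    have "size (fold (\<lambda>e acc. g (Node x (Node e acc))) (take m (telems (l x))) Null)
      = size (tlist (map (\<lambda>e. h (Node x e)) (take m (telems (l x)))))"
      by (simp add: gfold size_fold_Node)
    also have "\<dots> \<le> length (take m (telems (l x))) * (ph (size x + pa (size x) + 1) + 1)"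
      by (rule sum) (rule set_take_subset)
    also have "\<dots> \<le> ?b (size x)"
      using length_telems[of "l x"] A(3)[of x] by (intro mult_le_mono1) simp
    finally show "size (fold (\<lambda>e acc. g (Node x (Node e acc))) (take m (telems (l x))) Null) \<le> ?b (size x)" .
  qed
  then have "ptime (\<lambda>x. trev (fold (\<lambda>e acc. g (Node x (Node e acc))) (telems (l x)) Null))"
    by (rule ptime_trev)
  moreover have "fold (\<lambda>e acc. g (Node x (Node e acc))) (telems (l x)) Null
      = trev (tlist (map (\<lambda>e. h (Node x e)) (telems (l x))))" for x
    by (simp add: gfold trev_def telems_tlist)
  ultimately show ?thesis by (simp add: trev_tlist)
qed

section \<open>Gale--Shapley with delayed arrivals\<close>

text \<open>The same unbounded \<open>LEAST\<close> as in \<open>edge_rank\<close>, so that ranks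
  translate into positions directly; for members of the list it is the first occurrence.\<close>

definition idx :: "'a list \<Rightarrow> 'a \<Rightarrow> nat" where
  "idx xs a = (LEAST l. xs ! l = a)"

lemma idx_nth: "distinct xs \<Longrightarrow> r < length xs \<Longrightarrow> idx xs (xs ! r) = r"
  unfolding idx_def
proof (rule Least_equality)
  fix l assume *: "distinct xs" "r < length xs" "xs ! l = xs ! r"
  show "r \<le> l"
  proof (rule ccontr)
    assume "\<not> r \<le> l"
    then show False using * nth_eq_iff_index_eq[of xs l r] by simp
  qed
qed simp

lemma
  assumes "a \<in> set xs"
  shows nth_idx: "xs ! idx xs a = a" and idx_less: "idx xs a < length xs"
proof -
  obtain r where r: "r < length xs" "xs ! r = a" using assms by (auto simp: in_set_conv_nth)
  show "xs ! idx xs a = a" unfolding idx_def by (rule LeastI[of _ r]) (rule r)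
  have "idx xs a \<le> r" unfolding idx_def by (rule Least_le) (rule r)
  with r show "idx xs a < length xs" by simp
qed

locale marriage =
  fixes k :: nat and mp wp :: "nat \<Rightarrow> nat list"
  assumes k: "1 \<le> k" and complete: "complete_instance k mp wp"
begin

lemma mp: "i < k \<Longrightarrow> distinct (mp i)" "i < k \<Longrightarrow> set (mp i) = {..<k}" "i < k \<Longrightarrow> length (mp i) = k"
  and wp: "i < k \<Longrightarrow> distinct (wp i)" "i < k \<Longrightarrow> set (wp i) = {..<k}" "i < k \<Longrightarrow> length (wp i) = k"
proof -
  show *: "distinct (mp i)" "set (mp i) = {..<k}" "distinct (wp i)" "set (wp i) = {..<k}" if "i < k" for i
    using complete that unfolding complete_instance_def by auto
  show "length (mp i) = k" "length (wp i) = k" if "i < k" for i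
    using *[OF that] distinct_card by fastforce+
qed

lemma mp_nth: "i < k \<Longrightarrow> r < k \<Longrightarrow> mp i ! r < k"
  using mp nth_mem by (metis lessThan_iff)

abbreviation mr :: "nat \<Rightarrow> nat \<Rightarrow> nat" where
  "mr i w \<equiv> idx (mp i) w"

abbreviation wr :: "nat \<Rightarrow> nat \<Rightarrow> nat" where
  "wr w i \<equiv> idx (wp w) i"

lemma mr_less: "i < k \<Longrightarrow> w < k \<Longrightarrow> mr i w < k"
  using mp idx_less by (metis lessThan_iff)

lemma mp_mr: "i < k \<Longrightarrow> w < k \<Longrightarrow> mp i ! mr i w = w"
  using mp nth_idx by (metis lessThan_iff)

lemma mr_mp: "i < k \<Longrightarrow> r < k \<Longrightarrow> mr i (mp i ! r) = r"
  using mp idx_nth by metis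

lemma wr_less: "w < k \<Longrightarrow> i < k \<Longrightarrow> wr w i < k"
  using wp idx_less by (metis lessThan_iff)

lemma wr_inj: "w < k \<Longrightarrow> i < k \<Longrightarrow> i' < k \<Longrightarrow> wr w i = wr w i' \<Longrightarrow> i = i'"
  using wp nth_idx by (metis lessThan_iff)

text \<open>Man \<open>0\<close> arrives last, because his loop is the one missing from the initial \<open>D\<close>. \<open>act p\<close> is the set of men that have arrived when \<open>p\<close> is the most recent arrival.\<close>

definition act :: "nat \<Rightarrow> nat set" where
  "act p = (if p = 0 then {..<k} else {1..p})"

text \<open>An edge with a man whom \<open>w\<close> likes less than her best rejected one would
  have the smaller entry in her row and displace the rejected edge as its minimum; strictness also
  rules out repeating a proposal to a woman whose best rejected man is \<open>i\<close>.\<close>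

definition acceptable :: "(nat \<Rightarrow> nat option) \<Rightarrow> nat \<Rightarrow> nat \<Rightarrow> bool" where
  "acceptable rej i w \<longleftrightarrow> (\<forall>i'. rej w = Some i' \<longrightarrow> wr w i < wr w i')"

text \<open>A link leads from a held man to the man whom his woman rejected last; her rejections
  improve over time, so the best rejected man is also the latest. The pending man has no outgoing
  link.\<close>

definition rejections :: "nat set \<Rightarrow> nat \<Rightarrow> (nat \<Rightarrow> nat) \<Rightarrow> (nat \<Rightarrow> nat option) \<Rightarrow> (nat \<times> nat) set" where
  "rejections M q pos rej = {(i, i'). i \<in> M \<and> i \<noteq> q \<and> rej (mp i ! pos i) = Some i'}"

end

text \<open>\<open>p\<close> is the latest arrival and \<open>q\<close> the man whose proposal is pending; \<open>pos i\<close> is the position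
  on \<open>i\<close>'s list of his latest proposal, and \<open>rej w\<close> the best man rejected by \<open>w\<close> so far. The
  time stamps \<open>T\<close> record the order of the latest decisions of the women.\<close>

locale gs_state = marriage +
  fixes p q :: nat and pos :: "nat \<Rightarrow> nat" and rej :: "nat \<Rightarrow> nat option" and T :: "nat \<Rightarrow> nat"
  assumes p_less: "p < k"
    and q_act: "q \<in> act p"
    and pos_less: "i \<in> act p \<Longrightarrow> pos i < k"
    and held_inj: "inj_on (\<lambda>i. mp i ! pos i) (act p - {q})"
    and rejected: "w < k \<Longrightarrow> rej w = Some i \<Longrightarrow> i \<in> act p \<and> mr i w < pos i \<and>
      (\<exists>h\<in>act p - {q}. mp h ! pos h = w \<and> wr w h < wr w i)"
    and passed: "i \<in> act p \<Longrightarrow> r < pos i \<Longrightarrow>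
      \<exists>i'. rej (mp i ! r) = Some i' \<and> wr (mp i ! r) i' \<le> wr (mp i ! r) i"
    and pending: "acceptable rej q (mp q ! pos q)"
    and stamps: "w < k \<Longrightarrow> rej w = Some i \<Longrightarrow> i \<noteq> q \<Longrightarrow> T w < T (mp i ! pos i)"
    and chain: "(p, q) \<in> (rejections (act p) q pos rej)\<^sup>*"
begin

definition wm :: "nat \<Rightarrow> nat" where
  "wm i = mp i ! pos i"

lemma act_less: "i \<in> act p \<Longrightarrow> i < k"
  using p_less by (auto simp: act_def split: if_splits)

lemma finite_act: "finite (act p)"
  by (simp add: act_def)

lemma wm_less: "i \<in> act p \<Longrightarrow> wm i < k"
  using mp_nth act_less pos_less unfolding wm_def by blast

lemma card_act_le: "card (act p) \<le> k"
  using card_mono[of "{..<k}" "act p"] act_less by auto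

lemma p_act: "p \<in> act p"
  using p_less k by (auto simp: act_def)

text \<open>The deciding woman receives a stamp above all others. This settles the men who are with
  her; elsewhere neither of the two stamps changes, since \<open>w\<close> is a different
  woman.\<close>

lemma stamps_raise:
  defines "T' \<equiv> T(wm q := Suc (Max (T ` {..<k})))"
  assumes "w < k" "w \<noteq> wm q" "rej w = Some i" "i \<noteq> q \<or> wm i = wm q"
  shows "T' w < T' (wm i)"
proof -
  have max: "T w < Suc (Max (T ` {..<k}))" using assms(2) by (simp add: less_Suc_eq_le)
  show ?thesis
  proof (cases "wm i = wm q")
    case True
    then show ?thesis unfolding T'_def using max assms(3) by (simp only: fun_upd_apply if_False if_True simp_thms)
  next
    case False
    then show ?thesis using stamps[of w i] assms(2-5) unfolding T'_def wm_def by simp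
  qed
qed

text \<open>A woman who has rejected nobody finds everybody acceptable, and she occurs at position
  \<open>a\<close> or later because all women before it have rejected someone. Hence the first
  acceptable position exists.\<close>

lemma ex_first_acceptable:
  assumes i: "i < k" and free: "\<exists>w<k. rj w = None" and a: "\<And>r. r < a \<Longrightarrow> rj (mp i ! r) \<noteq> None"
  shows "\<exists>r\<ge>a. r < k \<and> acceptable rj i (mp i ! r) \<and> (\<forall>r'. a \<le> r' \<and> r' < r \<longrightarrow> \<not> acceptable rj i (mp i ! r'))"
proof -
  obtain w where w: "w < k" "rj w = None" using free by blast
  define r0 where "r0 = mr i w"
  have r0: "r0 < k" "mp i ! r0 = w" using mr_less mp_mr i w unfolding r0_def by auto
  let ?Q = "\<lambda>r. a \<le> r \<and> acceptable rj i (mp i ! r)"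
  have Q0: "?Q r0" using a[of r0] r0 w by (auto simp: acceptable_def not_less[symmetric])
  define r where "r = (LEAST r. ?Q r)"
  have "?Q r" unfolding r_def by (rule LeastI[of ?Q, OF Q0])
  moreover have "r \<le> r0" unfolding r_def by (rule Least_le[of ?Q, OF Q0])
  moreover have "\<not> ?Q r'" if "r' < r" for r' using that not_less_Least unfolding r_def by blast
  ultimately show ?thesis using r0(1) by (intro exI[of _ r]) auto
qed

text \<open>Pigeonhole: every woman who has rejected somebody holds a man of \<open>H\<close>, and
  there are fewer than \<open>k\<close> of them.\<close>

lemma ex_never_rejecting:
  assumes "H \<subseteq> act p" "card H < k" "\<And>w. w < k \<Longrightarrow> rj w \<noteq> None \<Longrightarrow> \<exists>h\<in>H. wm h = w"
  shows "\<exists>w<k. rj w = None"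
proof (rule ccontr)
  assume "\<not> ?thesis"
  then have "{..<k} \<subseteq> wm ` H" using assms(3) by blast
  then have "k \<le> card (wm ` H)" using card_mono finite_subset[OF assms(1) finite_act]
    by (metis card_lessThan finite_imageI)
  also have "\<dots> \<le> card H" using card_image_le finite_subset[OF assms(1) finite_act] by blast
  finally show False using assms(2) by simp
qed

text \<open>The woman receiving the pending proposal already holds \<open>h\<close>: she keeps the better of \<open>q\<close>
  and \<open>h\<close>, and the loser \<open>l\<close> proposes next.\<close>

lemma next_rejection:
  assumes h: "h \<in> act p" "h \<noteq> q" "wm h = wm q"
  defines "l \<equiv> (if wr (wm q) q < wr (wm q) h then h else q)"
  shows "\<exists>r T'. pos l < r \<and>
    gs_state k mp wp p l (pos(l := r)) (rej(wm q := Some l)) T'"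
proof -
  define w where "w = wm q"
  define v where "v = (if wr w q < wr w h then q else h)"
  define rej' where "rej' = rej(w := Some l)"
  define T' where "T' = T(w := Suc (Max (T ` {..<k})))"
  have wk: "w < k" using wm_less q_act w_def by blast
  have lv: "l \<in> act p" "v \<in> act p" "wm l = w" "wm v = w" "l \<noteq> v"
    using h q_act unfolding l_def v_def w_def by auto
  have l_cases: "l = q \<and> v = h \<or> l = h \<and> v = q" unfolding l_def v_def w_def by auto
  have wlv: "wr w v < wr w l"
  proof -
    have "wr w q \<noteq> wr w h" using wr_inj[OF wk, of q h] h act_less q_act by blast
    then show ?thesis unfolding l_def v_def w_def by auto
  qed
  have held_unique: "i = i'" if "i \<in> act p - {q}" "i' \<in> act p - {q}" "wm i = wm i'" for i i'
    using held_inj that unfolding inj_on_def wm_def by blast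
  \<comment> \<open>Rejections only improve: if \<open>q\<close> loses, he was acceptable to
    \<open>w\<close>; if \<open>h\<close> loses, he is the holder who already beats the men rejected
    before.\<close>
  have better: "wr w l < wr w i" if rw: "rej w = Some i" for i
  proof (cases "l = q")
    case True
    then show ?thesis using pending that unfolding acceptable_def w_def wm_def by blast
  next
    case False
    then have "l = h" using l_cases by blast
    obtain h' where h': "h' \<in> act p - {q}" "wm h' = w" "wr w h' < wr w i"
      using rejected[OF wk rw] unfolding wm_def by blast
    then have "h' = h" using held_unique[of h' h] h w_def by auto
    then show ?thesis using h' \<open>l = h\<close> by simp
  qed
  have held': "\<exists>h\<in>act p - {l}. wm h = w' \<and> wr w' h < wr w' i"
    if w': "w' < k" "rej' w' = Some i" for w' i
  proof (cases "w' = w")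
    case True
    then show ?thesis using w' lv wlv unfolding rej'_def by auto
  next
    case False
    then obtain h' where h': "h' \<in> act p - {q}" "wm h' = w'" "wr w' h' < wr w' i"
      using rejected[of w' i] w' unfolding rej'_def wm_def by auto
    moreover have "h' \<noteq> l" using h' False lv by auto
    ultimately show ?thesis by blast
  qed
  \<comment> \<open>The loser holds no woman any more, so at most \<open>k - 1\<close> men are
    held.\<close>
  have "card (act p - {l}) < k"
    using card_Diff1_less[OF finite_act lv(1)] card_act_le by simp
  then have free: "\<exists>w<k. rej' w = None"
    using ex_never_rejecting[of "act p - {l}" rej'] held' by blast
  have "rej' (mp l ! r) \<noteq> None" if "r < Suc (pos l)" for r
  proof (cases "r = pos l")
    case True
    then show ?thesis using lv unfolding rej'_def wm_def by simp
  next
    case False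
    then show ?thesis using passed[OF lv(1), of r] that unfolding rej'_def by auto
  qed
  then obtain r where r: "r \<ge> Suc (pos l)" "r < k" "acceptable rej' l (mp l ! r)"
    "\<And>r'. Suc (pos l) \<le> r' \<Longrightarrow> r' < r \<Longrightarrow> \<not> acceptable rej' l (mp l ! r')"
    using ex_first_acceptable[OF act_less[OF lv(1)] free, of "Suc (pos l)"] by blast
  define pos' where "pos' = pos(l := r)"
  have wm': "mp i ! pos' i = wm i" if "i \<noteq> l" for i using that unfolding pos'_def wm_def by simp
  have "gs_state k mp wp p l pos' rej' T'"
  proof (unfold_locales)
    show "p < k" by (rule p_less)
    show "l \<in> act p" by (rule lv)
    show "pos' i < k" if "i \<in> act p" for i using that r pos_less unfolding pos'_def by simp
    show "inj_on (\<lambda>i. mp i ! pos' i) (act p - {l})"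
    proof (rule inj_onI)
      fix i i' assume i: "i \<in> act p - {l}" "i' \<in> act p - {l}" "mp i ! pos' i = mp i' ! pos' i'"
      then have e: "wm i = wm i'" using wm' by simp
      show "i = i'"
      proof (cases "l = q")
        case True
        then show ?thesis using held_unique e i by blast
      next
        case False
        then have "l = h" "v = q" using l_cases by auto
        then show ?thesis using held_unique e i h by (metis Diff_iff insertE empty_iff insertI1)
      qed
    qed
    show "i \<in> act p \<and> mr i w' < pos' i \<and>
      (\<exists>h\<in>act p - {l}. mp h ! pos' h = w' \<and> wr w' h < wr w' i)" if w': "w' < k" "rej' w' = Some i" for w' i
    proof -
      have "i \<in> act p \<and> mr i w' < pos' i"
      proof (cases "w' = w")
        case True
        then have "i = l" using w' unfolding rej'_def by simp
        moreover have "mr l w = pos l"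
          using mr_mp[OF act_less pos_less, of l] lv unfolding wm_def by auto
        ultimately show ?thesis using True lv r unfolding pos'_def by simp
      next
        case False
        then have "i \<in> act p \<and> mr i w' < pos i" using rejected[of w' i] w' unfolding rej'_def by simp
        then show ?thesis using r unfolding pos'_def by auto
      qed
      then show ?thesis using held'[OF w'] wm' by auto
    qed
    show "\<exists>i'. rej' (mp i ! r') = Some i' \<and> wr (mp i ! r') i' \<le> wr (mp i ! r') i"
      if i: "i \<in> act p" "r' < pos' i" for i r'
    proof (cases "r' < pos i")
      case True
      then obtain i' where i': "rej (mp i ! r') = Some i'" "wr (mp i ! r') i' \<le> wr (mp i ! r') i"
        using passed i by blast
      then show ?thesis using better[of i'] unfolding rej'_def by auto
    next
      case False
      then have il: "i = l" using i unfolding pos'_def by (auto split: if_splits)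
      show ?thesis
      proof (cases "r' = pos l")
        case True
        then show ?thesis using il lv unfolding rej'_def wm_def by simp
      next
        case neq: False
        then have "\<not> acceptable rej' l (mp l ! r')"
          using False il i r unfolding pos'_def by simp
        then show ?thesis using il unfolding acceptable_def by (auto simp: not_less)
      qed
    qed
    show "acceptable rej' l (mp l ! pos' l)" using r unfolding pos'_def by simp
    show "T' w' < T' (mp i ! pos' i)" if w': "w' < k" "rej' w' = Some i" "i \<noteq> l" for w' i
    proof -
      have "w' \<noteq> w" using w' unfolding rej'_def by auto
      moreover from this have "rej w' = Some i" using w' unfolding rej'_def by simp
      ultimately show ?thesis
        using stamps_raise[of w' i] w' wm'[of i] unfolding T'_def w_def by auto
    qed
    have sub: "(i, i') \<in> rejections (act p) l pos' rej'"
      if "(i, i') \<in> rejections (act p) q pos rej" "i \<noteq> h" for i i'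
    proof -
      have i: "i \<in> act p" "i \<noteq> q" "rej (wm i) = Some i'"
        using that(1) unfolding rejections_def wm_def by auto
      then have "wm i \<noteq> w" using held_unique[of i h] h that(2) w_def by auto
      moreover from this have il: "i \<noteq> l" using lv(3) by blast
      ultimately have "rej' (mp i ! pos' i) = Some i'" using i unfolding rej'_def wm'[OF il] by simp
      then show ?thesis using i il unfolding rejections_def by auto
    qed
    have vl: "(v, l) \<in> rejections (act p) l pos' rej'"
      using lv wm'[of v] unfolding rejections_def rej'_def by auto
    \<comment> \<open>Among the held men only \<open>h\<close> has a woman whose last rejection
      changes. If a chain meets \<open>h\<close>, it either ends there, when \<open>h\<close> is the
      loser, or continues by the new link to \<open>l = q\<close>. A chain that reaches
      \<open>q\<close> is prolonged by the new link when \<open>q\<close> wins.\<close>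
    have "(i, l) \<in> (rejections (act p) l pos' rej')\<^sup>*"
      if "(i, q) \<in> (rejections (act p) q pos rej)\<^sup>*" for i
      using that
    proof (induction rule: converse_rtrancl_induct)
      case base
      then show ?case using vl l_cases by auto
    next
      case (step i i')
      show ?case
      proof (cases "i = h")
        case True
        then show ?thesis using vl l_cases by auto
      next
        case False
        then show ?thesis using sub[OF step.hyps(1)] step.IH by (meson converse_rtrancl_into_rtrancl)
      qed
    qed
    then show "(p, l) \<in> (rejections (act p) l pos' rej')\<^sup>*" using chain by blast
  qed
  then show ?thesis using r(1) unfolding pos'_def rej'_def w_def by (intro exI[of _ r]) auto
qed

text \<open>The woman receiving the pending proposal was free: the next man arrives.\<close>

lemma next_arrival:
  assumes free: "\<And>h. h \<in> act p \<Longrightarrow> h \<noteq> q \<Longrightarrow> wm h \<noteq> wm q" and p0: "p \<noteq> 0"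
  defines "p' \<equiv> Suc p mod k"
  shows "act p' = insert p' (act p) \<and> p' \<notin> act p \<and>
    (\<exists>r T'. gs_state k mp wp p' p' (pos(p' := r)) rej T')"
proof -
  define T' where "T' = T(wm q := Suc (Max (T ` {..<k})))"
  have p'k: "p' < k" unfolding p'_def using k by simp
  have actp: "act p = {1..p}" using p0 unfolding act_def by simp
  have p': "p' = (if Suc p = k then 0 else Suc p)" unfolding p'_def using p_less by auto
  have act': "act p' = insert p' (act p)" "p' \<notin> act p"
    using p0 p_less p' by (auto simp: act_def split: if_splits)
  have "act p \<subset> {..<k}" using act_less act'(2) p'k by auto
  then have "card (act p) < k" using psubset_card_mono[of "{..<k}"] by simp
  moreover have held: "\<exists>h\<in>act p - {q}. wm h = w \<and> wr w h < wr w i" if "w < k" "rej w = Some i" for w i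
    using rejected[OF that] unfolding wm_def by blast
  ultimately have "\<exists>w<k. rej w = None" using ex_never_rejecting[of "act p" rej] by blast
  then obtain r where r: "r < k" "acceptable rej p' (mp p' ! r)"
    "\<And>r'. r' < r \<Longrightarrow> \<not> acceptable rej p' (mp p' ! r')"
    using ex_first_acceptable[OF p'k, of rej 0] by auto
  define pos' where "pos' = pos(p' := r)"
  have wm': "mp i ! pos' i = wm i" if "i \<in> act p" for i
    using that act' unfolding pos'_def wm_def by auto
  have "gs_state k mp wp p' p' pos' rej T'"
  proof (unfold_locales)
    show "p' < k" by (rule p'k)
    show "p' \<in> act p'" using act' by simp
    show "pos' i < k" if "i \<in> act p'" for i using that act' r pos_less unfolding pos'_def by auto
    have "inj_on wm (act p)"
      using held_inj free unfolding inj_on_def wm_def by (metis DiffI singletonD)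
    then show "inj_on (\<lambda>i. mp i ! pos' i) (act p' - {p'})"
      using act' wm' by (simp add: inj_on_def)
    show "i \<in> act p' \<and> mr i w < pos' i \<and>
      (\<exists>h\<in>act p' - {p'}. mp h ! pos' h = w \<and> wr w h < wr w i)" if w: "w < k" "rej w = Some i" for w i
    proof -
      have "i \<in> act p" "mr i w < pos i" using rejected[OF w] by auto
      then show ?thesis using held[OF w] wm' act' unfolding pos'_def by auto
    qed
    show "\<exists>i'. rej (mp i ! r') = Some i' \<and> wr (mp i ! r') i' \<le> wr (mp i ! r') i"
      if i: "i \<in> act p'" "r' < pos' i" for i r'
    proof (cases "i = p'")
      case True
      then have "\<not> acceptable rej i (mp i ! r')" using i r unfolding pos'_def by simp
      then show ?thesis unfolding acceptable_def by (auto simp: not_less)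
    next
      case False
      then show ?thesis using i act' passed[of i r'] unfolding pos'_def by auto
    qed
    show "acceptable rej p' (mp p' ! pos' p')" using r unfolding pos'_def by simp
    show "T' w < T' (mp i ! pos' i)" if w: "w < k" "rej w = Some i" "i \<noteq> p'" for w i
    proof -
      have "i \<in> act p" using rejected w by blast
      moreover have "w \<noteq> wm q" using held[OF w(1,2)] free by blast
      ultimately show ?thesis
        using stamps_raise[of w i] w wm'[of i] unfolding T'_def by auto
    qed
    show "(p', p') \<in> (rejections (act p') p' pos' rej)\<^sup>*" by simp
  qed
  then show ?thesis using act' unfolding pos'_def by blast
qed

text \<open>The successor lets an arrival count even if the first proposal is at position
  \<open>0\<close>. Each man contributes at most \<open>k\<close>, whence the bound
  \<open>k\<^sup>2\<close> on the number of iterations.\<close>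

definition progress :: nat where
  "progress = (\<Sum>i\<in>act p. Suc (pos i))"

lemma progress_le: "progress \<le> k\<^sup>2"
proof -
  have "progress \<le> (\<Sum>i\<in>act p. k)" unfolding progress_def by (intro sum_mono Suc_leI pos_less)
  also have "\<dots> \<le> k * k" using card_act_le by simp
  finally show ?thesis by (simp add: power2_eq_square)
qed

end

context marriage
begin

text \<open>The first arrival is man \<open>1\<close>, except for \<open>k = 1\<close>, where man
  \<open>0\<close> is the only man; \<open>1 mod k\<close> covers both cases.\<close>

lemma gs_state_initial: "gs_state k mp wp (1 mod k) (1 mod k) (\<lambda>_. 0) (\<lambda>_. None) (\<lambda>_. 0)"
proof -
  have "act (1 mod k) = {1 mod k}"
    unfolding act_def using k by (cases "k = 1") auto
  then show ?thesis using k by unfold_locales (auto simp: acceptable_def)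
qed

end

section \<open>The columns and the entries of the matrices\<close>

context marriage
begin

definition ecol :: "nat \<Rightarrow> nat \<Rightarrow> nat" where
  "ecol i r = 2 * k + k * i + r"

lemma ecol_ge: "2 * k \<le> ecol i r"
  by (simp add: ecol_def)

lemma ecol_less: "i < k \<Longrightarrow> r < k \<Longrightarrow> ecol i r < num_cols k"
proof -
  assume "i < k" "r < k"
  then have "k * i + r < k * Suc i" by simp
  also have "\<dots> \<le> k * k" using \<open>i < k\<close> by (intro mult_le_mono2) simp
  finally show ?thesis by (simp add: ecol_def num_cols_def power2_eq_square)
qed

lemma ecol_div: "r < k \<Longrightarrow> (ecol i r - 2 * k) div k = i"
  and ecol_mod: "r < k \<Longrightarrow> (ecol i r - 2 * k) mod k = r"
  by (simp_all add: ecol_def)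

lemma ecol_eq_iff: "r < k \<Longrightarrow> r' < k \<Longrightarrow> ecol i r = ecol i' r' \<longleftrightarrow> i = i' \<and> r = r'"
  using ecol_div ecol_mod by metis

lemma ecol_less_iff: "r < k \<Longrightarrow> r' < k \<Longrightarrow> ecol i r < ecol i' r' \<longleftrightarrow> i < i' \<or> i = i' \<and> r < r'"
proof -
  have *: "ecol i r < ecol i' r'" if "i < i'" "r < k" for i r i' r'
  proof -
    have "k * i + r < k * Suc i" using that by simp
    also have "\<dots> \<le> k * i'" using that by (intro mult_le_mono2) simp
    finally show ?thesis by (simp add: ecol_def)
  qed
  assume r: "r < k" "r' < k"
  consider "i < i'" | "i = i'" | "i' < i" by linarith
  then show ?thesis
  proof cases
    case 1 then show ?thesis using *[of i i' r r'] r by simp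
  next
    case 2 then show ?thesis by (simp add: ecol_def)
  next
    case 3 then show ?thesis using *[of i' i r' r] r by simp
  qed
qed

lemma column_cases:
  assumes "j < num_cols k"
  obtains "j < 2 * k" | i r where "i < k" "r < k" "j = ecol i r"
proof (cases "j < 2 * k")
  case False
  define i where "i = (j - 2 * k) div k"
  define r where "r = (j - 2 * k) mod k"
  have "j - 2 * k < k * k" using False assms by (simp add: num_cols_def power2_eq_square)
  then have "i < k" unfolding i_def by (simp add: less_mult_imp_div_less)
  moreover have "r < k" using k unfolding r_def by simp
  moreover have "j = ecol i r" using False unfolding ecol_def i_def r_def by simp
  ultimately show ?thesis using that by blast
qed (use that in blast)

lemma col_edge_loop: "j < 2 * k \<Longrightarrow> col_edge k mp j = {j}"
  by (simp add: col_edge_def)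

lemma col_edge_ecol: "r < k \<Longrightarrow> col_edge k mp (ecol i r) = {i, k + mp i ! r}"
  using ecol_ge[of i r] ecol_div ecol_mod by (simp add: col_edge_def Let_def)

lemma edge_rank_idx: "edge_rank k mp wp v e = Suc (idx (edge_list k mp wp v) e)"
  by (simp add: edge_rank_def idx_def)

lemma edge_list_man: "i < k \<Longrightarrow> edge_list k mp wp i = map (\<lambda>w. {i, k + w}) (mp i) @ [{i}]"
  and edge_list_woman: "edge_list k mp wp (k + w) = map (\<lambda>m. {m, k + w}) (wp w) @ [{k + w}]"
  by (simp_all add: edge_list_def)

lemma distinct_edge_list:
  assumes "v < 2 * k"
  shows "distinct (edge_list k mp wp v)"
proof (cases "v < k")
  case True
  then show ?thesis using mp[OF True]
    by (auto simp: edge_list_man distinct_map inj_on_def doubleton_eq_iff)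
next
  case False
  then obtain w where w: "v = k + w" "w < k" using assms by (metis add_less_cancel_left le_Suc_ex mult_2 not_less)
  then show ?thesis using wp[OF w(2)]
    by (auto simp: edge_list_woman distinct_map inj_on_def doubleton_eq_iff)
qed

lemma length_edge_list: "v < 2 * k \<Longrightarrow> length (edge_list k mp wp v) = Suc k"
  using mp(3)[of v] wp(3)[of "v - k"] by (simp add: edge_list_def)

lemma edge_rank_nth: "v < 2 * k \<Longrightarrow> r \<le> k \<Longrightarrow> edge_rank k mp wp v (edge_list k mp wp v ! r) = Suc r"
  unfolding edge_rank_idx using idx_nth[OF distinct_edge_list[of v], of r] length_edge_list[of v] by simp

lemma edge_rank_loop: "v < 2 * k \<Longrightarrow> edge_rank k mp wp v {v} = Suc k"
  using edge_rank_nth[of v k] mp(3)[of v] wp(3)[of "v - k"] by (simp add: edge_list_def nth_append split: if_splits)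

lemma edge_rank_man:
  assumes "i < k" "w < k"
  shows "edge_rank k mp wp i {i, k + w} = Suc (mr i w)"
proof -
  have "edge_list k mp wp i ! mr i w = {i, k + w}"
    using assms mr_less[OF assms] mp_mr[OF assms] mp(3) by (simp add: edge_list_man nth_append)
  then show ?thesis using edge_rank_nth[of i "mr i w"] mr_less[OF assms] assms by simp
qed

lemma edge_rank_woman:
  assumes "w < k" "i < k"
  shows "edge_rank k mp wp (k + w) {i, k + w} = Suc (wr w i)"
proof -
  have "wp w ! wr w i = i" using wp nth_idx assms by (metis lessThan_iff)
  then have "edge_list k mp wp (k + w) ! wr w i = {i, k + w}"
    using assms wr_less[OF assms] wp(3) by (simp add: edge_list_woman nth_append)
  then show ?thesis using edge_rank_nth[of "k + w" "wr w i"] wr_less[OF assms] assms by simp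
qed

definition c :: "nat \<Rightarrow> nat \<Rightarrow> nat" where
  "c v j = ordinal_mat k mp wp $$ (v, j)"

lemma c_loop_self: "v < 2 * k \<Longrightarrow> c v v = 0"
  using edge_rank_loop[of v] by (simp add: c_def ordinal_mat_def num_cols_def col_edge_loop)

lemma c_man:
  assumes "i < k" "r < k"
  shows "c i (ecol i r) = k - r"
  using ecol_less[OF assms] edge_rank_man[OF assms(1) mp_nth[OF assms]] mr_mp[OF assms] assms
  by (simp add: c_def ordinal_mat_def col_edge_ecol)

lemma c_woman:
  assumes "i < k" "w < k"
  shows "c (k + w) (ecol i (mr i w)) = k - wr w i"
  using ecol_less[OF assms(1) mr_less[OF assms]] edge_rank_woman[OF assms(2,1)] mp_mr[OF assms]
    mr_less[OF assms] assms
  by (simp add: c_def ordinal_mat_def col_edge_ecol)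

section \<open>The value ranges within a row of the ordinal matrix\<close>

definition far :: "nat \<Rightarrow> nat set" where
  "far v = {h. 2 * k \<le> h \<and> h < num_cols k \<and> v \<notin> col_edge k mp h}"

lemma ecol_far_iff:
  "i < k \<Longrightarrow> r < k \<Longrightarrow> ecol i r \<in> far v \<longleftrightarrow> v \<noteq> i \<and> v \<noteq> k + mp i ! r"
  using ecol_ge[of i r] ecol_less[of i r] by (simp add: far_def col_edge_ecol)

text \<open>The edges of a man fill his block of columns; the edges of a woman are one from the
  block of each man. Either way there are \<open>k\<close> of them.\<close>

lemma incident_columns:
  assumes "v < 2 * k"
  shows "\<exists>g. inj_on g {..<k} \<and> {2 * k..<num_cols k} - far v = g ` {..<k}"
proof -
  have *: "{2 * k..<num_cols k} - far v = {ecol i r |i r. i < k \<and> r < k \<and> (v = i \<or> v = k + mp i ! r)}"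
    (is "?L = ?R")
  proof (rule Set.set_eqI)
    fix j
    show "j \<in> ?L \<longleftrightarrow> j \<in> ?R"
    proof (cases "2 * k \<le> j \<and> j < num_cols k")
      case True
      then obtain i r where ir: "i < k" "r < k" "j = ecol i r" using column_cases[of j] by auto
      then have "j \<in> ?R \<longleftrightarrow> v = i \<or> v = k + mp i ! r" using ecol_eq_iff by blast
      then show ?thesis using True ir ecol_far_iff[of i r v] by auto
    next
      case False
      then show ?thesis using ecol_less ecol_ge by auto
    qed
  qed
  show ?thesis
  proof (cases "v < k")
    case True
    then have "?R = ecol v ` {..<k}" by auto
    moreover have "inj_on (ecol v) {..<k}" using ecol_eq_iff by (auto simp: inj_on_def)
    ultimately show ?thesis using * by auto
  next
    case False
    then obtain w where w: "v = k + w" "w < k" using assms by (metis add_less_cancel_left le_Suc_ex mult_2 not_less)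
    have "?R = (\<lambda>i. ecol i (mr i w)) ` {..<k}"
    proof (intro Set.set_eqI iffI)
      fix j assume "j \<in> ?R"
      then obtain i r where "i < k" "r < k" "j = ecol i r" "w = mp i ! r" using w by auto
      then show "j \<in> (\<lambda>i. ecol i (mr i w)) ` {..<k}"
        using mr_mp by (intro image_eqI[of _ _ i]) auto
    next
      fix j assume "j \<in> (\<lambda>i. ecol i (mr i w)) ` {..<k}"
      then obtain i where i: "i < k" "j = ecol i (mr i w)" by auto
      then show "j \<in> ?R" using w mr_less[of i w] mp_mr[of i w]
        unfolding mem_Collect_eq by - (rule exI[of _ i], rule exI[of _ "mr i w"], simp)
    qed
    moreover have "inj_on (\<lambda>i. ecol i (mr i w)) {..<k}"
      using ecol_eq_iff mr_less w by (auto simp: inj_on_def)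
    ultimately show ?thesis using * by auto
  qed
qed

lemma card_far:
  assumes "v < 2 * k"
  shows "card (far v) + k = k\<^sup>2"
proof -
  obtain g where g: "inj_on g {..<k}" "{2 * k..<num_cols k} - far v = g ` {..<k}"
    using incident_columns[OF assms] by blast
  have sub: "far v \<subseteq> {2 * k..<num_cols k}" by (auto simp: far_def)
  have fin: "finite (far v)" using sub finite_subset by blast
  have "card ({2 * k..<num_cols k} - far v) = k" using g by (simp add: card_image)
  moreover have "card ({2 * k..<num_cols k} - far v) = k\<^sup>2 - card (far v)"
    using card_Diff_subset[OF fin sub] by (simp add: num_cols_def)
  moreover have "card (far v) \<le> k\<^sup>2" using card_mono[OF _ sub] by (simp add: num_cols_def)
  ultimately show ?thesis by simp
qed

lemma c_far_eq:
  assumes "v < 2 * k" "j \<in> far v"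
  shows "c v j = k\<^sup>2 - card {h\<in>far v. h < j}" "card {h\<in>far v. h < j} + k < k\<^sup>2"
proof -
  have "{h. 2 * k \<le> h \<and> h < j \<and> v \<notin> col_edge k mp h} = {h\<in>far v. h < j}"
    using assms(2) by (auto simp: far_def)
  then show "c v j = k\<^sup>2 - card {h\<in>far v. h < j}"
    using assms by (simp add: c_def ordinal_mat_def far_def)
  have fin: "finite (far v)" by (rule finite_subset[of _ "{..<num_cols k}"]) (auto simp: far_def)
  have "card {h\<in>far v. h < j} < card (far v)"
    using assms(2) fin by (intro psubset_card_mono) auto
  then show "card {h\<in>far v. h < j} + k < k\<^sup>2" using card_far[OF assms(1)] by simp
qed

lemma c_far_bounds:
  assumes "v < 2 * k" "j \<in> far v"
  shows "k < c v j" "c v j \<le> k\<^sup>2"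
  using c_far_eq[OF assms] by auto

lemma c_far_antimono:
  assumes "v < 2 * k" "j \<in> far v" "j' \<in> far v" "j < j'"
  shows "c v j' < c v j"
proof -
  have fin: "finite {h\<in>far v. h < j'}" by (rule finite_subset[of _ "{..<j'}"]) auto
  have "card {h\<in>far v. h < j} < card {h\<in>far v. h < j'}"
    using assms by (intro psubset_card_mono[OF fin]) auto
  then show ?thesis using c_far_eq[OF assms(1,2)] c_far_eq[OF assms(1,3)] by linarith
qed

lemma c_loop_eq:
  assumes "v < 2 * k" "j < 2 * k" "j \<noteq> v"
  shows "c v j = k\<^sup>2 + 2 * k - 1 - card {h. h < j \<and> h \<noteq> v}" "card {h. h < j \<and> h \<noteq> v} + 1 < 2 * k"
proof -
  show "c v j = k\<^sup>2 + 2 * k - 1 - card {h. h < j \<and> h \<noteq> v}"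
    using assms by (simp add: c_def ordinal_mat_def num_cols_def col_edge_loop)
  have "card {h. h < j \<and> h \<noteq> v} < card ({..<2 * k} - {v})"
    using assms by (intro psubset_card_mono) auto
  then show "card {h. h < j \<and> h \<noteq> v} + 1 < 2 * k" using assms by simp
qed

lemma c_loop_bound:
  assumes "v < 2 * k" "j < 2 * k" "j \<noteq> v"
  shows "k\<^sup>2 < c v j"
  using c_loop_eq[OF assms] by linarith

lemma c_loop_antimono:
  assumes "v < 2 * k" "j < 2 * k" "j \<noteq> v" "j' < 2 * k" "j' \<noteq> v" "j < j'"
  shows "c v j' < c v j"
proof -
  have "card {h. h < j \<and> h \<noteq> v} < card {h. h < j' \<and> h \<noteq> v}"
    using assms by (intro psubset_card_mono) auto
  then show ?thesis using c_loop_eq[OF assms(1-3)] c_loop_eq[OF assms(1,4,5)] by linarith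
qed

lemma c_incident:
  assumes "v < 2 * k" "2 * k \<le> j" "j < num_cols k" "j \<notin> far v"
  shows "0 < c v j" "c v j \<le> k"
proof -
  obtain i r where ir: "i < k" "r < k" "j = ecol i r" using column_cases[OF assms(3)] assms(2) by auto
  then have "v = i \<or> v = k + mp i ! r" using ecol_far_iff[of i r v] assms(4) by auto
  then have "c v j = k - r \<or> c v j = k - wr (mp i ! r) i"
    using c_man[OF ir(1,2)] c_woman[OF ir(1) mp_nth[OF ir(1,2)]] mr_mp[OF ir(1,2)] ir(3) by auto
  then show "0 < c v j" "c v j \<le> k" using ir wr_less[OF mp_nth[OF ir(1,2)] ir(1)] by auto
qed

lemma c_incident_inj:
  assumes "v < 2 * k" "2 * k \<le> j" "j < num_cols k" "j \<notin> far v"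
    "2 * k \<le> j'" "j' < num_cols k" "j' \<notin> far v" "c v j = c v j'"
  shows "j = j'"
proof -
  obtain i r where ir: "i < k" "r < k" "j = ecol i r" using column_cases[OF assms(3)] assms(2) by auto
  obtain i' r' where ir': "i' < k" "r' < k" "j' = ecol i' r'" using column_cases[OF assms(6)] assms(5) by auto
  have vi: "v = i \<or> v = k + mp i ! r" "v = i' \<or> v = k + mp i' ! r'"
    using ecol_far_iff[of i r v] ecol_far_iff[of i' r' v] assms(4,7) ir ir' by auto
  show ?thesis
  proof (cases "v < k")
    case True
    then have "v = i" "v = i'" using vi by auto
    then have "k - r = k - r'" using c_man[OF ir(1,2)] c_man[OF ir'(1,2)] assms(8) ir ir' by simp
    then have "r = r'" using ir ir' by arith
    then show ?thesis using ir ir' \<open>v = i\<close> \<open>v = i'\<close> by simp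
  next
    case False
    define w where "w = mp i ! r"
    have w: "w < k" "v = k + w" "mp i' ! r' = w" "mr i w = r" "mr i' w = r'"
      using False vi ir ir' mp_nth[OF ir(1,2)] mr_mp[OF ir(1,2)] mr_mp[OF ir'(1,2)] unfolding w_def by auto
    then have "k - wr w i = k - wr w i'"
      using c_woman[OF ir(1) w(1)] c_woman[OF ir'(1) w(1)] assms(8) ir ir' by simp
    then have "i = i'" using wr_less[OF w(1)] wr_inj[OF w(1)] ir ir' by (metis diff_diff_cancel less_imp_le)
    then show ?thesis using w ir ir' by simp
  qed
qed

text \<open>The value reveals the kind of column: \<open>0\<close> for the own loop, up to
  \<open>k\<close> for incident edges, up to \<open>k\<^sup>2\<close> for other valid edges, above
  that for other loops. Within a kind the entries are distinct by strict preferences or strictly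
  decreasing.\<close>

lemma c_inj:
  assumes "v < 2 * k" "j < num_cols k" "j' < num_cols k" "c v j = c v j'"
  shows "j = j'"
proof -
  have kk: "k \<le> k\<^sup>2" using k by (simp add: power2_eq_square)
  define kind where "kind j = (if j = v then 0 else if j < 2 * k then 3 else if j \<in> far v then 2 else (1::nat))" for j
  define level where "level x = (if x = 0 then 0 else if x \<le> k then 1 else if x \<le> k\<^sup>2 then 2 else (3::nat))" for x
  have kind: "kind j = level (c v j)" if "j < num_cols k" for j
  proof -
    consider "j = v" | "j \<noteq> v" "j < 2 * k" | "2 * k \<le> j" "j \<in> far v" | "2 * k \<le> j" "j \<notin> far v"
      by (cases "2 * k \<le> j") auto
    then show ?thesis
    proof cases
      case 1
      then show ?thesis using c_loop_self[OF assms(1)] unfolding kind_def level_def by simp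
    next
      case 2
      then show ?thesis using c_loop_bound[OF assms(1), of j] kk unfolding kind_def level_def by simp
    next
      case 3
      then show ?thesis using c_far_bounds[OF assms(1), of j] assms(1) unfolding kind_def level_def by simp
    next
      case 4
      then show ?thesis using c_incident[OF assms(1) _ that] assms(1) unfolding kind_def level_def by simp
    qed
  qed
  have eq: "kind j = kind j'" unfolding kind[OF assms(2)] kind[OF assms(3)] assms(4) by (rule refl)
  have kind_iff: "kind j = 0 \<longleftrightarrow> j = v" "kind j = 1 \<longleftrightarrow> j \<noteq> v \<and> 2 * k \<le> j \<and> j \<notin> far v"
    "kind j = 2 \<longleftrightarrow> j \<noteq> v \<and> 2 * k \<le> j \<and> j \<in> far v" "kind j = 3 \<longleftrightarrow> j \<noteq> v \<and> j < 2 * k" for j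
    unfolding kind_def by auto
  consider "kind j = 0" | "kind j = 1" | "kind j = 2" | "kind j = 3" unfolding kind_iff by linarith
  then show ?thesis
  proof cases
    case 1
    moreover from 1 have "kind j' = 0" using eq by (simp only:)
    ultimately show ?thesis unfolding kind_iff by (simp only:)
  next
    case 2
    moreover from 2 have "kind j' = 1" using eq by (simp only:)
    ultimately show ?thesis unfolding kind_iff
      using c_incident_inj[OF assms(1) _ assms(2) _ _ assms(3) _ assms(4)] by blast
  next
    case 3
    moreover from 3 have "kind j' = 2" using eq by (simp only:)
    ultimately have far: "j \<in> far v" "j' \<in> far v" unfolding kind_iff by blast+
    have "\<not> j < j'" using c_far_antimono[OF assms(1) far] assms(4) by linarith
    moreover have "\<not> j' < j" using c_far_antimono[OF assms(1) far(2,1)] assms(4) by linarith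
    ultimately show ?thesis by linarith
  next
    case 4
    moreover from 4 have "kind j' = 3" using eq by (simp only:)
    ultimately have l: "j < 2 * k" "j \<noteq> v" "j' < 2 * k" "j' \<noteq> v" unfolding kind_iff by blast+
    have "\<not> j < j'" using c_loop_antimono[OF assms(1) l] assms(4) by linarith
    moreover have "\<not> j' < j" using c_loop_antimono[OF assms(1) l(3,4,1,2)] assms(4) by linarith
    ultimately show ?thesis by linarith
  qed
qed

lemma dim_ordinal_mat: "dim_row (ordinal_mat k mp wp) = 2 * k" "dim_col (ordinal_mat k mp wp) = num_cols k"
  by (simp_all add: ordinal_mat_def)

lemma row_injective_ordinal_mat: "row_injective (ordinal_mat k mp wp)"
proof
  show "j = j'" if "i < dim_row (ordinal_mat k mp wp)" "j < dim_col (ordinal_mat k mp wp)"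
    "j' < dim_col (ordinal_mat k mp wp)" "ordinal_mat k mp wp $$ (i, j) = ordinal_mat k mp wp $$ (i, j')"
    for i j j'
    using c_inj[of i j j'] that unfolding c_def dim_ordinal_mat by blast
  show "0 < dim_row (ordinal_mat k mp wp)" using k by (simp add: dim_ordinal_mat)
qed

lemma incidence_entry:
  "v < 2 * k \<Longrightarrow> j < num_cols k \<Longrightarrow>
    (incidence_mat k mp :: 'a::zero_neq_one mat) $$ (v, j) = (if v \<in> col_edge k mp j then 1 else 0)"
  by (simp add: incidence_mat_def)

lemma dim_incidence_mat: "dim_row (incidence_mat k mp :: 'a::zero_neq_one mat) = 2 * k"
    "dim_col (incidence_mat k mp :: 'a::zero_neq_one mat) = num_cols k"
  by (simp_all add: incidence_mat_def)

lemma incidence_ex_legal_pivot: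
  assumes "feasible_basis (incidence_mat k mp) b B" "j < num_cols k" "j \<notin> B"
  shows "\<exists>l\<in>B. feasible_basis (incidence_mat k mp) b (insert j (B - {l}))"
proof (rule ex_legal_cardinal_pivot[OF assms(1)])
  show "j < dim_col (incidence_mat k mp :: real mat)" using assms(2) by (simp add: dim_incidence_mat)
  show "j \<notin> B" by fact
  show "0 \<le> (incidence_mat k mp :: real mat) $$ (i, j)"
    if "i < dim_row (incidence_mat k mp :: real mat)" "j < dim_col (incidence_mat k mp :: real mat)" for i j
    using that by (simp add: incidence_entry dim_incidence_mat)
  have "\<exists>v<2 * k. v \<in> col_edge k mp j"
    using assms(2)
  proof (cases rule: column_cases)
    case 1
    then show ?thesis by (auto simp: col_edge_loop)
  next
    case (2 i r)
    then show ?thesis by (intro exI[of _ i]) (auto simp: col_edge_ecol)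
  qed
  then show "\<exists>i<dim_row (incidence_mat k mp :: real mat). 0 < (incidence_mat k mp :: real mat) $$ (i, j)"
    using assms(2) by (auto simp: incidence_entry dim_incidence_mat)
qed

end

section \<open>The bases of a state\<close>

text \<open>A functional relation leaves only one path from \<open>a\<close>, and acyclicity keeps
  its vertices distinct, so that moving one step is a bijection. It will shift partners along a
  chain of rejections.\<close>

lemma rtrancl_path_bij:
  assumes "(a, b) \<in> R\<^sup>*" and fn: "\<And>x y. (x, y) \<in> R \<Longrightarrow> y = f x" and acyc: "acyclic R"
    and b: "\<And>y. (b, y) \<notin> R"
  shows "\<exists>P. a \<in> P \<and> b \<in> P \<and> (\<forall>x\<in>P. (a, x) \<in> R\<^sup>*) \<and> (\<forall>x\<in>P - {b}. (x, f x) \<in> R) \<and>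
    bij_betw f (P - {b}) (P - {a})"
  using assms(1)
proof (induction rule: converse_rtrancl_induct)
  case base
  show ?case by (rule exI[of _ "{b}"]) (simp add: bij_betw_def)
next
  case (step a c)
  then obtain P where P: "c \<in> P" "b \<in> P" "\<forall>x\<in>P. (c, x) \<in> R\<^sup>*" "\<forall>x\<in>P - {b}. (x, f x) \<in> R"
    "bij_betw f (P - {b}) (P - {c})" by blast
  have c: "c = f a" using fn step by blast
  have "a \<noteq> b" using step b by blast
  have a: "a \<notin> P"
  proof
    assume "a \<in> P"
    then have "(a, a) \<in> R\<^sup>+" using P(3) step(1) by (meson rtrancl_into_trancl2)
    then show False using acyc by (simp add: acyclic_def)
  qed
  have dom: "insert a P - {b} = insert a (P - {b})" "insert a P - {a} = P" using a \<open>a \<noteq> b\<close> by auto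
  have "bij_betw f (insert a (P - {b})) P"
    using bij_betw_combine[of f "{a}" "{c}" "P - {b}" "P - {c}"] P c a
    by (simp add: bij_betw_def insert_absorb)
  moreover have "\<forall>x\<in>insert a P. (a, x) \<in> R\<^sup>*"
    using P(3) step(1) by (auto intro: converse_rtrancl_into_rtrancl)
  ultimately show ?case using P c step(1) dom
    by (intro exI[of _ "insert a P"]) auto
qed

context marriage
begin

text \<open>The column of \<open>D\<close> that attains the minimum in the row of woman
  \<open>w\<close>.\<close>

definition rejcol :: "(nat \<Rightarrow> nat option) \<Rightarrow> nat \<Rightarrow> nat" where
  "rejcol rej w = (case rej w of None \<Rightarrow> k + w | Some i \<Rightarrow> ecol i (mr i w))"

text \<open>The range starts at \<open>p\<close> and not after it: as long as man \<open>0\<close>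
  is missing, the edge of the latest arrival serves row \<open>0\<close>, and row \<open>p\<close>
  is still served by his loop.\<close>

definition man_loops :: "nat \<Rightarrow> nat set" where
  "man_loops p = (if p = 0 then {} else {p..<k})"

definition Dcols :: "nat \<Rightarrow> (nat \<Rightarrow> nat) \<Rightarrow> (nat \<Rightarrow> nat option) \<Rightarrow> nat set" where
  "Dcols p pos rej = (\<lambda>i. ecol i (pos i)) ` act p \<union> rejcol rej ` {..<k} \<union> man_loops p"

definition Bcols :: "nat \<Rightarrow> nat \<Rightarrow> (nat \<Rightarrow> nat) \<Rightarrow> (nat \<Rightarrow> nat option) \<Rightarrow> nat set" where
  "Bcols p q pos rej = insert 0 (Dcols p pos rej - {ecol q (pos q)})"

lemma c_gt_k:
  assumes "v < 2 * k" "j < num_cols k" "v \<notin> col_edge k mp j"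
  shows "k < c v j"
proof (cases "j < 2 * k")
  case True
  then have "k\<^sup>2 < c v j" using assms c_loop_bound col_edge_loop[OF True] by auto
  moreover have "k \<le> k\<^sup>2" using k by (simp add: power2_eq_square)
  ultimately show ?thesis by simp
next
  case False
  then show ?thesis using assms c_far_bounds[of v j] by (simp add: far_def)
qed

section \<open>Feasibility from node potentials and perfect sets of columns\<close>

lemma column_sum:
  fixes \<pi> :: "nat \<Rightarrow> real"
  assumes "i < k" "r < k"
  shows "(\<Sum>v<2 * k. (incidence_mat k mp :: real mat) $$ (v, ecol i r) * \<pi> v) = \<pi> i + \<pi> (k + mp i ! r)"
proof -
  have "(\<Sum>v<2 * k. (incidence_mat k mp :: real mat) $$ (v, ecol i r) * \<pi> v)
    = (\<Sum>v\<in>{i, k + mp i ! r}. \<pi> v)"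
    by (rule sum.mono_neutral_cong_right)
      (use assms ecol_less mp_nth[OF assms] in \<open>auto simp: incidence_entry col_edge_ecol\<close>)
  then show ?thesis using assms by simp
qed

lemma column_sum_loop:
  fixes \<pi> :: "nat \<Rightarrow> real"
  assumes "j < 2 * k"
  shows "(\<Sum>v<2 * k. (incidence_mat k mp :: real mat) $$ (v, j) * \<pi> v) = \<pi> j"
proof -
  have "(\<Sum>v<2 * k. (incidence_mat k mp :: real mat) $$ (v, j) * \<pi> v) = (\<Sum>v\<in>{j}. \<pi> v)"
    by (rule sum.mono_neutral_cong_right)
      (use assms in \<open>auto simp: incidence_entry col_edge_loop num_cols_def\<close>)
  then show ?thesis by simp
qed

lemma perfect_columns_solution:
  assumes M: "M \<subseteq> {..<num_cols k}" and perfect: "\<And>v. v < 2 * k \<Longrightarrow> \<exists>!j. j \<in> M \<and> v \<in> col_edge k mp j"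
    and B: "M \<subseteq> B"
  shows "basic_solution (incidence_mat k mp) (ones_vec k) B (vec (num_cols k) (\<lambda>j. if j \<in> M then 1 else 0))"
  unfolding basic_solution_iff
proof (intro conjI allI impI)
  fix v assume "v < dim_row (incidence_mat k mp :: real mat)"
  then have v: "v < 2 * k" by (simp add: dim_incidence_mat)
  obtain j where j: "j \<in> M \<and> v \<in> col_edge k mp j" "\<forall>j'. j' \<in> M \<and> v \<in> col_edge k mp j' \<longrightarrow> j' = j"
    using perfect[OF v] by (rule ex1E)
  have jN: "j < num_cols k" using j(1) M by blast
  have "(\<Sum>j<num_cols k. (incidence_mat k mp :: real mat) $$ (v, j) *
      vec (num_cols k) (\<lambda>j. if j \<in> M then 1 else 0) $ j) = (\<Sum>h<num_cols k. if h = j then 1 else 0)"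
  proof (rule sum.cong)
    fix h assume "h \<in> {..<num_cols k}"
    moreover have "h \<in> M \<and> v \<in> col_edge k mp h \<longleftrightarrow> h = j" using j by blast
    ultimately show "(incidence_mat k mp :: real mat) $$ (v, h) *
      vec (num_cols k) (\<lambda>j. if j \<in> M then 1 else 0) $ h = (if h = j then 1 else 0)"
      using v by (auto simp add: incidence_entry)
  qed simp
  also have "\<dots> = 1" using jN by simp
  finally have "(\<Sum>j<num_cols k. (incidence_mat k mp :: real mat) $$ (v, j) *
      vec (num_cols k) (\<lambda>j. if j \<in> M then 1 else 0) $ j) = 1" .
  then show "(\<Sum>j<dim_col (incidence_mat k mp :: real mat). (incidence_mat k mp :: real mat) $$ (v, j) *
      vec (num_cols k) (\<lambda>j. if j \<in> M then 1 else 0) $ j) = ones_vec k $ v"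
    using v by (simp add: dim_incidence_mat ones_vec_def)
qed (use B in \<open>auto simp: dim_incidence_mat ones_vec_def\<close>)

text \<open>The 0/1 vector of a set of columns covering every node once is a nonnegative basic
  solution. In a degenerate basis that set is a proper part of \<open>B\<close> and says nothing
  about independence, which comes from the potentials.\<close>

lemma feasible_basis_if_perfect:
  assumes B: "B \<subseteq> {..<num_cols k}" "card B = 2 * k"
    and M: "M \<subseteq> B" and perfect: "\<And>v. v < 2 * k \<Longrightarrow> \<exists>!j. j \<in> M \<and> v \<in> col_edge k mp j"
    and left: "\<And>\<pi> :: nat \<Rightarrow> real. (\<And>j. j \<in> B \<Longrightarrow> (\<Sum>v<2 * k. incidence_mat k mp $$ (v, j) * \<pi> v) = 0)
      \<Longrightarrow> \<forall>v<2 * k. \<pi> v = 0"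
  shows "feasible_basis (incidence_mat k mp) (ones_vec k) B"
  unfolding feasible_basis_iff_det dim_incidence_mat
proof (intro conjI)
  have fin: "finite B" using B(1) finite_subset by blast
  show "det (basis_mat (incidence_mat k mp :: real mat) B) \<noteq> 0"
    by (rule det_basis_mat_nonzero_if_left_kernel_trivial[OF fin])
      (use B(2) left in \<open>simp_all add: dim_incidence_mat\<close>)
  show "\<exists>x. basic_solution (incidence_mat k mp) (ones_vec k) B x \<and> 0\<^sub>v (num_cols k) \<le> x"
    using perfect_columns_solution[OF _ perfect M] M B(1)
    by (intro exI[of _ "vec (num_cols k) (\<lambda>j. if j \<in> M then 1 else 0)"]) (auto simp: less_eq_vec_def)
qed (use B in auto)

end

section \<open>The columns \<open>D\<close> of a state form an ordinal basis\<close>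

context gs_state
begin

abbreviation cur :: "nat \<Rightarrow> nat" where
  "cur i \<equiv> ecol i (pos i)"

abbreviation D :: "nat set" where
  "D \<equiv> Dcols p pos rej"

abbreviation B :: "nat set" where
  "B \<equiv> Bcols p q pos rej"

lemma rejected_act: "w < k \<Longrightarrow> rej w = Some i \<Longrightarrow> i \<in> act p"
  and rejected_pos: "w < k \<Longrightarrow> rej w = Some i \<Longrightarrow> mr i w < pos i"
  and rejected_holder: "w < k \<Longrightarrow> rej w = Some i \<Longrightarrow> \<exists>h\<in>act p - {q}. wm h = w \<and> wr w h < wr w i"
  using rejected unfolding wm_def by blast+

lemma held_unique: "i \<in> act p - {q} \<Longrightarrow> i' \<in> act p - {q} \<Longrightarrow> wm i = wm i' \<Longrightarrow> i = i'"
  using held_inj unfolding inj_on_def wm_def by blast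

lemma mr_wm: "i \<in> act p \<Longrightarrow> mr i (wm i) = pos i"
  unfolding wm_def using mr_mp act_less pos_less by blast

lemma rejcol_cases:
  assumes "w < k"
  obtains "rej w = None" "rejcol rej w = k + w"
  | i where "rej w = Some i" "i \<in> act p" "i < k" "mr i w < k" "mr i w < pos i" "mp i ! mr i w = w"
    "rejcol rej w = ecol i (mr i w)"
proof (cases "rej w")
  case None
  then show ?thesis using that(1) by (simp add: rejcol_def)
next
  case (Some i)
  then show ?thesis using that(2)[of i] rejected_act[OF assms] rejected_pos[OF assms] act_less
      mr_less mp_mr assms by (simp add: rejcol_def)
qed

lemma cur_less: "i \<in> act p \<Longrightarrow> cur i < num_cols k"
  using ecol_less act_less pos_less by blast

lemma cur_inj: "i \<in> act p \<Longrightarrow> i' \<in> act p \<Longrightarrow> cur i = cur i' \<Longrightarrow> i = i'"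
  using ecol_eq_iff pos_less by blast

lemma col_edge_cur: "i \<in> act p \<Longrightarrow> col_edge k mp (cur i) = {i, k + wm i}"
  using col_edge_ecol pos_less unfolding wm_def by blast

lemma col_edge_rejcol:
  assumes w: "w < k"
  shows "col_edge k mp (rejcol rej w) = (case rej w of None \<Rightarrow> {k + w} | Some i \<Rightarrow> {i, k + w})"
  using w by (cases rule: rejcol_cases) (use w in \<open>simp_all add: col_edge_loop col_edge_ecol\<close>)

lemma rejcol_less:
  assumes w: "w < k"
  shows "rejcol rej w < num_cols k"
  using w
proof (cases rule: rejcol_cases)
  case 1
  then show ?thesis using w by (simp add: num_cols_def)
next
  case (2 i)
  then show ?thesis by (simp add: ecol_less)
qed

lemma rejcol_ge:
  assumes w: "w < k"
  shows "k \<le> rejcol rej w"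
  using w
proof (cases rule: rejcol_cases)
  case (2 i)
  then show ?thesis using ecol_ge[of i "mr i w"] by simp
qed simp

lemma rejcol_neq_cur:
  assumes w: "w < k" and i: "i \<in> act p"
  shows "rejcol rej w \<noteq> cur i"
  using w
proof (cases rule: rejcol_cases)
  case 1
  then show ?thesis using ecol_ge[of i "pos i"] w by simp
next
  case (2 i')
  then show ?thesis using ecol_eq_iff[of "mr i' w" "pos i" i' i] pos_less[OF i] by auto
qed

lemma rejcol_inj:
  assumes "w < k" "w' < k" "rejcol rej w = rejcol rej w'"
  shows "w = w'"
proof -
  have "k + w' \<in> col_edge k mp (rejcol rej w')"
    unfolding col_edge_rejcol[OF assms(2)] by (simp split: option.splits)
  then have "k + w' \<in> (case rej w of None \<Rightarrow> {k + w} | Some i \<Rightarrow> {i, k + w})"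
    using col_edge_rejcol[OF assms(1)] assms(3) by simp
  moreover have "i < k" if "rej w = Some i" for i using rejected_act act_less that assms(1) by blast
  ultimately show ?thesis by (fastforce split: option.splits)
qed

lemma man_loops_less: "j \<in> man_loops p \<Longrightarrow> j < k"
  by (auto simp: man_loops_def split: if_splits)

lemma D_cases:
  assumes "j \<in> D"
  obtains i where "i \<in> act p" "j = cur i" | w where "w < k" "j = rejcol rej w" | "j \<in> man_loops p"
  using assms unfolding Dcols_def by auto

lemma D_less:
  assumes j: "j \<in> D"
  shows "j < num_cols k"
  using j
proof (cases rule: D_cases)
  case 3
  then show ?thesis using man_loops_less[OF 3] by (simp add: num_cols_def)
qed (simp_all add: cur_less rejcol_less)

lemma cur_D: "i \<in> act p \<Longrightarrow> cur i \<in> D" and rejcol_D: "w < k \<Longrightarrow> rejcol rej w \<in> D"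
  and loop_D: "j \<in> man_loops p \<Longrightarrow> j \<in> D"
  by (auto simp: Dcols_def)

lemma cur_neq_loop: "j < 2 * k \<Longrightarrow> cur i \<noteq> j"
  using ecol_ge[of i "pos i"] by simp

lemma finite_D: "finite D"
  using D_less finite_subset[of D "{..<num_cols k}"] by auto

lemma card_D: "card D = 2 * k"
proof -
  have fin: "finite (act p)" "finite (man_loops p)" by (auto simp: finite_act man_loops_def)
  have 1: "card (cur ` act p) = card (act p)" using cur_inj by (intro card_image inj_onI) blast
  have 2: "card (rejcol rej ` {..<k}) = k" using rejcol_inj by (subst card_image) (auto intro!: inj_onI)
  have "cur ` act p \<inter> rejcol rej ` {..<k} = {}" using rejcol_neq_cur by force
  then have 3: "card (cur ` act p \<union> rejcol rej ` {..<k}) = card (act p) + k"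
    using fin 1 2 by (subst card_Un_disjoint) auto
  have "j \<noteq> cur i" "w < k \<Longrightarrow> j \<noteq> rejcol rej w" if "j \<in> man_loops p" for i j w
    using cur_neq_loop[of j i] man_loops_less[OF that] rejcol_ge[of w] by auto
  then have "(cur ` act p \<union> rejcol rej ` {..<k}) \<inter> man_loops p = {}" by blast
  then have "card D = card (act p) + k + card (man_loops p)"
    unfolding Dcols_def using fin 3 by (subst card_Un_disjoint) auto
  then show ?thesis using p_less by (auto simp: act_def man_loops_def split: if_splits)
qed

lemma zero_notin_D: "0 \<notin> D"
proof
  assume "0 \<in> D"
  then show False
  proof (cases rule: D_cases)
    case (1 i)
    then show ?thesis using cur_neq_loop[of 0 i] k by simp
  next
    case (2 w)
    then show ?thesis using rejcol_ge[of w] k by simp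
  qed (simp add: man_loops_def split: if_splits)
qed

lemma card_B: "card B = 2 * k"
  using card_D finite_D zero_notin_D cur_D[OF q_act] k unfolding Bcols_def by (simp add: card_Diff_singleton)

lemma B_less: "j \<in> B \<Longrightarrow> j < num_cols k"
  using D_less k unfolding Bcols_def by (auto simp: num_cols_def)

text \<open>Among the edges of \<open>D\<close> at \<open>i\<close> the current one is the worst,
  because rejected edges stand earlier on his list. The exception is the latest arrival while man
  \<open>0\<close> is missing, whose loop is still in \<open>D\<close>.\<close>

lemma min_man:
  assumes i: "i \<in> act p" "p = 0 \<or> i \<noteq> p" and j: "j \<in> D"
  shows "c i (cur i) \<le> c i j"
proof -
  have ik: "i < k" "pos i < k" using i act_less pos_less by auto
  have cur: "c i (cur i) = k - pos i" by (rule c_man[OF ik])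
  show ?thesis
  proof (cases "i \<in> col_edge k mp j")
    case False
    then show ?thesis using c_gt_k[of i j] D_less[OF j] ik cur by simp
  next
    case True
    from j show ?thesis
    proof (cases rule: D_cases)
      case (1 i')
      then show ?thesis using True col_edge_cur[of i'] ik by auto
    next
      case (2 w)
      from 2(1) show ?thesis
      proof (cases rule: rejcol_cases)
        case 1
        then show ?thesis using True 2 ik by (simp add: col_edge_loop)
      next
        case (2 i')
        then have "i' = i" using True \<open>j = rejcol rej w\<close> ik by (simp add: col_edge_ecol)
        then show ?thesis using 2 \<open>j = rejcol rej w\<close> c_man[of i "mr i w"] cur by simp
      qed
    next
      case 3
      then have "j = i" using True man_loops_less[OF 3] by (simp add: col_edge_loop)
      then show ?thesis using 3 i by (auto simp: act_def man_loops_def split: if_splits)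
    qed
  qed
qed

text \<open>Whoever proposes to \<open>w\<close> or is held by her beats her best rejected man, and
  edges away from \<open>w\<close> have entries above \<open>k\<close>. A loop of \<open>w\<close>
  has entry \<open>0\<close>.\<close>

lemma min_woman:
  assumes w: "w < k" and j: "j \<in> D"
  shows "c (k + w) (rejcol rej w) \<le> c (k + w) j"
  using w
proof (cases rule: rejcol_cases)
  case 1
  then show ?thesis using c_loop_self[of "k + w"] w by simp
next
  case (2 i)
  have cw: "c (k + w) (rejcol rej w) = k - wr w i" using 2 c_woman w by simp
  show ?thesis
  proof (cases "k + w \<in> col_edge k mp j")
    case False
    then show ?thesis using c_gt_k[of "k + w" j] D_less[OF j] w cw by simp
  next
    case True
    from j show ?thesis
    proof (cases rule: D_cases)
      case (1 i')
      then have wi: "wm i' = w" using True col_edge_cur[of i'] act_less[of i'] by auto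
      have "wr w i' \<le> wr w i"
      proof (cases "i' = q")
        case True
        then show ?thesis using pending 2(1) wi unfolding acceptable_def wm_def by auto
      next
        case False
        then show ?thesis using rejected_holder[OF w 2(1)] held_unique wi 1(1) by force
      qed
      moreover have "c (k + w) j = k - wr w i'"
        using c_woman[of i' w] mr_wm[OF 1(1)] wi w act_less[OF 1(1)] 1(2) by simp
      ultimately show ?thesis using cw by simp
    next
      case (2 w')
      then have "w' = w" using True col_edge_rejcol[of w'] act_less rejected_act[of w']
        by (fastforce split: option.splits)
      then show ?thesis using 2 by simp
    next
      case 3
      then show ?thesis using True man_loops_less[OF 3] by (simp add: col_edge_loop)
    qed
  qed
qed

lemma cur_p_far: "p \<noteq> 0 \<Longrightarrow> cur p \<in> far 0"
  using ecol_far_iff[of p "pos p" 0] p_less pos_less[OF p_act] k by simp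

text \<open>While man \<open>0\<close> is missing, the valid edges in \<open>D\<close> all avoid
  him, so the rightmost one has the smallest entry. It is \<open>cur p\<close>: the other arrivals
  have smaller numbers, and rejected edges of \<open>p\<close> stand to the left of his current
  one.\<close>

lemma min_zero:
  assumes j: "j \<in> D"
  shows "c 0 (cur p) \<le> c 0 j"
proof (cases "p = 0")
  case True
  then show ?thesis using min_man[of 0 j] p_act j by simp
next
  case False
  have 0: "0 < 2 * k" using k by simp
  have far: "c 0 (cur p) \<le> c 0 (ecol i r)" if "i \<in> act p" "r \<le> pos i" for i r
  proof -
    have i: "i < k" "r < k" "i \<noteq> 0" "i \<le> p" using that act_less[of i] pos_less[of i] False by (auto simp: act_def)
    then have "ecol i r \<in> far 0" using ecol_far_iff k by auto
    moreover have "ecol i r \<le> cur p"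
      using ecol_less_iff[OF i(2) pos_less[OF p_act], of i p] that i by (cases "ecol i r = cur p") (auto simp: ecol_def)
    ultimately show ?thesis
      using c_far_antimono[OF 0 _ cur_p_far[OF False], of "ecol i r"] by (cases "ecol i r = cur p") auto
  qed
  have big: "c 0 (cur p) \<le> c 0 j" if "j < 2 * k" "j \<noteq> 0" for j
    using c_loop_bound[OF 0 that] c_far_bounds[OF 0 cur_p_far[OF False]] by simp
  from j show ?thesis
  proof (cases rule: D_cases)
    case (1 i)
    then show ?thesis using far by blast
  next
    case (2 w)
    from 2(1) show ?thesis
      by (cases rule: rejcol_cases) (use 2 big[of "k + w"] far k in auto)
  next
    case 3
    then show ?thesis using big[of j] man_loops_less[OF 3] False by (auto simp: man_loops_def)
  qed
qed

text \<open>A loop is dominated in its own row, an edge of a missing man in row \<open>0\<close>, an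
  edge already passed by its man in the row of the woman, and any other edge in the row of the man.
  For the latest arrival row \<open>0\<close> stands in for the last case until man \<open>0\<close>
  has come.\<close>

lemma ordinal_basis_D: "ordinal_basis (ordinal_mat k mp wp) D"
proof -
  have "\<exists>v<2 * k. \<forall>j\<in>D. c v h \<le> c v j" if "h < num_cols k" for h
    using that
  proof (cases rule: column_cases)
    case 1
    then show ?thesis using c_loop_self[OF 1] by (intro exI[of _ h]) auto
  next
    case (2 i r)
    have 0: "0 < 2 * k" using k by simp
    show ?thesis
    proof (cases "i \<in> act p")
      case False
      then have p: "p \<noteq> 0" "i = 0 \<or> p < i" using 2(1) by (auto simp: act_def split: if_splits)
      have "c 0 h \<le> c 0 (cur p)"
      proof (cases "i = 0")
        case True
        then have "c 0 h \<le> k" using c_man[of 0 r] 2 by simp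
        then show ?thesis using c_far_bounds[OF 0 cur_p_far[OF p(1)]] by simp
      next
        case False
        then have "p < i" using p by simp
        then show ?thesis using c_far_antimono[OF 0 cur_p_far[OF p(1)], of h] 2 ecol_far_iff[of i r 0]
          ecol_less_iff[OF pos_less[OF p_act] 2(2), of p i] k by auto
      qed
      then show ?thesis using min_zero 0 order_trans by blast
    next
      case act: True
      show ?thesis
      proof (cases "r < pos i")
        case True
        define w where "w = mp i ! r"
        have w: "w < k" using mp_nth 2 w_def by blast
        obtain i' where i': "rej w = Some i'" "wr w i' \<le> wr w i" using passed[OF act True] w_def by blast
        have "c (k + w) h = k - wr w i" using c_woman[OF 2(1) w] mr_mp[OF 2(1,2)] 2(3) w_def by simp
        moreover have "c (k + w) (rejcol rej w) = k - wr w i'"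
          using c_woman[of i' w] w rejected_act[OF w i'(1)] act_less i'(1) by (simp add: rejcol_def)
        ultimately have "c (k + w) h \<le> c (k + w) (rejcol rej w)" using i' by simp
        then show ?thesis using min_woman[OF w] w by (intro exI[of _ "k + w"]) (auto intro: order_trans)
      next
        case False
        show ?thesis
        proof (cases "p = 0 \<or> i \<noteq> p")
          case True
          have "c i h \<le> c i (cur i)" using c_man[OF 2(1,2)] c_man[OF 2(1) pos_less[OF act]] False 2(3) by simp
          then show ?thesis using min_man[OF act True] 2(1) by (intro exI[of _ i]) (auto intro: order_trans)
        next
          case ip: False
          have "c 0 h \<le> c 0 (cur p)"
          proof (cases "r = pos p")
            case True
            then show ?thesis using 2 ip by simp
          next
            case neq: False
            then show ?thesis using c_far_antimono[OF 0 cur_p_far, of h] 2 ecol_far_iff[of i r 0]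
              ecol_less_iff[OF pos_less[OF p_act] 2(2), of p i] k ip False by auto
          qed
          then show ?thesis using min_zero 0 order_trans by blast
        qed
      qed
    qed
  qed
  then show ?thesis using k D_less card_D
    by (subst ordinal_basis_iff) (auto simp: dim_ordinal_mat c_def)
qed

end

section \<open>Feasibility of \<open>B\<close>: potentials, stamps and the chain of
  rejections\<close>

context gs_state
begin

text \<open>If \<open>w\<close> rejected \<open>i \<in> H\<close>, the edges of \<open>i\<close> to
  \<open>w\<close> and to his present woman give both women the same potential, and the present
  woman has the later stamp. Hence induction from the latest stamp downwards. \<open>H\<close> and
  \<open>T'\<close> are kept general to serve \<open>B\<close>, where the pending man is left out,
  as well as the final \<open>D\<close>, where he counts as accepted.\<close>

lemma kernel_zero:
  fixes \<pi> \<sigma> :: "nat \<Rightarrow> real"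
  assumes H: "\<forall>i\<in>H. wm i < k \<and> \<pi> i + \<sigma> (wm i) = 0"
    and none: "\<forall>w<k. rej w = None \<longrightarrow> \<sigma> w = 0"
    and some: "\<forall>w<k. \<forall>i. rej w = Some i \<longrightarrow> \<sigma> w + \<pi> i = 0"
    and rest: "\<forall>i<k. i \<notin> H \<longrightarrow> \<pi> i = 0"
    and st: "\<forall>w<k. \<forall>i\<in>H. rej w = Some i \<longrightarrow> T' w < (T' (wm i) :: nat)"
  shows "w < k \<Longrightarrow> \<sigma> w = 0" and "i < k \<Longrightarrow> \<pi> i = 0"
proof -
  define m where "m = Max (T' ` {..<k})"
  have le: "T' w \<le> m" if "w < k" for w unfolding m_def using that by simp
  have \<sigma>0: "\<sigma> w = 0" if "w < k" for w
    using that
  proof (induction "m - T' w" arbitrary: w rule: less_induct)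
    case less
    show ?case
    proof (cases "rej w")
      case None
      then show ?thesis using none less.prems by blast
    next
      case (Some i)
      have ik: "i < k" using rejected_act[OF less.prems Some] act_less by blast
      have "\<pi> i = 0"
      proof (cases "i \<in> H")
        case True
        then have "m - T' (wm i) < m - T' w"
          using st less.prems Some True le[of "wm i"] H by (meson diff_less_mono2 order_less_le_trans)
        then have "\<sigma> (wm i) = 0" using less.hyps bspec[OF H True] by blast
        then show ?thesis using bspec[OF H True] by simp
      qed (use rest ik in blast)
      then show ?thesis using some less.prems Some by force
    qed
  qed
  then show "w < k \<Longrightarrow> \<sigma> w = 0" .
  show "\<pi> i = 0" if "i < k"
  proof (cases "i \<in> H")
    case True
    then show ?thesis using bspec[OF H True] \<sigma>0[of "wm i"] by simp
  qed (use rest that in blast)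
qed

lemma column_kernel:
  fixes \<pi> :: "nat \<Rightarrow> real"
  assumes ker: "\<forall>j\<in>X. (\<Sum>v<2 * k. incidence_mat k mp $$ (v, j) * \<pi> v) = 0"
  shows "i \<in> act p \<Longrightarrow> cur i \<in> X \<Longrightarrow> \<pi> i + \<pi> (k + wm i) = 0"
    and "w < k \<Longrightarrow> rejcol rej w \<in> X \<Longrightarrow> rej w = None \<Longrightarrow> \<pi> (k + w) = 0"
    and "w < k \<Longrightarrow> rejcol rej w \<in> X \<Longrightarrow> rej w = Some i \<Longrightarrow> \<pi> (k + w) + \<pi> i = 0"
    and "j < 2 * k \<Longrightarrow> j \<in> X \<Longrightarrow> \<pi> j = 0"
proof -
  show "\<pi> i + \<pi> (k + wm i) = 0" if "i \<in> act p" "cur i \<in> X"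
    using bspec[OF ker that(2)] column_sum[OF act_less[OF that(1)] pos_less[OF that(1)], of \<pi>]
    unfolding wm_def by simp
  show loop: "\<pi> j = 0" if "j < 2 * k" "j \<in> X" for j
    using bspec[OF ker that(2)] column_sum_loop[OF that(1), of \<pi>] by simp
  show "\<pi> (k + w) = 0" if "w < k" "rejcol rej w \<in> X" "rej w = None"
    using loop[of "k + w"] that by (simp add: rejcol_def)
  show "\<pi> (k + w) + \<pi> i = 0" if w: "w < k" "rejcol rej w \<in> X" "rej w = Some i"
  proof -
    have i: "i < k" using rejected_act[OF w(1,3)] act_less by blast
    have "ecol i (mr i w) \<in> X" using w by (simp add: rejcol_def)
    then show ?thesis
      using bspec[OF ker] column_sum[OF i mr_less[OF i w(1)], of \<pi>] mp_mr[OF i w(1)]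
      by simp
  qed
qed

text \<open>The current edge of \<open>q\<close> is not in \<open>B\<close>, so his potential is
  reached from the other end: it vanishes at \<open>p\<close>, whose loop is in \<open>B\<close>
  (for \<open>p = 0\<close> it is the extra column \<open>0\<close>), and each link of the chain
  carries zero from a man to the woman holding him and on to the man she rejected.\<close>

lemma left_kernel_B:
  fixes \<pi> :: "nat \<Rightarrow> real"
  assumes ker: "\<And>j. j \<in> B \<Longrightarrow> (\<Sum>v<2 * k. incidence_mat k mp $$ (v, j) * \<pi> v) = 0"
  shows "\<forall>v<2 * k. \<pi> v = 0"
proof -
  have "\<forall>j\<in>B. (\<Sum>v<2 * k. incidence_mat k mp $$ (v, j) * \<pi> v) = 0" using ker by blast
  note col = column_kernel[OF this]
  have curB: "cur i \<in> B" if "i \<in> act p" "i \<noteq> q" for i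
    using that cur_D[of i] cur_inj[OF _ q_act] unfolding Bcols_def by blast
  have rejB: "rejcol rej w \<in> B" if "w < k" for w
    using that rejcol_D[of w] rejcol_neq_cur[OF _ q_act] unfolding Bcols_def by blast
  have loopB: "j \<in> B" if "j \<in> man_loops p \<or> j = 0" for j
    using that loop_D[of j] man_loops_less[of j] cur_neq_loop[of j q] unfolding Bcols_def by auto
  have \<pi>p: "\<pi> p = 0"
    using col(4)[of p] loopB[of p] p_less by (auto simp: man_loops_def)
  have "\<pi> i = 0" if "(p, i) \<in> (rejections (act p) q pos rej)\<^sup>*" for i
    using that
  proof (induction rule: rtrancl_induct)
    case base
    show ?case by (rule \<pi>p)
  next
    case (step i i')
    then have i: "i \<in> act p" "i \<noteq> q" "rej (wm i) = Some i'" unfolding rejections_def wm_def by auto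
    then have "\<pi> (k + wm i) = 0" using col(1)[OF i(1) curB[OF i(1,2)]] step.IH by simp
    then show ?case using col(3)[OF wm_less[OF i(1)] rejB[OF wm_less[OF i(1)]] i(3)] by simp
  qed
  then have \<pi>q: "\<pi> q = 0" using chain by blast
  have rest: "\<forall>i<k. i \<notin> act p - {q} \<longrightarrow> \<pi> i = 0"
  proof (intro allI impI)
  fix i assume that: "i < k" "i \<notin> act p - {q}"
  show "\<pi> i = 0"
  proof (cases "i = q")
    case False
    then have "i \<in> man_loops p \<or> i = 0" using that by (auto simp: act_def man_loops_def split: if_splits)
    then show ?thesis using col(4)[of i] loopB[of i] that by simp
  qed (use \<pi>q in simp)
  qed
  have H: "\<forall>i\<in>act p - {q}. wm i < k \<and> \<pi> i + \<pi> (k + wm i) = 0"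
    using col(1) curB wm_less by blast
  have st: "\<forall>w<k. \<forall>i\<in>act p - {q}. rej w = Some i \<longrightarrow> T w < T (wm i)"
    using stamps unfolding wm_def by blast
  have women: "\<forall>w<k. rej w = None \<longrightarrow> \<pi> (k + w) = 0"
    "\<forall>w<k. \<forall>i. rej w = Some i \<longrightarrow> \<pi> (k + w) + \<pi> i = 0"
    using col(2,3) rejB by blast+
  note z = kernel_zero[of "act p - {q}" \<pi> "\<lambda>w. \<pi> (k + w)", OF H women rest st]
  show ?thesis
  proof (intro allI impI)
    fix v assume v: "v < 2 * k"
    show "\<pi> v = 0"
    proof (cases "v < k")
      case True
      then show ?thesis using z(2) by blast
    next
      case False
      then show ?thesis using z(1)[of "v - k"] v by simp
    qed
  qed
qed

text \<open>Along links the stamps of the holding women increase strictly, except for a link into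
  \<open>q\<close>; but from \<open>q\<close> no link departs.\<close>

lemma rejections_acyclic: "acyclic (rejections (act p) q pos rej)"
proof -
  let ?R = "rejections (act p) q pos rej"
  have "j = q \<or> T (wm i) < T (wm j)" if "(i, j) \<in> ?R\<^sup>+" for i j
    using that
  proof (induction rule: trancl_induct)
    case (base j)
    then show ?case using stamps[of "wm i" j] wm_less[of i] unfolding rejections_def wm_def by auto
  next
    case (step j j')
    then have j: "j \<in> act p" "j \<noteq> q" "rej (wm j) = Some j'" unfolding rejections_def wm_def by auto
    then have "j' = q \<or> T (wm j) < T (wm j')"
      using stamps[of "wm j" j'] wm_less[of j] unfolding wm_def by auto
    then show ?case using step.IH j by auto
  qed
  moreover have "i \<noteq> q" if "(i, j) \<in> ?R\<^sup>+" for i j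
    using that by (auto simp: rejections_def dest: tranclD)
  ultimately show ?thesis unfolding acyclic_def by blast
qed

text \<open>The men on the chain of rejections from \<open>p\<close> to \<open>q\<close> are shifted by one: the woman holding a man
  of the chain is matched with the man she rejected last, which leaves exactly \<open>p\<close> unmatched.\<close>

lemma ex_perfect_B: "\<exists>M \<subseteq> B. \<forall>v<2 * k. \<exists>!j. j \<in> M \<and> v \<in> col_edge k mp j"
proof -
  let ?R = "rejections (act p) q pos rej"
  define f where "f i = the (rej (wm i))" for i
  have "\<exists>P. p \<in> P \<and> q \<in> P \<and> (\<forall>x\<in>P. (p, x) \<in> ?R\<^sup>*) \<and> (\<forall>x\<in>P - {q}. (x, f x) \<in> ?R) \<and>
    bij_betw f (P - {q}) (P - {p})"
    by (rule rtrancl_path_bij[OF chain _ rejections_acyclic])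
      (auto simp: rejections_def f_def wm_def)
  then obtain P where P: "p \<in> P" "q \<in> P" "\<And>x. x \<in> P - {q} \<Longrightarrow> (x, f x) \<in> ?R"
    and bij: "bij_betw f (P - {q}) (P - {p})" by blast
  have PR: "x \<in> act p" "rej (wm x) = Some (f x)" if "x \<in> P" "x \<noteq> q" for x
    using P(3)[of x] that unfolding rejections_def wm_def by auto
  have fP: "f x \<in> P - {p}" if "x \<in> P" "x \<noteq> q" for x using bij that unfolding bij_betw_def by blast
  have finj: "x = y" if "x \<in> P" "x \<noteq> q" "y \<in> P" "y \<noteq> q" "f x = f y" for x y
    using bij that unfolding bij_betw_def inj_on_def by blast
  have fsurj: "\<exists>x\<in>P - {q}. f x = y" if "y \<in> P" "y \<noteq> p" for y
    using bij that unfolding bij_betw_def by (metis DiffI imageE singletonD)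
  \<comment> \<open>The women not held by a man outside the chain. Those among them who have
    rejected somebody hold a man of the chain and change over to their rejected man; the others have
    their loop as \<open>rejcol\<close>.\<close>
  define W where "W = {w. w < k \<and> w \<notin> wm ` (act p - P)}"
  define L where "L = insert 0 (man_loops p)"
  define M where "M = L \<union> rejcol rej ` W \<union> cur ` (act p - P)"
  have Lk: "j < k" if "j \<in> L" for j using that man_loops_less k unfolding L_def by auto
  have L_iff: "i \<in> L \<longleftrightarrow> i \<notin> act p \<or> i = p" if "i < k" for i
    using that p_less unfolding L_def by (auto simp: act_def man_loops_def split: if_splits)
  have MB: "M \<subseteq> B"
  proof
    fix j assume "j \<in> M"
    then consider "j \<in> L" | w where "w < k" "j = rejcol rej w" | i where "i \<in> act p - P" "j = cur i"
      unfolding M_def W_def by blast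
    then show "j \<in> B"
    proof cases
      case 1
      then show ?thesis using loop_D[of j] Lk[OF 1] cur_neq_loop[of j q] unfolding Bcols_def L_def by auto
    next
      case (2 w)
      then show ?thesis using rejcol_D[of w] rejcol_neq_cur[OF _ q_act, of w] unfolding Bcols_def by simp
    next
      case (3 i)
      then have "i \<in> act p" "i \<noteq> q" using P(2) by auto
      then have "cur i \<in> D" "cur i \<noteq> cur q" using cur_D[of i] cur_inj[OF _ q_act, of i] by auto
      then show ?thesis using 3 unfolding Bcols_def by simp
    qed
  qed
  have W_holder: "\<exists>h\<in>P - {q}. wm h = w \<and> i = f h" if w: "w \<in> W" "rej w = Some i" for w i
  proof -
    have "w < k" using w W_def by blast
    then obtain h where h: "h \<in> act p - {q}" "wm h = w" using rejected_holder[OF _ w(2)] by blast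
    moreover have "h \<in> P" using w(1) h unfolding W_def by blast
    ultimately show ?thesis using w(2) unfolding f_def by (intro bexI[of _ h]) auto
  qed
  \<comment> \<open>A man can be covered by his loop, by the rejected edge at the woman of his
    predecessor on the chain, or by his own edge off the chain. Uniqueness amounts to excluding two
    of these and to the injectivity of \<open>f\<close>.\<close>
  have man_in: "j \<in> M \<and> i \<in> col_edge k mp j \<longleftrightarrow>
      j = i \<and> i \<in> L \<or> (\<exists>h\<in>P - {q}. wm h \<in> W \<and> f h = i \<and> j = rejcol rej (wm h)) \<or> i \<in> act p - P \<and> j = cur i"
    if i: "i < k" for i j
  proof
    assume j: "j \<in> M \<and> i \<in> col_edge k mp j"
    then consider "j \<in> L" | w where "w \<in> W" "j = rejcol rej w" | i' where "i' \<in> act p - P" "j = cur i'"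
      unfolding M_def by blast
    then show "j = i \<and> i \<in> L \<or> (\<exists>h\<in>P - {q}. wm h \<in> W \<and> f h = i \<and> j = rejcol rej (wm h)) \<or> i \<in> act p - P \<and> j = cur i"
    proof cases
      case 1
      then show ?thesis using j Lk[OF 1] by (simp add: col_edge_loop)
    next
      case (2 w)
      then have "w < k" by (simp add: W_def)
      then have "rej w = Some i" using j 2 i col_edge_rejcol[of w] by (auto split: option.splits)
      then show ?thesis using W_holder[OF 2(1)] 2 by blast
    next
      case (3 i')
      then show ?thesis using j i col_edge_cur[of i'] by auto
    qed
  next
    assume "j = i \<and> i \<in> L \<or> (\<exists>h\<in>P - {q}. wm h \<in> W \<and> f h = i \<and> j = rejcol rej (wm h)) \<or> i \<in> act p - P \<and> j = cur i"
    then consider "j = i" "i \<in> L" | h where "h \<in> P - {q}" "wm h \<in> W" "f h = i" "j = rejcol rej (wm h)"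
      | "i \<in> act p - P" "j = cur i" by blast
    then show "j \<in> M \<and> i \<in> col_edge k mp j"
    proof cases
      case 1
      then show ?thesis using i by (auto simp: M_def col_edge_loop)
    next
      case (2 h)
      then show ?thesis using PR[of h] col_edge_rejcol[of "wm h"] by (auto simp: M_def W_def)
    next
      case 3
      then show ?thesis using col_edge_cur[of i] by (auto simp: M_def)
    qed
  qed
  have woman_in: "j \<in> M \<and> k + w \<in> col_edge k mp j \<longleftrightarrow>
      w \<in> W \<and> j = rejcol rej w \<or> (\<exists>i\<in>act p - P. wm i = w \<and> j = cur i)"
    if w: "w < k" for w j
  proof
    assume j: "j \<in> M \<and> k + w \<in> col_edge k mp j"
    then consider "j \<in> L" | w' where "w' \<in> W" "j = rejcol rej w'" | i where "i \<in> act p - P" "j = cur i"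
      unfolding M_def by blast
    then show "w \<in> W \<and> j = rejcol rej w \<or> (\<exists>i\<in>act p - P. wm i = w \<and> j = cur i)"
    proof cases
      case 1
      then show ?thesis using j Lk[OF 1] by (simp add: col_edge_loop)
    next
      case (2 w')
      then have w': "w' < k" by (simp add: W_def)
      have "w' = w"
      proof (cases "rej w'")
        case None
        then show ?thesis using j 2 col_edge_rejcol[OF w'] by simp
      next
        case (Some i)
        then have "i < k" using rejected_act[OF w'] act_less by blast
        then show ?thesis using j 2 col_edge_rejcol[OF w'] Some by auto
      qed
      then show ?thesis using 2 by blast
    next
      case (3 i)
      then have "i < k" using act_less by blast
      then show ?thesis using j 3 col_edge_cur[of i] by auto
    qed
  next
    assume "w \<in> W \<and> j = rejcol rej w \<or> (\<exists>i\<in>act p - P. wm i = w \<and> j = cur i)"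
    then show "j \<in> M \<and> k + w \<in> col_edge k mp j"
    proof (elim disjE bexE conjE)
      assume "w \<in> W" "j = rejcol rej w"
      then show ?thesis using col_edge_rejcol[OF w] by (auto simp: M_def split: option.splits)
    next
      fix i assume "i \<in> act p - P" "wm i = w" "j = cur i"
      then show ?thesis using col_edge_cur[of i] by (auto simp: M_def)
    qed
  qed
  have notP: "i \<in> act p - {q}" if "i \<in> act p - P" for i using that P(2) by blast
  have PW: "wm h \<in> W" if "h \<in> P - {q}" for h
    using that PR[of h] wm_less held_unique notP unfolding W_def by blast
  have "\<exists>!j. j \<in> M \<and> v \<in> col_edge k mp j" if v: "v < 2 * k" for v
  proof (cases "v < k")
    case True
    note in_iff = man_in[OF True]
    consider "v \<in> L" | "v \<notin> L" "v \<in> P" | "v \<notin> L" "v \<notin> P" by blast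
    then show ?thesis
    proof cases
      case 1
      then have v: "v \<notin> act p \<or> v = p" using L_iff[OF True] by blast
      have "f h \<noteq> v" if h: "h \<in> P - {q}" for h
      proof -
        have "f h \<in> act p" using rejected_act[OF wm_less[OF PR(1)] PR(2)] h by simp
        then show ?thesis using v fP[of h] h by auto
      qed
      moreover have "v \<notin> act p - P" using v P(1) by auto
      ultimately show ?thesis unfolding in_iff using 1 by (intro ex1I[of _ v]) auto
    next
      case 2
      then have "v \<noteq> p" using L_iff[OF True] by blast
      then obtain h where h: "h \<in> P - {q}" "f h = v" using fsurj 2 by blast
      show ?thesis unfolding in_iff
      proof (rule ex1I[of _ "rejcol rej (wm h)"])
        show "rejcol rej (wm h) = v \<and> v \<in> L \<or> (\<exists>h'\<in>P - {q}. wm h' \<in> W \<and> f h' = v \<and>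
          rejcol rej (wm h) = rejcol rej (wm h')) \<or> v \<in> act p - P \<and> rejcol rej (wm h) = cur v"
          using h PW by blast
      next
        fix j assume "j = v \<and> v \<in> L \<or> (\<exists>h\<in>P - {q}. wm h \<in> W \<and> f h = v \<and> j = rejcol rej (wm h)) \<or>
          v \<in> act p - P \<and> j = cur v"
        then obtain h' where "h' \<in> P - {q}" "f h' = v" "j = rejcol rej (wm h')" using 2 by blast
        then show "j = rejcol rej (wm h)" using finj[of h h'] h by blast
      qed
    next
      case 3
      then have "v \<in> act p - P" "\<And>h. h \<in> P - {q} \<Longrightarrow> f h \<noteq> v" using L_iff[OF True] fP by blast+
      then show ?thesis unfolding in_iff using 3 by (intro ex1I[of _ "cur v"]) auto
    qed
  next
    case False
    define w where "w = v - k"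
    have w: "w < k" "v = k + w" using False v w_def by auto
    show ?thesis
    proof (cases "w \<in> W")
      case True
      then have "\<And>i. i \<in> act p - P \<Longrightarrow> wm i \<noteq> w" unfolding W_def by blast
      then show ?thesis unfolding w(2) woman_in[OF w(1)] using True
        by (intro ex1I[of _ "rejcol rej w"]) auto
    next
      case False
      then obtain i where i: "i \<in> act p - P" "wm i = w" using w unfolding W_def by blast
      have uniq: "i' = i" if "i' \<in> act p - P" "wm i' = w" for i'
        using held_unique[OF notP[OF that(1)] notP[OF i(1)]] that(2) i(2) by simp
      show ?thesis unfolding w(2) woman_in[OF w(1)]
      proof (rule ex1I[of _ "cur i"])
        show "w \<in> W \<and> cur i = rejcol rej w \<or> (\<exists>i'\<in>act p - P. wm i' = w \<and> cur i = cur i')" using i by blast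
        fix j assume "w \<in> W \<and> j = rejcol rej w \<or> (\<exists>i\<in>act p - P. wm i = w \<and> j = cur i)"
        then obtain i' where "i' \<in> act p - P" "wm i' = w" "j = cur i'" using False by blast
        then show "j = cur i" using uniq[of i'] by simp
      qed
    qed
  qed
  then show ?thesis using MB by blast
qed

lemma feasible_B: "feasible_basis (incidence_mat k mp) (ones_vec k) B"
proof -
  obtain M where M: "M \<subseteq> B" "\<forall>v<2 * k. \<exists>!j. j \<in> M \<and> v \<in> col_edge k mp j" using ex_perfect_B by blast
  show ?thesis
  proof (rule feasible_basis_if_perfect)
    show "B \<subseteq> {..<num_cols k}" using B_less by auto
    show "card B = 2 * k" by (rule card_B)
    show "M \<subseteq> B" by (rule M(1))
    show "\<exists>!j. j \<in> M \<and> v \<in> col_edge k mp j" if "v < 2 * k" for v using M(2) that by blast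
    show "\<forall>v<2 * k. \<pi> v = 0"
      if "\<And>j. j \<in> B \<Longrightarrow> (\<Sum>v<2 * k. incidence_mat k mp $$ (v, j) * \<pi> v) = 0" for \<pi> :: "nat \<Rightarrow> real"
      using that by (rule left_kernel_B)
  qed
qed

end

text \<open>All men have arrived and the pending proposal goes to a free woman, so accepting it
  completes a stable matching.\<close>

locale gs_final = gs_state +
  assumes p_zero: "p = 0"
    and q_free: "h \<in> act p \<Longrightarrow> h \<noteq> q \<Longrightarrow> wm h \<noteq> wm q"
begin

lemma act_all: "act p = {..<k}"
  by (simp add: act_def p_zero)

lemma wm_inj: "i < k \<Longrightarrow> i' < k \<Longrightarrow> wm i = wm i' \<Longrightarrow> i = i'"
  using held_unique[of i i'] q_free[of i] q_free[of i'] unfolding act_all by (metis DiffI lessThan_iff singletonD)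

lemma wm_image: "wm ` {..<k} = {..<k}"
proof (rule card_subset_eq)
  show "wm ` {..<k} \<subseteq> {..<k}" using wm_less unfolding act_all by auto
  have "inj_on wm {..<k}" using wm_inj by (intro inj_onI) auto
  then show "card (wm ` {..<k}) = card {..<k}" by (rule card_image)
qed simp

lemma wm_surj: "w < k \<Longrightarrow> \<exists>i<k. wm i = w"
  using wm_image by (metis imageE lessThan_iff)

lemma node_edge:
  assumes v: "v < 2 * k"
  obtains i where "i < k" "v \<in> {i, k + wm i}" "\<forall>i'<k. v \<in> {i', k + wm i'} \<longrightarrow> i' = i"
proof (cases "v < k")
  case True
  then show ?thesis using that[of v] by auto
next
  case False
  then have "v - k < k" using v by simp
  then obtain i where i: "i < k" "wm i = v - k" using wm_surj by blast
  show ?thesis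
  proof (rule that[of i])
    show "i < k" by (rule i)
    show "v \<in> {i, k + wm i}" using i False by simp
    show "\<forall>i'<k. v \<in> {i', k + wm i'} \<longrightarrow> i' = i"
    proof (intro allI impI)
      fix i' assume i': "i' < k" "v \<in> {i', k + wm i'}"
      then have "wm i' = wm i" using False i by auto
      then show "i' = i" by (rule wm_inj[OF i'(1) i(1)])
    qed
  qed
qed

lemma perfect_final:
  assumes v: "v < 2 * k"
  shows "\<exists>!j. j \<in> cur ` {..<k} \<and> v \<in> col_edge k mp j"
proof -
  have edge: "col_edge k mp (cur i) = {i, k + wm i}" if "i < k" for i
    using col_edge_cur[of i] that unfolding act_all by simp
  obtain i where i: "i < k" "v \<in> {i, k + wm i}" "\<forall>i'<k. v \<in> {i', k + wm i'} \<longrightarrow> i' = i"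
    using v by (rule node_edge)
  show ?thesis
  proof (rule ex1I[of _ "cur i"])
    show "cur i \<in> cur ` {..<k} \<and> v \<in> col_edge k mp (cur i)" using i(1,2) edge[OF i(1)] by simp
    fix j assume "j \<in> cur ` {..<k} \<and> v \<in> col_edge k mp j"
    then obtain i' where i': "i' < k" "j = cur i'" "v \<in> col_edge k mp (cur i')" by blast
    then have "i' = i" using i(3) edge[OF i'(1)] by blast
    then show "j = cur i" using i'(2) by simp
  qed
qed

text \<open>No loop of a man is left, but all men now have their current edge. The stamps need not
  cover \<open>q\<close> yet, so the woman he proposes to is given the latest stamp, as if she had
  accepted him.\<close>

lemma left_kernel_D:
  fixes \<pi> :: "nat \<Rightarrow> real"
  assumes ker: "\<And>j. j \<in> D \<Longrightarrow> (\<Sum>v<2 * k. incidence_mat k mp $$ (v, j) * \<pi> v) = 0"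
  shows "\<forall>v<2 * k. \<pi> v = 0"
proof -
  have "\<forall>j\<in>D. (\<Sum>v<2 * k. incidence_mat k mp $$ (v, j) * \<pi> v) = 0" using ker by blast
  note col = column_kernel[OF this]
  define T' where "T' = T(wm q := Suc (Max (T ` {..<k})))"
  have H: "\<forall>i\<in>{..<k}. wm i < k \<and> \<pi> i + \<pi> (k + wm i) = 0"
    using col(1) cur_D wm_less unfolding act_all by blast
  have st: "T' w < T' (wm i)" if w: "w < k" "rej w = Some i" for w i
  proof -
    have "w \<noteq> wm q" using rejected_holder[OF w] q_free by blast
    then show ?thesis using stamps_raise[of w i] w unfolding T'_def by blast
  qed
  have st': "\<forall>w<k. \<forall>i\<in>{..<k}. rej w = Some i \<longrightarrow> T' w < T' (wm i)" using st by blast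
  have women: "\<forall>w<k. rej w = None \<longrightarrow> \<pi> (k + w) = 0"
    "\<forall>w<k. \<forall>i. rej w = Some i \<longrightarrow> \<pi> (k + w) + \<pi> i = 0"
    using col(2,3) rejcol_D by blast+
  have rest: "\<forall>i<k. i \<notin> {..<k} \<longrightarrow> \<pi> i = 0" by simp
  note z = kernel_zero[of "{..<k}" \<pi> "\<lambda>w. \<pi> (k + w)", OF H women rest st']
  show ?thesis
  proof (intro allI impI)
    fix v assume v: "v < 2 * k"
    show "\<pi> v = 0"
    proof (cases "v < k")
      case True
      then show ?thesis using z(2) by blast
    next
      case False
      then show ?thesis using z(1)[of "v - k"] v by simp
    qed
  qed
qed

lemma cur_image_subset: "cur ` {..<k} \<subseteq> D"
  using cur_D unfolding act_all by blast

lemma feasible_D: "feasible_basis (incidence_mat k mp) (ones_vec k) D"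
proof (rule feasible_basis_if_perfect[OF _ card_D cur_image_subset perfect_final])
  show "D \<subseteq> {..<num_cols k}" using D_less by auto
  show "\<forall>v<2 * k. \<pi> v = 0"
    if "\<And>j. j \<in> D \<Longrightarrow> (\<Sum>v<2 * k. incidence_mat k mp $$ (v, j) * \<pi> v) = 0" for \<pi> :: "nat \<Rightarrow> real"
    using that by (rule left_kernel_D)
qed

definition \<mu> :: "nat set set" where
  "\<mu> = (\<lambda>i. {i, k + wm i}) ` {..<k}"

lemma col_edge_in_\<mu>:
  assumes "j < num_cols k"
  shows "col_edge k mp j \<in> \<mu> \<longleftrightarrow> j \<in> cur ` {..<k}"
  using assms
proof (cases rule: column_cases)
  case 1
  then have "{j} \<noteq> {i, k + wm i}" if "i < k" for i using that by auto
  then have "col_edge k mp j \<notin> \<mu>" using 1 by (auto simp: \<mu>_def col_edge_loop)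
  moreover have "j \<notin> cur ` {..<k}" using cur_neq_loop[OF 1] by blast
  ultimately show ?thesis by blast
next
  case (2 i r)
  have "col_edge k mp j \<in> \<mu> \<longleftrightarrow> (\<exists>i'<k. {i, k + mp i ! r} = {i', k + wm i'})"
    using 2 by (auto simp: \<mu>_def col_edge_ecol)
  also have "\<dots> \<longleftrightarrow> mp i ! r = wm i" using 2 by (auto simp: doubleton_eq_iff)
  also have "\<dots> \<longleftrightarrow> r = pos i"
  proof
    have "i \<in> act p" using 2(1) by (simp add: act_all)
    then have "mr i (wm i) = pos i" by (rule mr_wm)
    then show "r = pos i" if "mp i ! r = wm i" using mr_mp[OF 2(1,2)] that by simp
    show "mp i ! r = wm i" if "r = pos i" using that by (simp add: wm_def)
  qed
  also have "\<dots> \<longleftrightarrow> j \<in> cur ` {..<k}"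
  proof
    show "j \<in> cur ` {..<k}" if "r = pos i" using that 2(1,3) by simp
    assume "j \<in> cur ` {..<k}"
    then obtain i' where i': "j = cur i'" "i' \<in> {..<k}" by (rule imageE)
    then have "pos i' < k" using pos_less[of i'] by (simp add: act_all)
    then show "r = pos i" using ecol_eq_iff[OF 2(2), of "pos i'" i i'] i'(1) 2(3) by simp
  qed
  finally show ?thesis .
qed

lemma char_vec_\<mu>:
  "char_vec k mp \<mu> = vec (num_cols k) (\<lambda>j. if j \<in> cur ` {..<k} then 1 else 0)"
  unfolding char_vec_def using col_edge_in_\<mu> by (intro eq_vecI) auto

lemma basic_solution_\<mu>:
  "basic_solution (incidence_mat k mp) (ones_vec k) D (char_vec k mp \<mu>)"
  unfolding char_vec_\<mu>
  by (rule perfect_columns_solution[OF _ perfect_final cur_image_subset])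
    (use cur_less in \<open>auto simp: act_all\<close>)

lemma matching_\<mu>: "matching k \<mu>"
  unfolding matching_def
proof (intro conjI allI impI)
  show "\<mu> \<subseteq> loops k \<union> valid_edges k"
    using wm_less unfolding \<mu>_def valid_edges_def act_all by blast
  fix v assume v: "v < 2 * k"
  obtain i where i: "i < k" "v \<in> {i, k + wm i}" "\<forall>i'<k. v \<in> {i', k + wm i'} \<longrightarrow> i' = i"
    using v by (rule node_edge)
  show "\<exists>!e. e \<in> \<mu> \<and> v \<in> e"
  proof (rule ex1I[of _ "{i, k + wm i}"])
    show "{i, k + wm i} \<in> \<mu> \<and> v \<in> {i, k + wm i}" using i(1,2) by (simp add: \<mu>_def)
    fix e assume "e \<in> \<mu> \<and> v \<in> e"
    then obtain i' where "i' < k" "e = {i', k + wm i'}" "v \<in> {i', k + wm i'}" unfolding \<mu>_def by blast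
    moreover from this have "i' = i" using i(3) by blast
    ultimately show "e = {i, k + wm i}" by simp
  qed
qed

lemma \<mu>_partner:
  assumes "i < k"
  shows "(THE f. f \<in> \<mu> \<and> i \<in> f) = {i, k + wm i}" "(THE f. f \<in> \<mu> \<and> k + wm i \<in> f) = {i, k + wm i}"
proof -
  have e: "{i, k + wm i} \<in> \<mu>" using assms by (simp add: \<mu>_def)
  have "i < 2 * k" "k + wm i < 2 * k" using assms wm_less[of i] unfolding act_all by auto
  then have u: "\<exists>!f. f \<in> \<mu> \<and> i \<in> f" "\<exists>!f. f \<in> \<mu> \<and> k + wm i \<in> f"
    using matching_\<mu> unfolding matching_def by blast+
  show "(THE f. f \<in> \<mu> \<and> i \<in> f) = {i, k + wm i}" by (rule the1_equality[OF u(1)]) (simp add: e)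
  show "(THE f. f \<in> \<mu> \<and> k + wm i \<in> f) = {i, k + wm i}" by (rule the1_equality[OF u(2)]) (simp add: e)
qed

text \<open>If \<open>i\<close> prefers \<open>w\<close> to his partner, he has passed her on his
  list; she has then rejected somebody at least as good as \<open>i\<close> and holds somebody
  better still.\<close>

lemma stable_\<mu>: "stable_matching k mp wp \<mu>"
  unfolding stable_matching_def
proof (intro conjI notI matching_\<mu>)
  assume "\<exists>e\<in>valid_edges k. e \<notin> \<mu> \<and> (\<forall>v\<in>e. prefers k mp wp v e (THE f. f \<in> \<mu> \<and> v \<in> f))"
  then obtain i w where iw: "i < k" "w < k" "prefers k mp wp i {i, k + w} (THE f. f \<in> \<mu> \<and> i \<in> f)"
    "prefers k mp wp (k + w) {i, k + w} (THE f. f \<in> \<mu> \<and> k + w \<in> f)"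
    unfolding valid_edges_def by auto
  have ia: "i \<in> act p" using iw by (simp add: act_all)
  obtain h where h: "h < k" "wm h = w" using wm_surj[OF iw(2)] by blast
  have "mr i w < mr i (wm i)"
    using iw(3) \<mu>_partner(1)[OF iw(1)] edge_rank_man[OF iw(1,2)] edge_rank_man[OF iw(1) wm_less[OF ia]]
    by (simp add: prefers_def)
  then have less: "mr i w < pos i" using mr_wm[OF ia] by simp
  then obtain i' where i': "rej w = Some i'" "wr w i' \<le> wr w i"
    using passed[OF ia less] mp_mr[OF iw(1,2)] by auto
  obtain h' where h': "h' \<in> act p - {q}" "wm h' = w" "wr w h' < wr w i'"
    using rejected_holder[OF iw(2) i'(1)] by blast
  then have "h' = h" using wm_inj[of h' h] h by (simp add: act_all)
  moreover have "wr w i < wr w h"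
    using iw(4) \<mu>_partner(2)[OF h(1)] h edge_rank_woman[OF iw(2,1)] edge_rank_woman[OF iw(2) h(1)]
    by (simp add: prefers_def)
  ultimately show False using h' i' by simp
qed

end

section \<open>The pivoting rule and the run\<close>

text \<open>Heads of filtered lists instead of choice operators, here and below, because the program
  computes them in the same form.\<close>

definition entering :: "nat set \<Rightarrow> nat set \<Rightarrow> nat" where
  "entering B D = hd (filter (\<lambda>j. j \<notin> B) (sorted_list_of_set D))"

definition argmin_col :: "(nat \<Rightarrow> nat \<Rightarrow> nat) \<Rightarrow> nat \<Rightarrow> nat set \<Rightarrow> nat" where
  "argmin_col c v D = hd (filter (\<lambda>j. \<forall>j'\<in>D. c v j \<le> c v j') (sorted_list_of_set D))"

definition first_row :: "nat \<Rightarrow> (nat \<Rightarrow> nat \<Rightarrow> bool) \<Rightarrow> nat \<Rightarrow> nat" where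
  "first_row n inc j = hd (filter (\<lambda>v. inc v j) [0..<n])"

definition last_row :: "nat \<Rightarrow> (nat \<Rightarrow> nat \<Rightarrow> bool) \<Rightarrow> nat \<Rightarrow> nat" where
  "last_row n inc j = hd (filter (\<lambda>v. inc v j \<and> (\<forall>v'<n. inc v' j \<longrightarrow> v' \<le> v)) [0..<n])"

text \<open>The entering edge is a proposal to the woman \<open>v\<close>. If she holds another proposal, the edge of the
  best man she rejected before (or her loop) leaves the basis; otherwise the loop of the latest
  arrival does, who is recognised by his edge being the last one in \<open>D\<close>.\<close>

definition leaving ::
    "nat \<Rightarrow> (nat \<Rightarrow> nat \<Rightarrow> bool) \<Rightarrow> (nat \<Rightarrow> nat \<Rightarrow> nat) \<Rightarrow> nat set \<Rightarrow> nat set \<Rightarrow> nat" where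
  "leaving n inc c B D =
     (let t = entering B D; v = last_row n inc t in
      if \<exists>j\<in>D. j \<noteq> t \<and> n \<le> j \<and> inc v j then argmin_col c v D
      else first_row n inc (argmin_col c 0 D))"

definition dominating :: "nat \<Rightarrow> nat \<Rightarrow> (nat \<Rightarrow> nat \<Rightarrow> nat) \<Rightarrow> nat set \<Rightarrow> bool" where
  "dominating n N c E \<longleftrightarrow> (\<forall>h<N. \<exists>i<n. \<forall>j\<in>E. c i h \<le> c i j)"

definition step ::
    "nat \<Rightarrow> nat \<Rightarrow> (nat \<Rightarrow> nat \<Rightarrow> bool) \<Rightarrow> (nat \<Rightarrow> nat \<Rightarrow> nat) \<Rightarrow> nat set \<times> nat set \<Rightarrow> nat set \<times> nat set" where
  "step n N inc c = (\<lambda>(B, D).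
     let l = leaving n inc c B D; B' = insert (entering B D) (B - {l}) in
     (B', if B' = D then D
          else insert (hd (filter (\<lambda>j. j \<notin> D \<and> dominating n N c (insert j (D - {l}))) [0..<N])) (D - {l})))"

text \<open>For a valid edge \<open>first_row\<close> is its man. In the final \<open>D\<close> the
  minimum of a man's row is his current edge, as his rejected edges have larger entries; so row
  minima give the matching without solving for the basic solution.\<close>

definition selected :: "nat \<Rightarrow> (nat \<Rightarrow> nat \<Rightarrow> bool) \<Rightarrow> (nat \<Rightarrow> nat \<Rightarrow> nat) \<Rightarrow> nat set \<Rightarrow> nat \<Rightarrow> bool" where
  "selected n inc c D j \<longleftrightarrow> n \<le> j \<and> j \<in> D \<and> (\<forall>j'\<in>D. c (first_row n inc j) j \<le> c (first_row n inc j) j')"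

text \<open>A rule must be legal for every feasible basis and entering column, and away from the
  simulated run \<open>leaving\<close> promises nothing; there any legal column is chosen. Along the
  run the first branch applies, which is the one the program computes.\<close>

definition proposal_rule :: "real mat \<Rightarrow> real vec \<Rightarrow> nat mat \<Rightarrow> pivoting_rule" where
  "proposal_rule A b C B D =
     (let l = leaving (dim_row A) (\<lambda>i j. A $$ (i, j) = 1) (\<lambda>i j. C $$ (i, j)) B D;
          legal = (\<lambda>l. l \<in> B \<and> feasible_basis A b (insert (entering B D) (B - {l})))
      in if legal l then l else (SOME l. legal l))"

lemma hd_filter_unique:
  assumes "a \<in> set xs" "Q a" "\<And>b. b \<in> set xs \<Longrightarrow> Q b \<Longrightarrow> b = a"
  shows "hd (filter Q xs) = a"
proof -
  have "hd (filter Q xs) \<in> set (filter Q xs)" using assms(1,2) by (intro hd_in_set) (auto simp: filter_empty_conv)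
  then show ?thesis using assms(3) by simp
qed

lemma entering_eq:
  assumes "finite D" "D - B = {j}"
  shows "entering B D = j"
  unfolding entering_def by (rule hd_filter_unique) (use assms in auto)

context marriage
begin

lemma cardinal_pivoting_rule_proposal_rule:
  "cardinal_pivoting_rule (incidence_mat k mp) b (proposal_rule (incidence_mat k mp) b C)"
  unfolding cardinal_pivoting_rule_def
proof (intro allI impI)
  fix B D j
  assume *: "feasible_basis (incidence_mat k mp) b B \<and> D \<subseteq> {..<dim_col (incidence_mat k mp :: real mat)} \<and> D - B = {j}"
  define legal where "legal l \<longleftrightarrow> l \<in> B \<and> feasible_basis (incidence_mat k mp) b (insert j (B - {l}))" for l
  have "finite D" using * finite_subset by blast
  then have j: "entering B D = j" using entering_eq * by blast
  have "j < num_cols k" "j \<notin> B" using * by (auto simp: dim_incidence_mat)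
  then have "\<exists>l\<in>B. feasible_basis (incidence_mat k mp) b (insert j (B - {l}))"
    using incidence_ex_legal_pivot[of b B j] * by simp
  then have "\<exists>l. legal l" unfolding legal_def Bex_def .
  then have "legal (SOME l. legal l)" by (rule someI_ex)
  then have "legal (proposal_rule (incidence_mat k mp) b C B D)"
    unfolding proposal_rule_def Let_def j legal_def[symmetric] by simp
  then show "proposal_rule (incidence_mat k mp) b C B D \<in> B \<and>
      feasible_basis (incidence_mat k mp) b (insert j (B - {proposal_rule (incidence_mat k mp) b C B D}))"
    unfolding legal_def .
qed

definition inc :: "nat \<Rightarrow> nat \<Rightarrow> bool" where
  "inc v j \<longleftrightarrow> (incidence_mat k mp :: real mat) $$ (v, j) = 1"

lemma inc_iff: "v < 2 * k \<Longrightarrow> j < num_cols k \<Longrightarrow> inc v j \<longleftrightarrow> v \<in> col_edge k mp j"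
  by (simp add: inc_def incidence_entry)

lemma first_row_ecol:
  assumes "i < k" "r < k"
  shows "first_row (2 * k) inc (ecol i r) = i"
proof -
  have "[0..<2 * k] = [0..<i] @ i # [Suc i..<2 * k]"
    using upt_add_eq_append[of 0 i "2 * k - i"] upt_conv_Cons[of i "2 * k"] assms by simp
  moreover have "filter (\<lambda>v. inc v (ecol i r)) [0..<i] = []"
    using assms ecol_less by (auto simp: filter_empty_conv inc_iff col_edge_ecol)
  moreover have "inc i (ecol i r)" using assms ecol_less by (simp add: inc_iff col_edge_ecol)
  ultimately show ?thesis unfolding first_row_def by simp
qed

lemma last_row_ecol:
  assumes "i < k" "r < k"
  shows "last_row (2 * k) inc (ecol i r) = k + mp i ! r"
  unfolding last_row_def
proof (rule hd_filter_unique)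
  have w: "mp i ! r < k" by (rule mp_nth[OF assms])
  have I: "inc v (ecol i r) \<longleftrightarrow> v = i \<or> v = k + mp i ! r" if "v < 2 * k" for v
    using inc_iff[OF that ecol_less[OF assms]] col_edge_ecol[OF assms(2)] by simp
  show "k + mp i ! r \<in> set [0..<2 * k]" using w by simp
  show "inc (k + mp i ! r) (ecol i r) \<and> (\<forall>v'<2 * k. inc v' (ecol i r) \<longrightarrow> v' \<le> k + mp i ! r)"
    using I w assms by auto
  fix v assume v: "v \<in> set [0..<2 * k]" "inc v (ecol i r) \<and> (\<forall>v'<2 * k. inc v' (ecol i r) \<longrightarrow> v' \<le> v)"
  then have "k + mp i ! r \<le> v" using I[of "k + mp i ! r"] w by simp
  then show "v = k + mp i ! r" using I[of v] v assms by auto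
qed

end

section \<open>Transitions of the state as iterations of the algorithm\<close>

context gs_state
begin

abbreviation "Am \<equiv> incidence_mat k mp :: real mat"
abbreviation "bv \<equiv> ones_vec k :: real vec"
abbreviation "Cm \<equiv> ordinal_mat k mp wp"
abbreviation "\<rho> \<equiv> proposal_rule Am bv Cm"
abbreviation "nextp \<equiv> step (2 * k) (num_cols k) inc c"

lemma D_minus_B: "D - B = {cur q}"
  using cur_D[OF q_act] zero_notin_D unfolding Bcols_def by auto

lemma entering_BD: "entering B D = cur q"
  by (rule entering_eq[OF finite_D D_minus_B])

lemma argmin_col_eq:
  assumes v: "v < 2 * k" and a: "a \<in> D" and min: "\<And>j. j \<in> D \<Longrightarrow> c v a \<le> c v j"
  shows "argmin_col c v D = a"
  unfolding argmin_col_def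
proof (rule hd_filter_unique)
  show "a \<in> set (sorted_list_of_set D)" using a finite_D by simp
  show "\<forall>j'\<in>D. c v a \<le> c v j'" using min by blast
  fix j assume j: "j \<in> set (sorted_list_of_set D)" "\<forall>j'\<in>D. c v j \<le> c v j'"
  then have "j \<in> D" using finite_D by simp
  then have "c v j = c v a" using j(2) min a by (simp add: le_antisym)
  then show "j = a" using c_inj[OF v] D_less a \<open>j \<in> D\<close> by blast
qed

lemma wmq: "wm q < k" by (rule wm_less[OF q_act])

lemma leaving_holder:
  assumes "h \<in> act p" "h \<noteq> q" "wm h = wm q"
  shows "leaving (2 * k) inc c B D = rejcol rej (wm q)"
proof -
  have "last_row (2 * k) inc (cur q) = k + wm q"
    using last_row_ecol[OF act_less[OF q_act] pos_less[OF q_act]] unfolding wm_def .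
  moreover have "\<exists>j\<in>D. j \<noteq> cur q \<and> 2 * k \<le> j \<and> inc (k + wm q) j"
  proof (intro bexI[of _ "cur h"] conjI)
    show "cur h \<noteq> cur q" using cur_inj[OF assms(1) q_act] assms(2) by blast
    show "2 * k \<le> cur h" by (rule ecol_ge)
    show "inc (k + wm q) (cur h)"
      using inc_iff[of "k + wm q" "cur h"] cur_less[OF assms(1)] wmq col_edge_cur[OF assms(1)] assms(3) by simp
    show "cur h \<in> D" by (rule cur_D[OF assms(1)])
  qed
  moreover have "argmin_col c (k + wm q) D = rejcol rej (wm q)"
    by (rule argmin_col_eq) (use wmq rejcol_D min_woman in auto)
  ultimately show ?thesis unfolding leaving_def entering_BD Let_def by simp
qed

lemma leaving_free:
  assumes free: "\<And>h. h \<in> act p \<Longrightarrow> h \<noteq> q \<Longrightarrow> wm h \<noteq> wm q"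
  shows "leaving (2 * k) inc c B D = p"
proof -
  have last: "last_row (2 * k) inc (cur q) = k + wm q"
    using last_row_ecol[OF act_less[OF q_act] pos_less[OF q_act]] unfolding wm_def .
  have none: "\<not> (j \<noteq> cur q \<and> 2 * k \<le> j \<and> inc (k + wm q) j)" if j: "j \<in> D" for j
  proof
    assume *: "j \<noteq> cur q \<and> 2 * k \<le> j \<and> inc (k + wm q) j"
    then have e: "k + wm q \<in> col_edge k mp j" using inc_iff[of "k + wm q" j] D_less[OF j] wmq by simp
    from j show False
    proof (cases rule: D_cases)
      case (1 i)
      then have "wm i = wm q" using e col_edge_cur[OF 1(1)] act_less[OF 1(1)] by auto
      then show False using free[OF 1(1)] 1(2) * by blast
    next
      case (2 w)
      from 2(1) show False
      proof (cases rule: rejcol_cases)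
        case 1
        then show False using * 2 by simp
      next
        case (2 i)
        \<comment> \<open>A rejected edge at the proposed woman would mean that she holds
          somebody.\<close>
        then have "w = wm q" using e \<open>j = rejcol rej w\<close> by (auto simp: col_edge_ecol)
        then show False using rejected_holder[OF \<open>w < k\<close> 2(1)] free by blast
      qed
    next
      case 3
      then show False using * man_loops_less[OF 3] by simp
    qed
  qed
  have "argmin_col c 0 D = cur p"
    by (rule argmin_col_eq) (use k cur_D[OF p_act] min_zero in auto)
  \<comment> \<open>The column of a loop has the number of its node, so this row index is also the
    leaving column.\<close>
  moreover have "first_row (2 * k) inc (cur p) = p"
    by (rule first_row_ecol[OF p_less pos_less[OF p_act]])
  ultimately show ?thesis unfolding leaving_def entering_BD Let_def last using none by auto
qed

lemma leaving_Am: "leaving (dim_row Am) (\<lambda>i j. Am $$ (i, j) = 1) (\<lambda>i j. Cm $$ (i, j)) B D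
    = leaving (2 * k) inc c B D"
proof -
  have "(\<lambda>i j. Am $$ (i, j) = 1) = inc" "(\<lambda>i j. Cm $$ (i, j)) = c" by (auto simp: inc_def c_def fun_eq_iff)
  then show ?thesis by (simp add: dim_incidence_mat)
qed

lemma rule_eq:
  assumes "leaving (2 * k) inc c B D = l" "l \<in> B" "feasible_basis Am bv (insert (cur q) (B - {l}))"
  shows "\<rho> B D = l"
  using assms unfolding proposal_rule_def leaving_Am Let_def entering_BD by simp

lemma ordinal_basis_dominating:
  "ordinal_basis Cm E \<longleftrightarrow> E \<subseteq> {..<num_cols k} \<and> card E = 2 * k \<and> dominating (2 * k) (num_cols k) c E"
  using k by (subst ordinal_basis_iff) (auto simp: dim_ordinal_mat dominating_def c_def)

lemma B_neq_D: "B \<noteq> D"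
  using zero_notin_D unfolding Bcols_def by auto

text \<open>It suffices to exhibit one completing column: \<open>l\<close> itself completes
  \<open>D - {l}\<close> to the old basis, so at most one further column can. The search in
  \<open>step\<close> therefore finds the same column as the definite description in the
  algorithm.\<close>

lemma pivot_continue:
  assumes l: "leaving (2 * k) inc c B D = l" "l \<in> B" "l \<in> D"
    and B': "insert (cur q) (B - {l}) = B'" "feasible_basis Am bv B'" "B' \<noteq> D"
    and D': "insert j (D - {l}) = D'" "j \<notin> D" "ordinal_basis Cm D'"
  shows "scarf_iteration Am bv Cm \<rho> (B, D) (B', D') \<and> nextp (B, D) = (B', D')"
proof -
  interpret row_injective Cm by (rule row_injective_ordinal_mat)
  have \<rho>: "\<rho> B D = l" by (rule rule_eq[OF l(1,2)]) (simp add: B')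
  have uniq: "j' = j" if "j' \<notin> D" "ordinal_basis Cm (insert j' (D - {l}))" for j'
  proof (rule ordinal_pivot_unique[of l "D - {l}" j' j])
    show "ordinal_basis Cm (insert l (D - {l}))" using ordinal_basis_D l(3) by (simp add: insert_absorb)
    show "ordinal_basis Cm (insert j (D - {l}))" using D' by simp
    show "ordinal_basis Cm (insert j' (D - {l}))" by (rule that(2))
  qed (use that D' l in auto)
  have j: "j \<notin> D \<and> ordinal_basis Cm (insert j (D - {l}))" using D' by simp
  have ex1: "\<exists>!j. j \<notin> D \<and> ordinal_basis Cm (insert j (D - {l}))"
  proof (rule ex1I[of _ j])
    show "j \<notin> D \<and> ordinal_basis Cm (insert j (D - {l}))" by (rule j)
    show "j' = j" if "j' \<notin> D \<and> ordinal_basis Cm (insert j' (D - {l}))" for j'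
      using uniq[of j'] that by simp
  qed
  have the: "(THE j. j \<notin> D \<and> ordinal_basis Cm (insert j (D - {l}))) = j"
    using ex1 j by (rule the1_equality)
  have "scarf_iteration Am bv Cm \<rho> (B, D) (B', D')"
    unfolding scarf_iteration_def case_prod_conv
  proof (intro conjI exI)
    show "B \<noteq> D" by (rule B_neq_D)
    show "D - B = {cur q}" by (rule D_minus_B)
    show "l = \<rho> B D" using \<rho> by simp
    show "l \<in> B" by (rule l)
    show "B' = insert (cur q) (B - {l})" using B'(1) by simp
    show "feasible_basis Am bv B'" by (rule B')
    show "if B' = D then D' = D
      else (\<exists>!j. j \<notin> D \<and> ordinal_basis Cm (insert j (D - {l}))) \<and>
        D' = insert (THE j. j \<notin> D \<and> ordinal_basis Cm (insert j (D - {l}))) (D - {l})"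
      unfolding the using B'(3) ex1 D'(1) by simp
  qed
  moreover have "hd (filter (\<lambda>j. j \<notin> D \<and> dominating (2 * k) (num_cols k) c (insert j (D - {l}))) [0..<num_cols k]) = j"
  proof (rule hd_filter_unique)
    have d: "D' \<subseteq> {..<num_cols k}" "dominating (2 * k) (num_cols k) c D'"
      using D'(3) unfolding ordinal_basis_dominating by auto
    then show "j \<in> set [0..<num_cols k]" using D'(1) by auto
    show "j \<notin> D \<and> dominating (2 * k) (num_cols k) c (insert j (D - {l}))" using D' d by simp
    fix j' assume j': "j' \<in> set [0..<num_cols k]"
      "j' \<notin> D \<and> dominating (2 * k) (num_cols k) c (insert j' (D - {l}))"
    have "insert j' (D - {l}) \<subseteq> {..<num_cols k}" using j' D_less by auto
    moreover have "card (insert j' (D - {l})) = 2 * k"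
      using j' finite_D card_D l(3) k by (simp add: card_Diff_singleton)
    ultimately show "j' = j" using uniq j' unfolding ordinal_basis_dominating by blast
  qed
  ultimately show ?thesis unfolding step_def Let_def using l(1) entering_BD B' D' by simp
qed

text \<open>When the rejected edge of \<open>w\<close> leaves, the edge of the loser stays in
  \<open>D\<close> and takes over her row as the new rejected edge; this frees the row of the loser
  for his next proposal, which is the only new column.\<close>

lemma holder_continue:
  assumes h: "h \<in> act p" "h \<noteq> q" "wm h = wm q"
    and l: "l = h \<or> l = q" and r: "pos l < r"
    and state: "gs_state k mp wp p l (pos(l := r)) (rej(wm q := Some l)) T'"
  shows "scarf_iteration Am bv Cm \<rho> (B, D)
      (Bcols p l (pos(l := r)) (rej(wm q := Some l)), Dcols p (pos(l := r)) (rej(wm q := Some l))) \<and>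
    nextp (B, D) = (Bcols p l (pos(l := r)) (rej(wm q := Some l)), Dcols p (pos(l := r)) (rej(wm q := Some l)))"
proof -
  define w where "w = wm q"
  interpret s: gs_state k mp wp p l "pos(l := r)" "rej(w := Some l)" T' using state unfolding w_def .
  have wk: "w < k" unfolding w_def by (rule wmq)
  have la: "l \<in> act p" "wm l = w" using l h q_act w_def by auto
  have mrl: "mr l w = pos l" using mr_wm[OF la(1)] la(2) by simp
  have rk: "r < k" using s.pos_less[OF la(1)] by simp
  have rejcol': "rejcol (rej(w := Some l)) w' = (if w' = w then cur l else rejcol rej w')" for w'
    by (simp add: rejcol_def mrl)
  have new: "ecol l r \<notin> D"
  proof
    assume "ecol l r \<in> D"
    then show False
    proof (cases rule: D_cases)
      case (1 i)
      then show False using ecol_eq_iff[OF rk pos_less[OF 1(1)], of l i] r by auto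
    next
      case (2 w')
      show False
      proof (cases "w' = w")
        case True
        from 2(1) show False
        proof (cases rule: rejcol_cases)
          case 1
          then show False using 2 ecol_ge[of l r] by simp
        next
          case (2 i)
          then have "ecol i (mr i w') = ecol l r" using \<open>ecol l r = rejcol rej w'\<close> by simp
          then have "i = l \<and> mr i w' = r" unfolding ecol_eq_iff[OF 2(4) rk] .
          then show False using mrl True r by auto
        qed
      next
        case False
        then show False using s.rejcol_neq_cur[OF 2(1) la(1)] 2(2) by (simp add: rejcol')
      qed
    next
      case 3
      then show False using man_loops_less[OF 3] ecol_ge[of l r] by simp
    qed
  qed
  have cur': "(\<lambda>i. ecol i ((pos(l := r)) i)) ` act p = insert (ecol l r) (cur ` (act p - {l}))"
  proof -
    have "(\<lambda>i. ecol i ((pos(l := r)) i)) ` (act p - {l}) = cur ` (act p - {l})" by (rule image_cong) auto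
    then show ?thesis using image_insert[of "\<lambda>i. ecol i ((pos(l := r)) i)" l "act p - {l}"] la(1)
      by (simp add: insert_absorb)
  qed
  have rej': "rejcol (rej(w := Some l)) ` {..<k} = insert (cur l) (rejcol rej ` ({..<k} - {w}))"
  proof -
    have "rejcol (rej(w := Some l)) ` ({..<k} - {w}) = rejcol rej ` ({..<k} - {w})"
      by (rule image_cong) (auto simp: rejcol')
    then show ?thesis using image_insert[of "rejcol (rej(w := Some l))" w "{..<k} - {w}"] wk
      by (simp add: insert_absorb rejcol')
  qed
  have D1: "D - {rejcol rej w} = cur ` act p \<union> rejcol rej ` ({..<k} - {w}) \<union> man_loops p"
  proof -
    have "rejcol rej w \<notin> cur ` act p" using rejcol_neq_cur[OF wk] by auto
    moreover have "rejcol rej w \<notin> rejcol rej ` ({..<k} - {w})" using rejcol_inj[OF wk] by auto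
    moreover have "rejcol rej w \<notin> man_loops p" using rejcol_ge[OF wk] man_loops_less by fastforce
    ultimately show ?thesis unfolding Dcols_def using wk by auto
  qed
  have cur2: "cur ` act p = insert (cur l) (cur ` (act p - {l}))" using la(1) by auto
  have D': "insert (ecol l r) (D - {rejcol rej w}) = s.D"
    unfolding D1 unfolding Dcols_def cur' rej' using cur2 by auto
  have ne: "cur q \<noteq> rejcol rej w" "0 \<noteq> rejcol rej w" "cur q \<noteq> 0"
    using rejcol_neq_cur[OF wk q_act] rejcol_ge[OF wk] k cur_neq_loop[of 0 q] by auto
  have B': "insert (cur q) (B - {rejcol rej w}) = s.B"
  proof -
    have "s.B = insert 0 (s.D - {ecol l r})" by (simp add: Bcols_def)
    also have "\<dots> = insert 0 (D - {rejcol rej w})" unfolding D'[symmetric] using new by auto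
    also have "\<dots> = insert (cur q) (B - {rejcol rej w})"
      using ne cur_D[OF q_act] unfolding Bcols_def by auto
    finally show ?thesis by simp
  qed
  have "scarf_iteration Am bv Cm \<rho> (B, D) (s.B, s.D) \<and> nextp (B, D) = (s.B, s.D)"
  proof (rule pivot_continue[OF _ _ _ B' s.feasible_B _ D' new s.ordinal_basis_D])
    show "leaving (2 * k) inc c B D = rejcol rej w" using leaving_holder[OF h] w_def by simp
    show "rejcol rej w \<in> D" by (rule rejcol_D[OF wk])
    then show "rejcol rej w \<in> B" using ne unfolding Bcols_def by auto
    show "s.B \<noteq> D" using zero_notin_D unfolding Bcols_def by auto
  qed
  then show ?thesis unfolding w_def .
qed

text \<open>When the loop of \<open>p\<close> leaves, his edge moves from row \<open>0\<close> to
  row \<open>p\<close>, and row \<open>0\<close> is free for the first acceptable edge of the next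
  man. The last man to come is man \<open>0\<close>, for whom row \<open>0\<close> is his
  own.\<close>

lemma arrival_continue:
  assumes free: "\<And>h. h \<in> act p \<Longrightarrow> h \<noteq> q \<Longrightarrow> wm h \<noteq> wm q" and p0: "p \<noteq> 0"
    and p': "p' = Suc p mod k" "act p' = insert p' (act p)" "p' \<notin> act p"
    and state: "gs_state k mp wp p' p' (pos(p' := r)) rej T'"
  shows "scarf_iteration Am bv Cm \<rho> (B, D) (Bcols p' p' (pos(p' := r)) rej, Dcols p' (pos(p' := r)) rej) \<and>
    nextp (B, D) = (Bcols p' p' (pos(p' := r)) rej, Dcols p' (pos(p' := r)) rej)"
proof -
  interpret s: gs_state k mp wp p' p' "pos(p' := r)" rej T' by (rule state)
  have rk: "r < k" using s.pos_less[of p'] p' by simp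
  have new: "ecol p' r \<notin> D"
  proof
    assume "ecol p' r \<in> D"
    then show False
    proof (cases rule: D_cases)
      case (1 i)
      then show False using ecol_eq_iff[OF rk pos_less[OF 1(1)], of p' i] p' by auto
    next
      case (2 w)
      from 2(1) show False
      proof (cases rule: rejcol_cases)
        case 1
        then show False using 2 ecol_ge[of p' r] by simp
      next
        case (2 i)
        then have "ecol i (mr i w) = ecol p' r" using \<open>ecol p' r = rejcol rej w\<close> by simp
        then have "i = p'" unfolding ecol_eq_iff[OF 2(4) rk] by simp
        then show False using 2 p' by simp
      qed
    next
      case 3
      then show False using man_loops_less[OF 3] ecol_ge[of p' r] by simp
    qed
  qed
  have cur': "(\<lambda>i. ecol i ((pos(p' := r)) i)) ` act p' = insert (ecol p' r) (cur ` act p)"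
  proof -
    have "(\<lambda>i. ecol i ((pos(p' := r)) i)) ` act p = cur ` act p" by (rule image_cong) (use p' in auto)
    then show ?thesis unfolding p'(2) image_insert by simp
  qed
  have loops': "man_loops p' = man_loops p - {p}"
    using p0 p_less p'(1) by (cases "Suc p = k") (auto simp: man_loops_def)
  have pD: "p \<in> man_loops p" "p \<in> D" using p0 p_less loop_D by (auto simp: man_loops_def)
  have D1: "D - {p} = cur ` act p \<union> rejcol rej ` {..<k} \<union> (man_loops p - {p})"
  proof -
    have "p \<notin> cur ` act p" using cur_neq_loop[of p] p_less by auto
    moreover have "p \<notin> rejcol rej ` {..<k}" using rejcol_ge p_less by fastforce
    ultimately show ?thesis unfolding Dcols_def by auto
  qed
  have D': "insert (ecol p' r) (D - {p}) = s.D"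
    unfolding D1 unfolding Dcols_def cur' loops' by auto
  have ne: "cur q \<noteq> p" "cur q \<noteq> 0" using cur_neq_loop[of p q] cur_neq_loop[of 0 q] p_less k by auto
  have B': "insert (cur q) (B - {p}) = s.B"
  proof -
    have "s.B = insert 0 (s.D - {ecol p' r})" by (simp add: Bcols_def)
    also have "\<dots> = insert 0 (D - {p})" unfolding D'[symmetric] using new by auto
    also have "\<dots> = insert (cur q) (B - {p})"
      using ne p0 cur_D[OF q_act] unfolding Bcols_def by auto
    finally show ?thesis by simp
  qed
  show ?thesis
  proof (rule pivot_continue[OF _ _ _ B' s.feasible_B _ D' new s.ordinal_basis_D])
    show "leaving (2 * k) inc c B D = p" using leaving_free[OF free] .
    show "p \<in> D" by (rule pD)
    then show "p \<in> B" using ne unfolding Bcols_def by auto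
    show "s.B \<noteq> D" using zero_notin_D unfolding Bcols_def by auto
  qed
qed

end

context gs_final
begin

lemma final_step: "scarf_iteration Am bv Cm \<rho> (B, D) (D, D) \<and> nextp (B, D) = (D, D)"
proof -
  have l: "leaving (2 * k) inc c B D = 0" using leaving_free[OF q_free] p_zero by simp
  have B': "insert (cur q) (B - {0}) = D" using cur_D[OF q_act] zero_notin_D unfolding Bcols_def by auto
  have zB: "0 \<in> B" by (simp add: Bcols_def)
  have "\<rho> B D = 0" by (rule rule_eq[OF l zB]) (simp add: B' feasible_D)
  then have "scarf_iteration Am bv Cm \<rho> (B, D) (D, D)"
    unfolding scarf_iteration_def using B_neq_D D_minus_B B' zB feasible_D by auto
  then show ?thesis unfolding step_def Let_def using l entering_BD B' by simp
qed

lemma selected_iff: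
  assumes "j < num_cols k"
  shows "selected (2 * k) inc c D j \<longleftrightarrow> j \<in> cur ` {..<k}"
proof
  assume s: "selected (2 * k) inc c D j"
  then have j: "j \<in> D" "2 * k \<le> j" unfolding selected_def by auto
  obtain i r where ir: "i < k" "r < k" "j = ecol i r" using column_cases[OF assms] j(2) by auto
  have min: "c i j \<le> c i (cur i)"
    using s first_row_ecol[OF ir(1,2)] ir cur_image_subset unfolding selected_def by auto
  have ia: "i \<in> act p" using ir(1) by (simp add: act_all)
  have "c i (cur i) \<le> c i j" using min_man[OF ia _ j(1)] p_zero by blast
  with min have "c i j = c i (cur i)" by (rule le_antisym)
  moreover have "i < 2 * k" using ir(1) by linarith
  ultimately have "j = cur i" using c_inj assms cur_less[OF ia] by blast
  then show "j \<in> cur ` {..<k}" using ir(1) by simp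
next
  assume "j \<in> cur ` {..<k}"
  then obtain i where i: "j = cur i" "i \<in> {..<k}" by (rule imageE)
  then have ia: "i \<in> act p" "i < k" by (auto simp: act_all)
  show "selected (2 * k) inc c D j"
    unfolding selected_def i(1) first_row_ecol[OF ia(2) pos_less[OF ia(1)]]
    using cur_D[OF ia(1)] ecol_ge min_man[OF ia(1)] p_zero by blast
qed

lemma char_vec_selected:
  "char_vec k mp \<mu> = vec (num_cols k) (\<lambda>j. if selected (2 * k) inc c D j then 1 else 0)"
  unfolding char_vec_\<mu> using selected_iff by (intro eq_vecI) auto

end

section \<open>The complete run and its length\<close>

context marriage
begin

text \<open>Initiality is left out so that tails of a run qualify and a run can be built backwards
  from its end. Iteration and \<open>step\<close> are recorded together, since the program follows
  the latter.\<close>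

definition good_run :: "(nat set \<times> nat set) list \<Rightarrow> nat set set \<Rightarrow> bool" where
  "good_run r \<mu> \<longleftrightarrow> r \<noteq> [] \<and>
     successively (\<lambda>x y. scarf_iteration (incidence_mat k mp) (ones_vec k) (ordinal_mat k mp wp)
         (proposal_rule (incidence_mat k mp) (ones_vec k) (ordinal_mat k mp wp)) x y \<and>
       y = step (2 * k) (num_cols k) inc c x) r \<and>
     fst (last r) = snd (last r) \<and>
     (\<forall>(B, D)\<in>set r. B \<subseteq> {..<num_cols k} \<and> D \<subseteq> {..<num_cols k}) \<and>
     stable_matching k mp wp \<mu> \<and>
     basic_solution (incidence_mat k mp) (ones_vec k) (fst (last r)) (char_vec k mp \<mu>) \<and>
     (char_vec k mp \<mu> :: nat vec) =
       vec (num_cols k) (\<lambda>j. if selected (2 * k) inc c (fst (last r)) j then 1 else 0)"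

lemma good_run_Cons:
  assumes "good_run r \<mu>"
    and "scarf_iteration (incidence_mat k mp) (ones_vec k) (ordinal_mat k mp wp)
         (proposal_rule (incidence_mat k mp) (ones_vec k) (ordinal_mat k mp wp)) (B, D) (hd r) \<and>
       step (2 * k) (num_cols k) inc c (B, D) = hd r"
    and "B \<subseteq> {..<num_cols k}" "D \<subseteq> {..<num_cols k}"
  shows "good_run ((B, D) # r) \<mu>"
proof -
  have "r \<noteq> []" using assms(1) by (simp add: good_run_def)
  then have last: "last ((B, D) # r) = last r" by simp
  show ?thesis
    using assms \<open>r \<noteq> []\<close> unfolding good_run_def last successively_Cons by (intro conjI) (elim conjE, simp)+
qed

text \<open>Going backwards, each new pair lengthens the list by one and lowers the progress by at
  least one, so the sum of the two never exceeds its bound at the end of the run.\<close>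

lemma ex_good_run:
  assumes "gs_state k mp wp p q pos rej T"
  shows "\<exists>r \<mu>. good_run r \<mu> \<and> hd r = (Bcols p q pos rej, Dcols p pos rej) \<and>
    length r + (\<Sum>i\<in>act p. Suc (pos i)) \<le> k\<^sup>2 + 2"
  using assms
proof (induction "k\<^sup>2 - (\<Sum>i\<in>act p. Suc (pos i))" arbitrary: p q pos rej T rule: less_induct)
  case less
  interpret gs_state k mp wp p q pos rej T by (rule less.prems)
  have le: "(\<Sum>i\<in>act p. Suc (pos i)) \<le> k\<^sup>2" using progress_le unfolding progress_def .
  have sub: "B \<subseteq> {..<num_cols k}" "D \<subseteq> {..<num_cols k}" using B_less D_less by auto
  have continue: ?case
    if state: "gs_state k mp wp p' q' pos' rej' T'"
      and it: "scarf_iteration Am bv Cm \<rho> (B, D) (Bcols p' q' pos' rej', Dcols p' pos' rej') \<and>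
        nextp (B, D) = (Bcols p' q' pos' rej', Dcols p' pos' rej')"
      and more: "(\<Sum>i\<in>act p. Suc (pos i)) < (\<Sum>i\<in>act p'. Suc (pos' i))" for p' q' pos' rej' T'
  proof -
    interpret s: gs_state k mp wp p' q' pos' rej' T' by (rule state)
    have le': "(\<Sum>i\<in>act p'. Suc (pos' i)) \<le> k\<^sup>2" using s.progress_le unfolding s.progress_def .
    have "k\<^sup>2 - (\<Sum>i\<in>act p'. Suc (pos' i)) < k\<^sup>2 - (\<Sum>i\<in>act p. Suc (pos i))" using le' more by linarith
    from less.hyps[OF this state] obtain r \<mu> where r: "good_run r \<mu>"
      "hd r = (Bcols p' q' pos' rej', Dcols p' pos' rej')"
      "length r + (\<Sum>i\<in>act p'. Suc (pos' i)) \<le> k\<^sup>2 + 2" by blast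
    have "good_run ((B, D) # r) \<mu>" by (rule good_run_Cons[OF r(1) _ sub]) (use it r(2) in simp)
    moreover have "length ((B, D) # r) + (\<Sum>i\<in>act p. Suc (pos i)) \<le> k\<^sup>2 + 2" using r(3) more by simp
    ultimately show ?case by (intro exI[of _ "(B, D) # r"] exI[of _ \<mu>]) simp
  qed
  show ?case
  proof (cases "\<exists>h\<in>act p. h \<noteq> q \<and> wm h = wm q")
    case True
    then obtain h where h: "h \<in> act p" "h \<noteq> q" "wm h = wm q" by blast
    define l where "l = (if wr (wm q) q < wr (wm q) h then h else q)"
    have l: "l = h \<or> l = q" "l \<in> act p" unfolding l_def using h q_act by auto
    obtain r T' where r: "pos l < r" and
      state: "gs_state k mp wp p l (pos(l := r)) (rej(wm q := Some l)) T'"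
      using next_rejection[OF h] unfolding l_def by blast
    have "(\<Sum>i\<in>act p. Suc (pos i)) < (\<Sum>i\<in>act p. Suc ((pos(l := r)) i))"
      by (rule sum_strict_mono_ex1) (use finite_act r l(2) in auto)
    then show ?thesis using continue[OF state holder_continue[OF h l(1) r state]] by blast
  next
    case False
    then have free: "wm h \<noteq> wm q" if "h \<in> act p" "h \<noteq> q" for h using that by blast
    show ?thesis
    proof (cases "p = 0")
      case True
      interpret gs_final k mp wp p q pos rej T by unfold_locales (use True free in auto)
      have "good_run [(D, D)] \<mu>"
        unfolding good_run_def using sub stable_\<mu> basic_solution_\<mu> char_vec_selected by simp
      then have "good_run [(B, D), (D, D)] \<mu>" by (rule good_run_Cons) (use sub final_step in auto)
      \<comment> \<open>The two pairs of the final iteration are the constant in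
        \<open>k\<^sup>2 + 2\<close>.\<close>
      then show ?thesis using le by (intro exI[of _ "[(B, D), (D, D)]"] exI[of _ \<mu>]) simp
    next
      case p0: False
      define p' where "p' = Suc p mod k"
      obtain r T' where act': "act p' = insert p' (act p)" "p' \<notin> act p"
        and state: "gs_state k mp wp p' p' (pos(p' := r)) rej T'"
        using next_arrival[OF free p0] unfolding p'_def by blast
      have "(\<Sum>i\<in>act p. Suc ((pos(p' := r)) i)) = (\<Sum>i\<in>act p. Suc (pos i))"
        by (rule sum.cong) (use act' in auto)
      then have "(\<Sum>i\<in>act p. Suc (pos i)) < (\<Sum>i\<in>act p'. Suc ((pos(p' := r)) i))"
        unfolding act'(1) using finite_act act'(2) by simp
      then show ?thesis
        using continue[OF state arrival_continue[OF free p0 p'_def act' state]] by blast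
    qed
  qed
qed

text \<open>In row \<open>0\<close> the largest entry at a valid edge belongs to the leftmost one
  avoiding man \<open>0\<close>, which is the first choice of man \<open>1\<close>. For
  \<open>k = 1\<close> there is a single valid edge.\<close>

lemma scarf_initial_state:
  "scarf_initial (ordinal_mat k mp wp)
    (Bcols (1 mod k) (1 mod k) (\<lambda>_. 0) (\<lambda>_. None), Dcols (1 mod k) (\<lambda>_. 0) (\<lambda>_. None))"
proof -
  define p where "p = 1 mod k"
  define j where "j = ecol p 0"
  have p: "p < k" "p \<noteq> 0 \<or> k = 1" "p = (if k = 1 then 0 else 1)" using k by (auto simp: p_def)
  have act: "act p = {p}" unfolding act_def using p by (auto split: if_splits)
  have j_ge: "2 * k \<le> j" unfolding j_def by (rule ecol_ge)
  have "rejcol (\<lambda>_. None) ` {..<k} = {k..<2 * k}"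
  proof -
    have "rejcol (\<lambda>_. None) = (+) k" by (auto simp: rejcol_def)
    then show ?thesis using image_add_atLeastLessThan[of k 0 k] by (simp add: lessThan_atLeast0 mult_2)
  qed
  then have D: "Dcols p (\<lambda>_. 0) (\<lambda>_. None) = insert j {1..<2 * k}"
    unfolding Dcols_def act j_def man_loops_def using p k by (auto split: if_splits)
  have B: "Bcols p p (\<lambda>_. 0) (\<lambda>_. None) = {..<2 * k}"
    unfolding Bcols_def D j_def[symmetric] using j_ge k by auto
  have "c 0 h \<le> c 0 j" if h: "2 * k \<le> h" "h < num_cols k" for h
  proof (cases "k = 1")
    case True
    then have "h = j" using h p unfolding j_def ecol_def by (simp add: num_cols_def)
    then show ?thesis by simp
  next
    case False
    have 0: "0 < 2 * k" using k by simp
    have p1: "p = 1" using p False by simp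
    then have jf: "j \<in> far 0" unfolding j_def using ecol_far_iff[of p 0 0] p k by simp
    obtain i r where ir: "i < k" "r < k" "h = ecol i r" using column_cases[OF h(2)] h(1) by auto
    show ?thesis
    proof (cases "h \<in> far 0")
      case True
      then have "i \<noteq> 0" using ecol_far_iff[OF ir(1,2), of 0] ir(3) by auto
      then have "\<not> h < j" using ecol_less_iff[OF ir(2), of 0 i p] ir(3) p1 k unfolding j_def by simp
      then show ?thesis using c_far_antimono[OF 0 jf True] by (cases "h = j") auto
    next
      case False
      then show ?thesis using c_incident[OF 0 h False] c_far_bounds[OF 0 jf] by simp
    qed
  qed
  moreover have "j < num_cols k" unfolding j_def using ecol_less p(1) k by simp
  ultimately have "is_arg_max (\<lambda>j. c 0 j) (\<lambda>j. 2 * k \<le> j \<and> j < num_cols k) j"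
    using j_ge unfolding is_arg_max_def by (meson leD)
  then show ?thesis unfolding scarf_initial_def Let_def dim_ordinal_mat p_def[symmetric] D B c_def by blast
qed

lemma ex_run:
  "\<exists>r \<mu>. good_run r \<mu> \<and> scarf_initial (ordinal_mat k mp wp) (hd r) \<and> length r \<le> k\<^sup>2 + 2 \<and>
    hd r = (Bcols (1 mod k) (1 mod k) (\<lambda>_. 0) (\<lambda>_. None), Dcols (1 mod k) (\<lambda>_. 0) (\<lambda>_. None))"
proof -
  obtain r \<mu> where r: "good_run r \<mu>" "length r + (\<Sum>i\<in>act (1 mod k). Suc 0) \<le> k\<^sup>2 + 2"
    "hd r = (Bcols (1 mod k) (1 mod k) (\<lambda>_. 0) (\<lambda>_. None), Dcols (1 mod k) (\<lambda>_. 0) (\<lambda>_. None))"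
    using ex_good_run[OF gs_state_initial] by auto
  moreover have "length r \<le> k\<^sup>2 + 2" using r(2) by (rule add_leD1)
  ultimately show ?thesis using scarf_initial_state by (intro exI[of _ r] exI[of _ \<mu>]) simp
qed

end

section \<open>The program\<close>

definition tbool :: "bool \<Rightarrow> tree" where
  "tbool b = (if b then Node Null Null else Null)"

definition ptimeb :: "(tree \<Rightarrow> bool) \<Rightarrow> bool" where
  "ptimeb Q \<longleftrightarrow> ptime (\<lambda>x. tbool (Q x))"

lemma tbool_Null: "tbool b \<noteq> Null \<longleftrightarrow> b"
  by (simp add: tbool_def)

lemma tbool_eq_Null: "tbool b = Null \<longleftrightarrow> \<not> b"
  by (simp add: tbool_def)

lemma ptime_If: "ptimeb Q \<Longrightarrow> ptime f \<Longrightarrow> ptime g \<Longrightarrow> ptime (\<lambda>x. if Q x then f x else g x)"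
  using ptime_if[of "\<lambda>x. tbool (Q x)" f g] by (simp add: tbool_Null ptimeb_def)

lemma ptimeb_Null: "ptime f \<Longrightarrow> ptimeb (\<lambda>x. f x = Null)"
proof -
  assume "ptime f"
  then have "ptime (\<lambda>x. if f x \<noteq> Null then Null else Node Null Null)"
    by (rule ptime_if) (intro ptime_Null ptime_Node)+
  moreover have "(if f x \<noteq> Null then Null else Node Null Null) = tbool (f x = Null)" for x
    by (simp add: tbool_def)
  ultimately show ?thesis by (simp add: ptimeb_def)
qed

lemma ptimeb_not: "ptimeb Q \<Longrightarrow> ptimeb (\<lambda>x. \<not> Q x)"
  using ptimeb_Null[of "\<lambda>x. tbool (Q x)"] by (simp add: ptimeb_def tbool_eq_Null)

lemma ptimeb_conj:
  assumes "ptimeb P" "ptimeb Q"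
  shows "ptimeb (\<lambda>x. P x \<and> Q x)"
proof -
  have "ptime (\<lambda>x. if P x then tbool (Q x) else Null)"
    by (rule ptime_If[OF assms(1) _ ptime_Null]) (use assms(2) in \<open>simp add: ptimeb_def\<close>)
  moreover have "(if P x then tbool (Q x) else Null) = tbool (P x \<and> Q x)" for x by (simp add: tbool_def)
  ultimately show ?thesis by (simp add: ptimeb_def)
qed

lemma ptimeb_disj: "ptimeb P \<Longrightarrow> ptimeb Q \<Longrightarrow> ptimeb (\<lambda>x. P x \<or> Q x)"
  using ptimeb_not[OF ptimeb_conj[OF ptimeb_not[of P] ptimeb_not[of Q]]] by simp

lemma ptimeb_imp: "ptimeb P \<Longrightarrow> ptimeb Q \<Longrightarrow> ptimeb (\<lambda>x. P x \<longrightarrow> Q x)"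
  unfolding imp_conv_disj by (intro ptimeb_disj ptimeb_not)

lemma ptime_filterb:
  assumes "ptime l" "ptimeb (\<lambda>s. Q (tleft s) (tright s))"
  shows "ptime (\<lambda>x. tlist (filter (Q x) (telems (l x))))"
  using ptime_filter[OF assms[unfolded ptimeb_def]] by (simp add: tbool_Null)

lemma ptime_mapb:
  assumes "ptime l" "ptime (\<lambda>s. h (tleft s) (tright s))"
  shows "ptime (\<lambda>x. tlist (map (h x) (telems (l x))))"
  using ptime_map[OF assms] by simp

lemma tlist_Null: "tlist xs = Null \<longleftrightarrow> xs = []"
  by (cases xs) auto

lemma ptimeb_Bex:
  assumes "ptime l" "ptimeb (\<lambda>s. Q (tleft s) (tright s))"
  shows "ptimeb (\<lambda>x. \<exists>e\<in>set (telems (l x)). Q x e)"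
proof -
  have "(\<exists>e\<in>set (telems (l x)). Q x e) \<longleftrightarrow> \<not> tlist (filter (Q x) (telems (l x))) = Null" for x
    by (auto simp: tlist_Null filter_empty_conv)
  then show ?thesis using ptimeb_not[OF ptimeb_Null[OF ptime_filterb[OF assms]]] by simp
qed

lemma ptimeb_Ball:
  assumes "ptime l" "ptimeb (\<lambda>s. Q (tleft s) (tright s))"
  shows "ptimeb (\<lambda>x. \<forall>e\<in>set (telems (l x)). Q x e)"
  using ptimeb_not[OF ptimeb_Bex[OF assms(1) ptimeb_not[OF assms(2)]]] by simp

text \<open>The letter n stands for numeral: \<open>nle\<close> compares unary numbers by truncated
  subtraction, and \<open>neq\<close> below is their equality, not its negation.\<close>

definition nle :: "tree \<Rightarrow> tree \<Rightarrow> bool" where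
  "nle a b \<longleftrightarrow> tdrop b a = Null"

definition neq :: "tree \<Rightarrow> tree \<Rightarrow> bool" where
  "neq a b \<longleftrightarrow> nle a b \<and> nle b a"

definition entry :: "tree \<Rightarrow> tree \<Rightarrow> tree \<Rightarrow> tree" where
  "entry M i j = tleft (tdrop j (tleft (tdrop i M)))"

definition mem :: "tree \<Rightarrow> tree \<Rightarrow> bool" where
  "mem j S \<longleftrightarrow> (\<exists>e\<in>set (telems S). neq e j)"

lemma ptimeb_nle: "ptime f \<Longrightarrow> ptime g \<Longrightarrow> ptimeb (\<lambda>x. nle (f x) (g x))"
  unfolding nle_def by (intro ptimeb_Null ptime_tdrop)

lemma ptimeb_neq: "ptime f \<Longrightarrow> ptime g \<Longrightarrow> ptimeb (\<lambda>x. neq (f x) (g x))"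
  unfolding neq_def by (intro ptimeb_conj ptimeb_nle)

lemma ptime_entry: "ptime f \<Longrightarrow> ptime g \<Longrightarrow> ptime h \<Longrightarrow> ptime (\<lambda>x. entry (f x) (g x) (h x))"
  unfolding entry_def by (intro ptime_tleft ptime_tdrop)

lemma ptimeb_mem:
  assumes "ptime f" "ptime g"
  shows "ptimeb (\<lambda>x. mem (f x) (g x))"
  unfolding mem_def by (intro ptimeb_Bex ptimeb_neq ptime_tright ptime_id ptime_tleft
      ptime_compose[OF _ assms(1)] ptime_compose[OF _ assms(2)] assms)

lemmas ptime_intros = ptime_id ptime_Null ptime_Node ptime_tleft ptime_tright ptime_If ptime_tdrop
  ptime_entry ptime_filterb ptime_mapb
  ptimeb_Null ptimeb_not ptimeb_conj ptimeb_disj ptimeb_imp ptimeb_Bex ptimeb_Ball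
  ptimeb_nle ptimeb_neq ptimeb_mem

section \<open>Tree versions of the operations of an iteration\<close>

definition t_entering :: "tree \<Rightarrow> tree \<Rightarrow> tree" where
  "t_entering B D = tleft (tlist (filter (\<lambda>j. \<not> mem j B) (telems D)))"

definition t_argmin :: "tree \<Rightarrow> tree \<Rightarrow> tree \<Rightarrow> tree" where
  "t_argmin C v D = tleft (tlist (filter
     (\<lambda>j. \<forall>j'\<in>set (telems D). nle (entry C v j) (entry C v j')) (telems D)))"

definition t_first :: "tree \<Rightarrow> tree \<Rightarrow> tree \<Rightarrow> tree" where
  "t_first R A j = tleft (tlist (filter (\<lambda>v. \<not> entry A v j = Null) (telems R)))"

definition t_last :: "tree \<Rightarrow> tree \<Rightarrow> tree \<Rightarrow> tree" where
  "t_last R A j = tleft (tlist (filter (\<lambda>v. \<not> entry A v j = Null \<and>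
     (\<forall>v'\<in>set (telems R). \<not> entry A v' j = Null \<longrightarrow> nle v' v)) (telems R)))"

text \<open>\<open>R\<close> has one element per row, so \<open>tdrop j R = Null\<close> tests
  whether \<open>j\<close> is a valid edge. \<open>Null\<close> is the numeral of row
  \<open>0\<close>.\<close>

definition t_leaving :: "tree \<Rightarrow> tree \<Rightarrow> tree \<Rightarrow> tree \<Rightarrow> tree \<Rightarrow> tree" where
  "t_leaving R A C B D =
     (if \<exists>j\<in>set (telems D). \<not> neq j (t_entering B D) \<and> tdrop j R = Null \<and>
           \<not> entry A (t_last R A (t_entering B D)) j = Null
      then t_argmin C (t_last R A (t_entering B D)) D
      else t_first R A (t_argmin C Null D))"

text \<open>Filtering the sorted list \<open>K\<close> of all columns keeps the result sorted, so it
  is exactly the encoding of the new set and not merely some list of its elements.\<close>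

definition t_insert :: "tree \<Rightarrow> tree \<Rightarrow> tree \<Rightarrow> tree \<Rightarrow> tree" where
  "t_insert K j S l = tlist (filter (\<lambda>e. neq e j \<or> mem e S \<and> \<not> neq e l) (telems K))"

text \<open>Domination by \<open>insert j (D - {l})\<close> is tested at \<open>j\<close> and at the
  members of \<open>D\<close> other than \<open>l\<close>, without building that set.\<close>

definition t_new :: "tree \<Rightarrow> tree \<Rightarrow> tree \<Rightarrow> tree \<Rightarrow> tree \<Rightarrow> tree" where
  "t_new K R C D l = tleft (tlist (filter (\<lambda>j. \<not> mem j D \<and>
     (\<forall>h\<in>set (telems K). \<exists>i\<in>set (telems R). nle (entry C i h) (entry C i j) \<and>
        (\<forall>j'\<in>set (telems D). \<not> neq j' l \<longrightarrow> nle (entry C i h) (entry C i j')))) (telems K)))"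

definition t_seteq :: "tree \<Rightarrow> tree \<Rightarrow> bool" where
  "t_seteq B D \<longleftrightarrow> (\<forall>j\<in>set (telems B). mem j D) \<and> (\<forall>j\<in>set (telems D). mem j B)"

definition t_selected :: "tree \<Rightarrow> tree \<Rightarrow> tree \<Rightarrow> tree \<Rightarrow> tree \<Rightarrow> bool" where
  "t_selected R A C D j \<longleftrightarrow> tdrop j R = Null \<and> mem j D \<and>
     (\<forall>j'\<in>set (telems D). nle (entry C (t_first R A j) j) (entry C (t_first R A j) j'))"

definition t_argmax :: "tree \<Rightarrow> tree \<Rightarrow> tree \<Rightarrow> tree" where
  "t_argmax K R C = tleft (tlist (filter (\<lambda>j. tdrop j R = Null \<and>
     (\<forall>j'\<in>set (telems K). tdrop j' R = Null \<longrightarrow> nle (entry C Null j') (entry C Null j))) (telems K)))"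

text \<open>Inside a filter or a bounded quantifier the parameters are read from the left half of a
  pair, which is why each assumption is also supplied composed with a further function.\<close>

lemma ptime_t_entering:
  assumes "ptime f" "ptime g"
  shows "ptime (\<lambda>x. t_entering (f x) (g x))"
  unfolding t_entering_def
  by (intro ptime_intros assms assms[THEN ptime_compose[rotated]])

lemma ptime_t_argmin:
  assumes "ptime f" "ptime g" "ptime h"
  shows "ptime (\<lambda>x. t_argmin (f x) (g x) (h x))"
  unfolding t_argmin_def
  by (intro ptime_intros assms assms[THEN ptime_compose[rotated]])

lemma ptime_t_first:
  assumes "ptime f" "ptime g" "ptime h"
  shows "ptime (\<lambda>x. t_first (f x) (g x) (h x))"
  unfolding t_first_def
  by (intro ptime_intros assms assms[THEN ptime_compose[rotated]])

lemma ptime_t_last: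
  assumes "ptime f" "ptime g" "ptime h"
  shows "ptime (\<lambda>x. t_last (f x) (g x) (h x))"
  unfolding t_last_def
  by (intro ptime_intros assms assms[THEN ptime_compose[rotated]])

lemma ptime_t_leaving:
  assumes "ptime R" "ptime A" "ptime C" "ptime B" "ptime D"
  shows "ptime (\<lambda>x. t_leaving (R x) (A x) (C x) (B x) (D x))"
  unfolding t_leaving_def
  by (intro ptime_intros ptime_t_last ptime_t_entering ptime_t_argmin ptime_t_first
      assms assms[THEN ptime_compose[rotated]])

lemma ptime_t_insert:
  assumes "ptime K" "ptime j" "ptime S" "ptime l"
  shows "ptime (\<lambda>x. t_insert (K x) (j x) (S x) (l x))"
  unfolding t_insert_def
  by (intro ptime_intros assms assms[THEN ptime_compose[rotated]])

lemma ptime_t_new: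
  assumes "ptime K" "ptime R" "ptime C" "ptime D" "ptime l"
  shows "ptime (\<lambda>x. t_new (K x) (R x) (C x) (D x) (l x))"
  unfolding t_new_def
  by (intro ptime_intros assms assms[THEN ptime_compose[rotated]])

lemma ptimeb_t_seteq:
  assumes "ptime B" "ptime D"
  shows "ptimeb (\<lambda>x. t_seteq (B x) (D x))"
  unfolding t_seteq_def
  by (intro ptime_intros assms assms[THEN ptime_compose[rotated]])

lemma ptimeb_t_selected:
  assumes "ptime R" "ptime A" "ptime C" "ptime D" "ptime j"
  shows "ptimeb (\<lambda>x. t_selected (R x) (A x) (C x) (D x) (j x))"
  unfolding t_selected_def
  by (intro ptime_intros ptime_t_first assms assms[THEN ptime_compose[rotated]])

lemma ptime_t_argmax:
  assumes "ptime K" "ptime R" "ptime C"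
  shows "ptime (\<lambda>x. t_argmax (K x) (R x) (C x))"
  unfolding t_argmax_def
  by (intro ptime_intros assms assms[THEN ptime_compose[rotated]])

text \<open>The accumulator holds the numerals so far, largest first; the next one is the successor
  of its head. Only the length of \<open>x\<close> matters.\<close>

definition t_iota :: "tree \<Rightarrow> tree" where
  "t_iota x = trev (fold (\<lambda>e acc. Node (if acc = Null then Null else Node Null (tleft acc)) acc) (telems x) Null)"

lemma fold_iota:
  "fold (\<lambda>e acc. Node (if acc = Null then Null else Node Null (tleft acc)) acc) es Null
    = tlist (map enc_nat (rev [0..<length es]))"
proof (induction es rule: rev_induct)
  case (snoc e es)
  show ?case
  proof (cases "length es")
    case 0
    then show ?thesis by simp
  next
    case (Suc m)
    then show ?thesis using snoc by simp
  qed
qed simp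

lemma t_iota_eq: "t_iota x = tlist (map enc_nat [0..<length (telems x)])"
  unfolding t_iota_def fold_iota by (simp add: trev_tlist rev_map)

lemma size_enc_nat: "size (enc_nat m) = m"
  by (induction m) auto

lemma size_tlist_le:
  assumes "\<And>x. x \<in> set xs \<Longrightarrow> size x \<le> m"
  shows "size (tlist xs) \<le> length xs * (m + 1)"
  using assms by (induction xs) fastforce+

lemma size_tlist_enc_nat:
  assumes "\<forall>x\<in>set xs. x \<le> m"
  shows "size (tlist (map enc_nat xs)) \<le> length xs * (m + 1)"
proof -
  have "size (tlist (map enc_nat xs)) \<le> length (map enc_nat xs) * (m + 1)"
    by (rule size_tlist_le) (use assms in \<open>auto simp: size_enc_nat\<close>)
  then show ?thesis by simp
qed

lemma size_iota: "size (tlist (map enc_nat (rev [0..<m]))) \<le> m * (m + 1)"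
proof -
  have "\<forall>x\<in>set (rev [0..<m]). x \<le> m" by simp
  then have "size (tlist (map enc_nat (rev [0..<m]))) \<le> length (rev [0..<m]) * (m + 1)"
    by (rule size_tlist_enc_nat)
  then show ?thesis by (simp only: length_rev length_upt minus_nat.diff_0)
qed

lemma ptime_t_iota:
  assumes "ptime f"
  shows "ptime (\<lambda>x. t_iota (f x))"
proof -
  obtain b F where b: "nat_poly b" "mono b" "\<forall>x. size (f x) \<le> b (size x)"
    "\<forall>x. \<exists>t \<le> b (size x). exec F x t (f x)" using assms by (rule ptimeE) blast
  define g where "g s = Node (if tright (tright s) = Null then Null
      else Node Null (tleft (tright (tright s)))) (tright (tright s))" for s
  have g: "ptime g" unfolding g_def by (intro ptime_intros)
  have geq: "(\<lambda>e acc. g (Node x (Node e acc)))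
      = (\<lambda>e acc. Node (if acc = Null then Null else Node Null (tleft acc)) acc)" for x
    by (auto simp: g_def fun_eq_iff)
  have "ptime (\<lambda>x. fold (\<lambda>e acc. g (Node x (Node e acc))) (telems (f x)) Null)"
  proof (rule ptime_fold[OF assms ptime_Null g])
    show "nat_poly (\<lambda>s. b s * (b s + 1))" by (intro nat_poly_intros b(1))
    fix x m
    let ?es = "take m (telems (f x))"
    have le: "length ?es \<le> b (size x)"
    proof -
      have "length ?es \<le> length (telems (f x))" by simp
      also have "\<dots> \<le> size (f x)" by (rule length_telems)
      also have "\<dots> \<le> b (size x)" using b(3) by blast
      finally show ?thesis .
    qed
    have "size (tlist (map enc_nat (rev [0..<length ?es]))) \<le> length ?es * (length ?es + 1)"
      by (rule size_iota)
    also have "\<dots> \<le> b (size x) * (b (size x) + 1)" using le by (intro mult_le_mono) auto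
    finally show "size (fold (\<lambda>e acc. g (Node x (Node e acc))) ?es Null) \<le> b (size x) * (b (size x) + 1)"
      unfolding geq fold_iota .
  qed
  then show ?thesis unfolding t_iota_def geq by (rule ptime_trev)
qed


definition t_pair :: "tree \<Rightarrow> tree \<Rightarrow> tree \<Rightarrow> tree \<Rightarrow> tree \<Rightarrow> tree \<Rightarrow> tree" where
  "t_pair K R A C B D =
     Node (t_insert K (t_entering B D) B (t_leaving R A C B D))
       (if t_seteq (t_insert K (t_entering B D) B (t_leaving R A C B D)) D then D
        else t_insert K (t_new K R C D (t_leaving R A C B D)) D (t_leaving R A C B D))"

lemma ptime_t_pair:
  assumes "ptime K" "ptime R" "ptime A" "ptime C" "ptime B" "ptime D"
  shows "ptime (\<lambda>x. t_pair (K x) (R x) (A x) (C x) (B x) (D x))"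
  unfolding t_pair_def
  by (intro ptime_intros ptime_t_insert ptime_t_entering ptime_t_leaving ptimeb_t_seteq ptime_t_new assms)

text \<open>The state of the main loop is \<open>Node (Node K (Node R (Node A C))) (Node (Node B D) H)\<close>, where
  \<open>K\<close> and \<open>R\<close> are the lists of column and row indices and \<open>H\<close> is the list of earlier pairs, latest
  first.\<close>

abbreviation "sK s \<equiv> tleft (tleft s)"
abbreviation "sR s \<equiv> tleft (tright (tleft s))"
abbreviation "sA s \<equiv> tleft (tright (tright (tleft s)))"
abbreviation "sC s \<equiv> tright (tright (tright (tleft s)))"
abbreviation "sB s \<equiv> tleft (tleft (tright s))"
abbreviation "sD s \<equiv> tright (tleft (tright s))"
abbreviation "sH s \<equiv> tright (tright s)"

definition t_cond :: "tree \<Rightarrow> tree" where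
  "t_cond s = tbool (\<not> t_seteq (sB s) (sD s))"

definition t_body :: "tree \<Rightarrow> tree" where
  "t_body s = Node (tleft s)
     (Node (t_pair (sK s) (sR s) (sA s) (sC s) (sB s) (sD s)) (Node (tleft (tright s)) (sH s)))"

text \<open>\<open>C\<close> has one element per row and its first element one per column, which
  yields \<open>R\<close> and \<open>K\<close>. Deleting the numeral \<open>Null\<close> removes
  column \<open>0\<close> from \<open>R\<close>, as the initial \<open>D\<close> demands.\<close>

definition t_init :: "tree \<Rightarrow> tree" where
  "t_init x =
     (let A = tleft x; C = tright (tright x); K = t_iota (tleft C); R = t_iota C in
      Node (Node K (Node R (Node A C))) (Node (Node R (t_insert K (t_argmax K R C) R Null)) Null))"

definition t_final :: "tree \<Rightarrow> tree" where
  "t_final s = Node (trev (Node (tleft (tright s)) (sH s)))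
     (tlist (map (\<lambda>j. tbool (t_selected (sR s) (sA s) (sC s) (sD s) j)) (telems (sK s))))"

lemma ptime_t_cond: "ptime t_cond"
  unfolding t_cond_def ptimeb_def[symmetric] by (intro ptime_intros ptimeb_t_seteq)

lemma ptime_t_body: "ptime t_body"
  unfolding t_body_def by (intro ptime_intros ptime_t_pair)

lemma ptime_t_init: "ptime t_init"
  unfolding t_init_def Let_def
  by (intro ptime_intros ptime_t_iota ptime_t_insert ptime_t_argmax)

lemma ptime_t_final: "ptime t_final"
  unfolding t_final_def
  by (intro ptime_Node ptime_trev ptime_mapb ptime_tleft ptime_tright ptime_id
      ptimeb_t_selected[unfolded ptimeb_def])

text \<open>The main loop is not a fold over a given list, and its history grows from round to
  round. Time is therefore bounded only on the states actually visited, whose sizes are controlled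
  by the length of the run.\<close>

lemma exec_Loop_states:
  assumes "ss \<noteq> []"
    and "\<forall>s\<in>set ss. \<exists>t\<le>M. exec Pc s t (cnd s)"
    and "\<forall>s\<in>set ss. \<exists>t\<le>M. exec Pb s t (bdy s)"
    and "successively (\<lambda>s s'. cnd s \<noteq> Null \<and> bdy s = s') ss"
    and "cnd (last ss) = Null"
  shows "\<exists>t \<le> length ss * (2 * M + 1). exec (Loop Pc Pb) (hd ss) t (last ss)"
  using assms
proof (induction ss)
  case (Cons s ss)
  obtain t where t: "t \<le> M" "exec Pc s t (cnd s)" using Cons.prems(2) by auto
  obtain u where u: "u \<le> M" "exec Pb s u (bdy s)" using Cons.prems(3) by auto
  show ?case
  proof (cases "ss = []")
    case True
    then have "exec Pc s t Null" using t Cons.prems(5) by simp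
    then have "exec (Loop Pc Pb) s (t + 1) s" by (rule exec.intros(11))
    then show ?thesis using t True by (intro exI[of _ "t + 1"]) simp
  next
    case False
    then have s: "cnd s \<noteq> Null" "bdy s = hd ss" "successively (\<lambda>s s'. cnd s \<noteq> Null \<and> bdy s = s') ss"
      using Cons.prems(4) by (auto simp: successively_Cons)
    obtain v where v: "v \<le> length ss * (2 * M + 1)" "exec (Loop Pc Pb) (hd ss) v (last ss)"
      using Cons.IH[OF False _ _ s(3)] Cons.prems False by auto
    have "exec (Loop Pc Pb) s (t + u + v + 1) (last ss)"
      using exec.intros(12)[OF t(2) s(1) u(2), of v "last ss"] v(2) s(2) by simp
    then show ?thesis using t u v(1) False by (intro exI[of _ "t + u + v + 1"]) simp
  qed
qed simp

section \<open>Correctness of the tree operations on encodings\<close>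

lemma telems_enc_list: "telems (enc_list f xs) = map f xs"
  by (induction xs) auto

lemma enc_nat_tlist: "enc_nat m = tlist (replicate m Null)"
  by (induction m) auto

lemma tright_tlist: "tright (tlist xs) = tlist (tl xs)"
  by (cases xs) auto

lemma tleft_tlist: "xs \<noteq> [] \<Longrightarrow> tleft (tlist xs) = hd xs"
  by (cases xs) auto

lemma tdrop_tlist: "tdrop (enc_nat m) (tlist xs) = tlist (drop m xs)"
proof -
  have "fold (\<lambda>_. tright) es (tlist xs) = tlist (drop (length es) xs)" for es :: "tree list"
    by (induction es arbitrary: xs) (auto simp: tright_tlist drop_Suc)
  from this[of "telems (enc_nat m)"] show ?thesis
    unfolding tdrop_def by (simp add: enc_nat_tlist telems_tlist)
qed

lemma tdrop_enc_list_Null: "tdrop (enc_nat m) (enc_list f xs) = Null \<longleftrightarrow> length xs \<le> m"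
  unfolding enc_list_tlist[of f] tdrop_tlist tlist_Null by simp

lemma tleft_tdrop_enc_list: "m < length xs \<Longrightarrow> tleft (tdrop (enc_nat m) (enc_list f xs)) = f (xs ! m)"
  unfolding enc_list_tlist[of f] tdrop_tlist by (subst tleft_tlist) (auto simp: hd_drop_conv_nth)

lemma enc_nat_Null: "enc_nat m = Null \<longleftrightarrow> m = 0"
  by (cases m) auto

lemma nle_enc_nat: "nle (enc_nat a) (enc_nat b) \<longleftrightarrow> a \<le> b"
  unfolding nle_def enc_nat_tlist[of a] tdrop_tlist tlist_Null by simp

lemma neq_enc_nat: "neq (enc_nat a) (enc_nat b) \<longleftrightarrow> a = b"
  unfolding neq_def nle_enc_nat by auto

lemma mem_enc_list: "mem (enc_nat j) (enc_list enc_nat xs) \<longleftrightarrow> j \<in> set xs"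
  unfolding mem_def telems_enc_list by (auto simp: neq_enc_nat)

lemma mem_enc_set: "finite S \<Longrightarrow> mem (enc_nat j) (enc_set S) \<longleftrightarrow> j \<in> S"
  unfolding enc_set_def mem_enc_list by simp

lemma telems_enc_set: "telems (enc_set S) = map enc_nat (sorted_list_of_set S)"
  unfolding enc_set_def telems_enc_list ..

lemma entry_enc_mat:
  assumes "i < dim_row M" "j < dim_col M"
  shows "entry (enc_mat M) (enc_nat i) (enc_nat j) = enc_nat (M $$ (i, j))"
proof -
  have "tleft (tdrop (enc_nat i) (enc_mat M)) = enc_vec (row M i)"
    unfolding enc_mat_def using assms by (subst tleft_tdrop_enc_list) auto
  then show ?thesis unfolding entry_def enc_vec_def
    using assms by (simp add: tleft_tdrop_enc_list list_of_vec_index)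
qed

text \<open>A witness is required because \<open>hd []\<close> is unspecified, whereas
  \<open>tleft\<close> maps the empty list to \<open>Null\<close>.\<close>

lemma tleft_filter_enc_nat:
  assumes "\<And>x. x \<in> set xs \<Longrightarrow> Q' (enc_nat x) \<longleftrightarrow> Q x" "\<exists>x\<in>set xs. Q x"
  shows "tleft (tlist (filter Q' (map enc_nat xs))) = enc_nat (hd (filter Q xs))"
proof -
  have "filter Q' (map enc_nat xs) = map enc_nat (filter Q xs)"
    using assms(1) by (induction xs) auto
  moreover have "filter Q xs \<noteq> []" using assms(2) by (auto simp: filter_empty_conv)
  ultimately show ?thesis by (simp add: tleft_tlist hd_map)
qed

lemma sorted_list_of_set_eq_filter:
  assumes "S \<subseteq> {..<N}"
  shows "sorted_list_of_set S = filter (\<lambda>j. j \<in> S) [0..<N]"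
proof -
  have "set (filter (\<lambda>j. j \<in> S) [0..<N]) = S" using assms by auto
  moreover have "sorted (filter (\<lambda>j. j \<in> S) [0..<N])" "distinct (filter (\<lambda>j. j \<in> S) [0..<N])"
    by (auto intro: sorted_wrt_filter)
  ultimately show ?thesis by (metis sorted_list_of_set.idem_if_sorted_distinct)
qed

lemma Ball_image_comp: "(\<forall>x\<in>f ` A. Q x) \<longleftrightarrow> (\<forall>x\<in>A. Q (f x))" and Bex_image_comp: "(\<exists>x\<in>f ` A. Q x) \<longleftrightarrow> (\<exists>x\<in>A. Q (f x))"
  by auto

lemma t_seteq_enc_set:
  assumes "finite B" "finite D"
  shows "t_seteq (enc_set B) (enc_set D) \<longleftrightarrow> B = D"
  unfolding t_seteq_def telems_enc_set using assms by (auto simp: mem_enc_set)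

lemma t_entering_enc_set:
  assumes "finite B" "finite D" "\<exists>j\<in>D. j \<notin> B"
  shows "t_entering (enc_set B) (enc_set D) = enc_nat (entering B D)"
  unfolding t_entering_def entering_def telems_enc_set
  by (rule tleft_filter_enc_nat) (use assms in \<open>auto simp: mem_enc_set\<close>)

lemma t_insert_enc_set:
  assumes "j < N" "S \<subseteq> {..<N}"
  shows "t_insert (enc_list enc_nat [0..<N]) (enc_nat j) (enc_set S) (enc_nat l) = enc_set (insert j (S - {l}))"
proof -
  have fin: "finite S" using assms finite_subset by blast
  have "sorted_list_of_set (insert j (S - {l})) = filter (\<lambda>e. e \<in> insert j (S - {l})) [0..<N]"
    by (rule sorted_list_of_set_eq_filter) (use assms in auto)
  then have *: "enc_set (insert j (S - {l})) = tlist (map enc_nat (filter (\<lambda>e. e = j \<or> e \<in> S \<and> e \<noteq> l) [0..<N]))"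
    unfolding enc_set_def enc_list_tlist[of enc_nat] by simp
  have "filter (\<lambda>e. neq e (enc_nat j) \<or> mem e (enc_set S) \<and> \<not> neq e (enc_nat l)) (map enc_nat xs)
    = map enc_nat (filter (\<lambda>e. e = j \<or> e \<in> S \<and> e \<noteq> l) xs)" for xs
    by (induction xs) (auto simp: neq_enc_nat mem_enc_set[OF fin])
  then show ?thesis unfolding t_insert_def telems_enc_list * by simp
qed

context marriage
begin

definition tA :: tree where "tA = enc_mat (incidence_mat k mp)"
definition tC :: tree where "tC = enc_mat (ordinal_mat k mp wp)"
definition tK :: tree where "tK = enc_list enc_nat [0..<num_cols k]"
definition tR :: tree where "tR = enc_list enc_nat [0..<2 * k]"

lemma entry_tA:
  assumes "v < 2 * k" "j < num_cols k"
  shows "entry tA (enc_nat v) (enc_nat j) = Null \<longleftrightarrow> \<not> inc v j"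
  unfolding tA_def using assms
  by (subst entry_enc_mat) (simp_all add: dim_incidence_mat incidence_entry enc_nat_Null inc_iff)

lemma entry_tC:
  assumes "v < 2 * k" "j < num_cols k"
  shows "entry tC (enc_nat v) (enc_nat j) = enc_nat (c v j)"
  unfolding tC_def using assms by (subst entry_enc_mat) (simp_all add: dim_ordinal_mat c_def)

lemma tdrop_tR: "tdrop (enc_nat j) tR = Null \<longleftrightarrow> 2 * k \<le> j"
  unfolding tR_def tdrop_enc_list_Null by simp

lemma telems_tR: "telems tR = map enc_nat [0..<2 * k]" and telems_tK: "telems tK = map enc_nat [0..<num_cols k]"
  unfolding tR_def tK_def telems_enc_list by auto

lemma ex_inc:
  assumes "j < num_cols k"
  shows "\<exists>v<2 * k. inc v j"
  using assms
proof (cases rule: column_cases)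
  case 1
  then show ?thesis using assms by (intro exI[of _ j]) (simp add: inc_iff col_edge_loop)
next
  case (2 i r)
  then show ?thesis using assms by (intro exI[of _ i]) (simp add: inc_iff col_edge_ecol)
qed

lemma first_row_enc:
  assumes "j < num_cols k"
  shows "t_first tR tA (enc_nat j) = enc_nat (first_row (2 * k) inc j)" "first_row (2 * k) inc j < 2 * k"
proof -
  show "t_first tR tA (enc_nat j) = enc_nat (first_row (2 * k) inc j)"
    unfolding t_first_def first_row_def telems_tR
    by (rule tleft_filter_enc_nat) (use assms ex_inc[OF assms] entry_tA in auto)
  have "filter (\<lambda>v. inc v j) [0..<2 * k] \<noteq> []" using ex_inc[OF assms] by (auto simp: filter_empty_conv)
  from hd_in_set[OF this] show "first_row (2 * k) inc j < 2 * k" unfolding first_row_def by simp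
qed

lemma last_row_enc:
  assumes j: "j < num_cols k"
  shows "t_last tR tA (enc_nat j) = enc_nat (last_row (2 * k) inc j)" "last_row (2 * k) inc j < 2 * k"
proof -
  define V where "V = {v. v < 2 * k \<and> inc v j}"
  have V: "finite V" "V \<noteq> {}" using ex_inc[OF j] unfolding V_def by auto
  have "Max V \<in> V" using Max_in[OF V] .
  moreover have "v' \<le> Max V" if "v' < 2 * k" "inc v' j" for v'
    using Max_ge[OF V(1), of v'] that unfolding V_def by simp
  ultimately have ex: "\<exists>v\<in>set [0..<2 * k]. inc v j \<and> (\<forall>v'<2 * k. inc v' j \<longrightarrow> v' \<le> v)"
    by (intro bexI[of _ "Max V"]) (auto simp: V_def)
  show "t_last tR tA (enc_nat j) = enc_nat (last_row (2 * k) inc j)"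
    unfolding t_last_def last_row_def telems_tR
    by (rule tleft_filter_enc_nat[OF _ ex]) (use j entry_tA in \<open>auto simp: nle_enc_nat\<close>)
  have "filter (\<lambda>v. inc v j \<and> (\<forall>v'<2 * k. inc v' j \<longrightarrow> v' \<le> v)) [0..<2 * k] \<noteq> []"
    unfolding filter_empty_conv using ex by blast
  from hd_in_set[OF this] show "last_row (2 * k) inc j < 2 * k" unfolding last_row_def by simp
qed

lemma argmin_col_enc:
  assumes v: "v < 2 * k" and D: "D \<subseteq> {..<num_cols k}" "D \<noteq> {}"
  shows "t_argmin tC (enc_nat v) (enc_set D) = enc_nat (argmin_col c v D)" "argmin_col c v D \<in> D"
proof -
  have fin: "finite D" using D finite_subset by blast
  have ex: "\<exists>j\<in>set (sorted_list_of_set D). \<forall>j'\<in>D. c v j \<le> c v j'"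
    using arg_min_if_finite(1)[OF fin D(2), of "c v"] arg_min_least[OF fin _, of _ "c v"] fin D(2)
    by (intro bexI[of _ "arg_min_on (c v) D"]) auto
  have e: "entry tC (enc_nat v) (enc_nat j) = enc_nat (c v j)" if "j \<in> D" for j
    using entry_tC[OF v] that D by blast
  show "t_argmin tC (enc_nat v) (enc_set D) = enc_nat (argmin_col c v D)"
    unfolding t_argmin_def argmin_col_def telems_enc_set
    by (rule tleft_filter_enc_nat[OF _ ex]) (use fin in \<open>auto simp: nle_enc_nat e\<close>)
  have "filter (\<lambda>j. \<forall>j'\<in>D. c v j \<le> c v j') (sorted_list_of_set D) \<noteq> []"
    unfolding filter_empty_conv using ex by blast
  from hd_in_set[OF this] show "argmin_col c v D \<in> D" unfolding argmin_col_def using fin by simp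
qed

lemma leaving_enc:
  assumes B: "B \<subseteq> {..<num_cols k}" and D: "D \<subseteq> {..<num_cols k}" and t: "D - B = {t}"
  shows "t_leaving tR tA tC (enc_set B) (enc_set D) = enc_nat (leaving (2 * k) inc c B D)"
proof -
  have fin: "finite B" "finite D" using B D finite_subset by blast+
  have tD: "t \<in> D" "t < num_cols k" using t D by auto
  have "\<exists>j\<in>D. j \<notin> B" using t by blast
  from t_entering_enc_set[OF fin this]
  have e1: "t_entering (enc_set B) (enc_set D) = enc_nat t" unfolding entering_eq[OF fin(2) t] .
  have e2: "entering B D = t" by (rule entering_eq[OF fin(2) t])
  define v where "v = last_row (2 * k) inc t"
  have v: "t_last tR tA (enc_nat t) = enc_nat v" "v < 2 * k" using last_row_enc[OF tD(2)] v_def by auto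
  have cond: "(\<exists>j\<in>set (telems (enc_set D)). \<not> neq j (enc_nat t) \<and> tdrop j tR = Null \<and> \<not> entry tA (enc_nat v) j = Null)
    \<longleftrightarrow> (\<exists>j\<in>D. j \<noteq> t \<and> 2 * k \<le> j \<and> inc v j)"
  proof -
    have "(\<exists>j\<in>set (telems (enc_set D)). \<not> neq j (enc_nat t) \<and> tdrop j tR = Null \<and> \<not> entry tA (enc_nat v) j = Null)
      \<longleftrightarrow> (\<exists>j\<in>D. j \<noteq> t \<and> 2 * k \<le> j \<and> \<not> entry tA (enc_nat v) (enc_nat j) = Null)"
      unfolding telems_enc_set using fin by (simp add: neq_enc_nat tdrop_tR)
    also have "\<dots> \<longleftrightarrow> (\<exists>j\<in>D. j \<noteq> t \<and> 2 * k \<le> j \<and> inc v j)"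
      using entry_tA[OF v(2)] D by (metis lessThan_iff subsetD)
    finally show ?thesis .
  qed
  have ne: "D \<noteq> {}" using tD by auto
  have 0: "0 < 2 * k" using k by simp
  have a0: "t_argmin tC Null (enc_set D) = enc_nat (argmin_col c 0 D)" "argmin_col c 0 D < num_cols k"
    using argmin_col_enc[OF 0 D ne] D by auto
  show ?thesis
    unfolding t_leaving_def leaving_def Let_def e1 e2 v_def[symmetric] v(1) cond
      argmin_col_enc(1)[OF v(2) D ne] a0(1) first_row_enc(1)[OF a0(2)]
    by (rule if_distrib[symmetric])
qed

lemma new_enc:
  assumes D: "D \<subseteq> {..<num_cols k}"
    and ex: "\<exists>j<num_cols k. j \<notin> D \<and> dominating (2 * k) (num_cols k) c (insert j (D - {l}))"
  shows "t_new tK tR tC (enc_set D) (enc_nat l) = enc_nat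
    (hd (filter (\<lambda>j. j \<notin> D \<and> dominating (2 * k) (num_cols k) c (insert j (D - {l}))) [0..<num_cols k]))"
  unfolding t_new_def telems_tK telems_tR telems_enc_set
proof (rule tleft_filter_enc_nat)
  show "\<exists>j\<in>set [0..<num_cols k]. j \<notin> D \<and> dominating (2 * k) (num_cols k) c (insert j (D - {l}))"
    using ex by auto
  have fin: "finite D" using D finite_subset by blast
  fix j assume "j \<in> set [0..<num_cols k]"
  then have j: "j < num_cols k" by simp
  have Dk: "j' < num_cols k" if "j' \<in> D" for j' using that D by blast
  have "(\<forall>h\<in>set (map enc_nat [0..<num_cols k]). \<exists>i\<in>set (map enc_nat [0..<2 * k]).
      nle (entry tC i h) (entry tC i (enc_nat j)) \<and>
      (\<forall>j'\<in>set (map enc_nat (sorted_list_of_set D)). \<not> neq j' (enc_nat l) \<longrightarrow> nle (entry tC i h) (entry tC i j')))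
    \<longleftrightarrow> (\<forall>h\<in>{0..<num_cols k}. \<exists>i\<in>{0..<2 * k}.
      nle (entry tC (enc_nat i) (enc_nat h)) (entry tC (enc_nat i) (enc_nat j)) \<and>
      (\<forall>j'\<in>D. j' \<noteq> l \<longrightarrow> nle (entry tC (enc_nat i) (enc_nat h)) (entry tC (enc_nat i) (enc_nat j'))))"
    by (simp only: set_map set_sorted_list_of_set[OF fin] set_upt Ball_image_comp Bex_image_comp comp_def neq_enc_nat)
  also have "\<dots> \<longleftrightarrow> (\<forall>h\<in>{0..<num_cols k}. \<exists>i\<in>{0..<2 * k}. c i h \<le> c i j \<and> (\<forall>j'\<in>D. j' \<noteq> l \<longrightarrow> c i h \<le> c i j'))"
  proof -
    have "nle (entry tC (enc_nat i) (enc_nat h)) (entry tC (enc_nat i) (enc_nat j')) \<longleftrightarrow> c i h \<le> c i j'"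
      if "i \<in> {0..<2 * k}" "h \<in> {0..<num_cols k}" "j' < num_cols k" for i h j'
      using that by (simp add: entry_tC nle_enc_nat)
    then show ?thesis using j Dk by (intro ball_cong bex_cong conj_cong imp_cong refl) blast+
  qed
  also have "\<dots> \<longleftrightarrow> dominating (2 * k) (num_cols k) c (insert j (D - {l}))"
  proof -
    have "(\<forall>j'\<in>insert j (D - {l}). Q j') \<longleftrightarrow> Q j \<and> (\<forall>j'\<in>D. j' \<noteq> l \<longrightarrow> Q j')" for Q by auto
    note ins = this
    show ?thesis unfolding dominating_def ins by (simp add: Ball_def Bex_def)
  qed
  finally show "(\<not> mem (enc_nat j) (enc_set D) \<and>
      (\<forall>h\<in>set (map enc_nat [0..<num_cols k]). \<exists>i\<in>set (map enc_nat [0..<2 * k]).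
        nle (entry tC i h) (entry tC i (enc_nat j)) \<and>
        (\<forall>j'\<in>set (map enc_nat (sorted_list_of_set D)). \<not> neq j' (enc_nat l) \<longrightarrow> nle (entry tC i h) (entry tC i j'))))
    \<longleftrightarrow> j \<notin> D \<and> dominating (2 * k) (num_cols k) c (insert j (D - {l}))"
    using mem_enc_set[OF fin] by simp
qed

lemma selected_enc:
  assumes j: "j < num_cols k" and D: "D \<subseteq> {..<num_cols k}"
  shows "t_selected tR tA tC (enc_set D) (enc_nat j) \<longleftrightarrow> selected (2 * k) inc c D j"
proof -
  have fin: "finite D" using D finite_subset by blast
  have e: "nle (entry tC (enc_nat (first_row (2 * k) inc j)) (enc_nat j))
      (entry tC (enc_nat (first_row (2 * k) inc j)) (enc_nat j'))
    \<longleftrightarrow> c (first_row (2 * k) inc j) j \<le> c (first_row (2 * k) inc j) j'" if "j' \<in> D" for j'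
  proof -
    have "j' < num_cols k" using that D by blast
    then show ?thesis using first_row_enc(2)[OF j] j by (simp add: entry_tC nle_enc_nat)
  qed
  show ?thesis unfolding t_selected_def selected_def first_row_enc(1)[OF j] tdrop_tR mem_enc_set[OF fin] telems_enc_set
    using fin e by simp
qed

lemma argmax_enc:
  assumes j0: "is_arg_max (\<lambda>j. c 0 j) (\<lambda>j. 2 * k \<le> j \<and> j < num_cols k) j"
  shows "t_argmax tK tR tC = enc_nat j"
proof -
  have 0: "0 < 2 * k" using k by simp
  have j: "2 * k \<le> j" "j < num_cols k" "\<And>h. 2 * k \<le> h \<Longrightarrow> h < num_cols k \<Longrightarrow> c 0 h \<le> c 0 j"
    using j0 unfolding is_arg_max_def by (auto simp: not_less)
  have e: "entry tC Null (enc_nat j) = enc_nat (c 0 j)" if "j < num_cols k" for j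
    using entry_tC[OF 0 that] by simp
  have "t_argmax tK tR tC = enc_nat (hd (filter (\<lambda>j. 2 * k \<le> j \<and>
      (\<forall>h<num_cols k. 2 * k \<le> h \<longrightarrow> c 0 h \<le> c 0 j)) [0..<num_cols k]))"
    unfolding t_argmax_def telems_tK
    by (rule tleft_filter_enc_nat) (use j in \<open>auto simp: tdrop_tR e nle_enc_nat\<close>)
  also have "hd (filter (\<lambda>j. 2 * k \<le> j \<and> (\<forall>h<num_cols k. 2 * k \<le> h \<longrightarrow> c 0 h \<le> c 0 j)) [0..<num_cols k]) = j"
  proof (rule hd_filter_unique)
    show "j \<in> set [0..<num_cols k]" "2 * k \<le> j \<and> (\<forall>h<num_cols k. 2 * k \<le> h \<longrightarrow> c 0 h \<le> c 0 j)"
      using j by auto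
    fix h assume h: "h \<in> set [0..<num_cols k]" "2 * k \<le> h \<and> (\<forall>h'<num_cols k. 2 * k \<le> h' \<longrightarrow> c 0 h' \<le> c 0 h)"
    then have "c 0 h = c 0 j" using j by (intro le_antisym) auto
    then show "h = j" using c_inj[OF 0 _ j(2)] h(1) by simp
  qed
  finally show ?thesis .
qed

end

section \<open>Sizes of the encodings and running time of the program\<close>

definition enc_pair :: "nat set \<times> nat set \<Rightarrow> tree" where
  "enc_pair = (\<lambda>(B, D). Node (enc_set B) (enc_set D))"

lemma size_enc_list_le:
  assumes "\<And>x. x \<in> set xs \<Longrightarrow> size (f x) \<le> m" "length xs \<le> l"
  shows "size (enc_list f xs) \<le> l * (m + 1)"
proof -
  have "size (enc_list f xs) \<le> length xs * (m + 1)"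
    unfolding enc_list_tlist[of f] using size_tlist_le[of "map f xs" m] assms(1) by auto
  also have "\<dots> \<le> l * (m + 1)" using assms(2) by (intro mult_le_mono1)
  finally show ?thesis .
qed

lemma size_enc_set_le:
  assumes "S \<subseteq> {..<N}"
  shows "size (enc_set S) \<le> N * (N + 1)"
  unfolding enc_set_def
proof (rule size_enc_list_le)
  have fin: "finite S" using assms finite_subset by blast
  show "size (enc_nat x) \<le> N" if "x \<in> set (sorted_list_of_set S)" for x
    using that fin assms by (auto simp: size_enc_nat)
  show "length (sorted_list_of_set S) \<le> N" using card_mono[OF _ assms] by simp
qed

lemma size_enc_vec_le:
  assumes "dim_vec v \<le> N" "\<And>i. i < dim_vec v \<Longrightarrow> v $ i \<le> N"
  shows "size (enc_vec v) \<le> N * (N + 1)"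
  unfolding enc_vec_def
  by (rule size_enc_list_le) (use assms in \<open>auto simp: size_enc_nat in_set_conv_nth list_of_vec_index\<close>)

lemma size_enc_mat_le:
  assumes "dim_row M \<le> N" "dim_col M \<le> N" "\<And>i j. i < dim_row M \<Longrightarrow> j < dim_col M \<Longrightarrow> M $$ (i, j) \<le> N"
  shows "size (enc_mat M) \<le> N * (N * (N + 1) + 1)"
  unfolding enc_mat_def
proof (rule size_enc_list_le)
  show "size (enc_vec v) \<le> N * (N + 1)" if "v \<in> set (rows M)" for v
  proof -
    obtain i where i: "i < dim_row M" "v = row M i" using \<open>v \<in> set (rows M)\<close> by (auto simp: rows_def)
    show ?thesis unfolding i(2) by (rule size_enc_vec_le) (use assms i(1) in auto)
  qed
qed (use assms in simp)

text \<open>\<open>N\<close> is the number of columns, which also bounds the number of rows and all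
  entries. The summands belong to \<open>A\<close>, \<open>b\<close> and \<open>C\<close>; each
  further 1 is a node joining two parts.\<close>

definition input_bound :: "nat \<Rightarrow> nat" where
  "input_bound N = N * (N * (N + 1) + 1) + (N * (N + 1) + N * (N * (N + 1) + 1) + 1) + 1"

text \<open>The index lists, the matrices (bounded by the whole input), the current pair and the
  history; the factor \<open>N + 2\<close> dominates the length \<open>k\<^sup>2 + 2\<close> of the
  run.\<close>

definition state_bound :: "nat \<Rightarrow> nat" where
  "state_bound N = (N * (N + 1) + (N * (N + 1) + input_bound N + 1) + 1) +
     ((N * (N + 1) + N * (N + 1) + 1) + (N + 2) * ((N * (N + 1) + N * (N + 1) + 1) + 1) + 1) + 1"

lemma nat_poly_bounds: "nat_poly input_bound" "nat_poly state_bound"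
proof -
  show "nat_poly input_bound" unfolding input_bound_def by (intro nat_poly_intros)
  then show "nat_poly state_bound" unfolding state_bound_def by (intro nat_poly_intros)
qed

context marriage
begin

definition tG :: tree where
  "tG = Node tK (Node tR (Node tA tC))"

definition loop_state :: "(nat set \<times> nat set) list \<Rightarrow> nat \<Rightarrow> tree" where
  "loop_state r i = Node tG (Node (enc_pair (r ! i)) (tlist (map enc_pair (rev (take i r)))))"

text \<open>The rule \<open>rl\<close> is arbitrary here. Its column lies in the old
  \<open>B\<close> but not in the new one, and the equation for \<open>step\<close> says that
  \<open>leaving\<close> is the only column with this property; so the two agree, and the ordinal
  pivot of the iteration guarantees that the search succeeds.\<close>

lemma pair_enc:
  assumes it: "scarf_iteration (incidence_mat k mp) (ones_vec k) (ordinal_mat k mp wp) rl (B, D) y"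
    and y: "y = step (2 * k) (num_cols k) inc c (B, D)"
    and B: "B \<subseteq> {..<num_cols k}" and D: "D \<subseteq> {..<num_cols k}"
  shows "t_pair tK tR tA tC (enc_set B) (enc_set D) = enc_pair y"
proof -
  obtain B' D' where y': "y = (B', D')" by (cases y)
  define l where "l = leaving (2 * k) inc c B D"
  define l' where "l' = rl B D"
  obtain t where a: "D - B = {t}" "l' \<in> B" "B' = insert t (B - {l'})" and
    new: "if B' = D then D' = D
         else (\<exists>!j. j \<notin> D \<and> ordinal_basis (ordinal_mat k mp wp) (insert j (D - {l'}))) \<and>
              D' = insert (THE j. j \<notin> D \<and> ordinal_basis (ordinal_mat k mp wp) (insert j (D - {l'}))) (D - {l'})"
    using it unfolding scarf_iteration_def y' case_prod_conv l'_def by (elim conjE exE) (simp only:)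
  note t = a(1) and l' = a(2,3)
  have new: "\<exists>j. j \<notin> D \<and> ordinal_basis (ordinal_mat k mp wp) (insert j (D - {l'}))" if "B' \<noteq> D"
    using new unfolding if_not_P[OF that] by (elim conjE ex1_implies_ex)
  have fin: "finite B" "finite D" using B D finite_subset by blast+
  have tD: "t \<in> D" "t \<notin> B" "t < num_cols k" using t D by auto
  have ent: "entering B D = t" by (rule entering_eq[OF fin(2) t])
  have "\<exists>j\<in>D. j \<notin> B" using tD by blast
  then have tent: "t_entering (enc_set B) (enc_set D) = enc_nat t"
    using t_entering_enc_set[OF fin] ent by simp
  have tl: "t_leaving tR tA tC (enc_set B) (enc_set D) = enc_nat l"
    unfolding l_def by (rule leaving_enc[OF B D t])
  have y1: "B' = insert t (B - {l}) \<and>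
    D' = (if insert t (B - {l}) = D then D else insert (hd (filter (\<lambda>j. j \<notin> D \<and>
        dominating (2 * k) (num_cols k) c (insert j (D - {l}))) [0..<num_cols k])) (D - {l}))"
    using y unfolding y' step_def Let_def case_prod_conv ent l_def[symmetric] prod.inject .
  then have yy: "B' = insert t (B - {l})"
    "D' = (if B' = D then D else insert (hd (filter (\<lambda>j. j \<notin> D \<and>
        dominating (2 * k) (num_cols k) c (insert j (D - {l}))) [0..<num_cols k])) (D - {l}))"
    by (simp_all only:)
  have "l' \<notin> B'" unfolding l'(2) using l'(1) tD(2) by auto
  then have ll: "l' = l" unfolding yy(1) using l'(1) by simp
  have B'sub: "B' \<subseteq> {..<num_cols k}" using yy(1) B tD by auto
  have tB': "t_insert tK (enc_nat t) (enc_set B) (enc_nat l) = enc_set B'"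
    unfolding tK_def yy(1) by (rule t_insert_enc_set[OF tD(3) B])
  have seteq: "t_seteq (enc_set B') (enc_set D) \<longleftrightarrow> B' = D"
    by (rule t_seteq_enc_set[OF finite_subset[OF B'sub finite_lessThan] fin(2)])
  have "(if B' = D then enc_set D else t_insert tK (t_new tK tR tC (enc_set D) (enc_nat l)) (enc_set D) (enc_nat l))
    = enc_set D'"
  proof (cases "B' = D")
    case True
    then show ?thesis using yy(2) by simp
  next
    case False
    let ?Q = "\<lambda>j. j \<notin> D \<and> dominating (2 * k) (num_cols k) c (insert j (D - {l}))"
    have "\<exists>j<num_cols k. ?Q j"
    proof -
      obtain j where j: "j \<notin> D" "ordinal_basis (ordinal_mat k mp wp) (insert j (D - {l}))"
        using new[OF False] unfolding ll by (elim exE conjE)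
      have "0 < dim_row (ordinal_mat k mp wp)" using k by (simp add: dim_ordinal_mat)
      from j(2)[unfolded ordinal_basis_iff[OF this] dim_ordinal_mat]
      have "insert j (D - {l}) \<subseteq> {..<num_cols k}" "dominating (2 * k) (num_cols k) c (insert j (D - {l}))"
        unfolding dominating_def c_def by blast+
      then show ?thesis using j(1) by (intro exI[of _ j]) auto
    qed
    note ex = this
    have "filter ?Q [0..<num_cols k] \<noteq> []" unfolding filter_empty_conv using ex by auto
    from hd_in_set[OF this] have less: "hd (filter ?Q [0..<num_cols k]) < num_cols k" by simp
    have "t_insert tK (enc_nat (hd (filter ?Q [0..<num_cols k]))) (enc_set D) (enc_nat l)
      = enc_set (insert (hd (filter ?Q [0..<num_cols k])) (D - {l}))"
      unfolding tK_def by (rule t_insert_enc_set[OF less D])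
    then show ?thesis using False yy(2) new_enc[OF D ex] by simp
  qed
  then show ?thesis unfolding t_pair_def tent tl tB' seteq y' enc_pair_def by simp
qed

lemma init_enc:
  assumes "scarf_initial (ordinal_mat k mp wp) (B, D)"
  shows "t_init (enc_input (incidence_mat k mp) (ones_vec k) (ordinal_mat k mp wp))
    = Node tG (Node (enc_pair (B, D)) Null)"
proof -
  obtain j where j: "is_arg_max (\<lambda>j. c 0 j) (\<lambda>j. 2 * k \<le> j \<and> j < num_cols k) j"
    and B: "B = {..<2 * k}" and D: "D = insert j {1..<2 * k}"
    using assms unfolding scarf_initial_def Let_def dim_ordinal_mat c_def by auto
  have jN: "j < num_cols k" using j by (simp add: is_arg_max_def)
  have "length (telems tC) = 2 * k"
    unfolding tC_def enc_mat_def telems_enc_list by (simp add: dim_ordinal_mat)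
  then have R: "t_iota tC = tR" unfolding t_iota_eq tR_def enc_list_tlist[of enc_nat] by simp
  have "length (telems (tleft tC)) = num_cols k"
  proof -
    have "tleft (tdrop (enc_nat 0) tC) = enc_vec (rows (ordinal_mat k mp wp) ! 0)"
      unfolding tC_def enc_mat_def using k by (intro tleft_tdrop_enc_list) (simp add: dim_ordinal_mat)
    moreover have "tdrop (enc_nat 0) tC = tC" by (simp add: tdrop_def)
    ultimately show ?thesis unfolding enc_vec_def using k by (simp add: telems_enc_list dim_ordinal_mat)
  qed
  then have K: "t_iota (tleft tC) = tK" unfolding t_iota_eq tK_def enc_list_tlist[of enc_nat] by simp
  have encB: "enc_set {..<2 * k} = tR"
    unfolding enc_set_def tR_def by (simp add: lessThan_atLeast0)
  have "{..<2 * k} - {0} = {1..<2 * k}" by auto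
  moreover have "{..<2 * k} \<subseteq> {..<num_cols k}" by (auto simp: num_cols_def)
  ultimately have "t_insert tK (enc_nat j) tR Null = enc_set D"
    using t_insert_enc_set[OF jN, of "{..<2 * k}" 0] unfolding tK_def[symmetric] D encB by simp
  then show ?thesis unfolding t_init_def Let_def enc_input_def tA_def[symmetric] tC_def[symmetric]
    by (simp add: K R argmax_enc[OF j] tG_def enc_pair_def B encB)
qed

lemma final_enc:
  assumes r: "r \<noteq> []" "last r = (D, D)" and D: "D \<subseteq> {..<num_cols k}"
    and x: "x = vec (num_cols k) (\<lambda>j. if selected (2 * k) inc c D j then 1 else (0::nat))"
  shows "t_final (loop_state r (length r - 1)) = enc_output r x"
proof -
  have "r ! (length r - 1) = last r" using r by (simp add: last_conv_nth)
  moreover have "r = take (length r - 1) r @ [last r]"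
    using append_butlast_last_id[OF r(1)] unfolding butlast_conv_take by (rule sym)
  then have "rev r = last r # rev (take (length r - 1) r)" by (metis rev_eq_Cons_iff rev_rev_ident)
  ultimately have "Node (enc_pair (r ! (length r - 1))) (tlist (map enc_pair (rev (take (length r - 1) r))))
    = tlist (map enc_pair (rev r))" by (simp only: list.map enc_list.simps)
  then have "trev (Node (enc_pair (r ! (length r - 1))) (tlist (map enc_pair (rev (take (length r - 1) r)))))
    = enc_list (\<lambda>(B, D). Node (enc_set B) (enc_set D)) r"
    by (simp add: trev_tlist rev_map enc_pair_def enc_list_tlist[of "\<lambda>(B, D). Node (enc_set B) (enc_set D)"])
  moreover have "tlist (map (\<lambda>j. tbool (t_selected tR tA tC (enc_set D) j)) (telems tK)) = enc_vec x"
  proof -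
    have "map (\<lambda>j. tbool (t_selected tR tA tC (enc_set D) (enc_nat j))) [0..<num_cols k]
      = map (\<lambda>j. enc_nat (x $ j)) [0..<num_cols k]"
      using selected_enc[OF _ D] by (auto simp: x tbool_def)
    moreover have "list_of_vec x = map (\<lambda>j. x $ j) [0..<num_cols k]"
      by (rule nth_equalityI) (auto simp: x list_of_vec_index)
    ultimately show ?thesis unfolding telems_tK enc_vec_def enc_list_tlist[of enc_nat]
      by (simp only: map_map comp_def)
  qed
  ultimately show ?thesis
    unfolding t_final_def loop_state_def enc_output_def
    using \<open>r ! (length r - 1) = last r\<close> r(2) by (simp add: tG_def enc_pair_def)
qed

lemma size_input:
  "size (enc_input (incidence_mat k mp) (ones_vec k) (ordinal_mat k mp wp)) \<le> input_bound (num_cols k)"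
  "size tA \<le> num_cols k * (num_cols k * (num_cols k + 1) + 1)"
  "size tC \<le> num_cols k * (num_cols k * (num_cols k + 1) + 1)"
proof -
  have N: "2 * k \<le> num_cols k" "1 \<le> num_cols k" "k + 1 \<le> num_cols k" using k by (auto simp: num_cols_def)
  show A: "size tA \<le> num_cols k * (num_cols k * (num_cols k + 1) + 1)"
    unfolding tA_def by (rule size_enc_mat_le) (use N in \<open>auto simp: dim_incidence_mat incidence_entry\<close>)
  show C: "size tC \<le> num_cols k * (num_cols k * (num_cols k + 1) + 1)"
    unfolding tC_def
  proof (rule size_enc_mat_le)
    show "ordinal_mat k mp wp $$ (i, j) \<le> num_cols k"
      if "i < dim_row (ordinal_mat k mp wp)" "j < dim_col (ordinal_mat k mp wp)" for i j
      using that N(3) unfolding ordinal_mat_def by (auto simp: num_cols_def)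
  qed (use N in \<open>auto simp: dim_ordinal_mat\<close>)
  have "size (enc_vec (ones_vec k)) \<le> num_cols k * (num_cols k + 1)"
    by (rule size_enc_vec_le) (use N in \<open>auto simp: ones_vec_def\<close>)
  then show "size (enc_input (incidence_mat k mp) (ones_vec k) (ordinal_mat k mp wp)) \<le> input_bound (num_cols k)"
    unfolding enc_input_def input_bound_def using A C unfolding tA_def tC_def by simp
qed

lemma size_loop_state:
  assumes r: "\<forall>(B, D)\<in>set r. B \<subseteq> {..<num_cols k} \<and> D \<subseteq> {..<num_cols k}" "length r \<le> num_cols k + 2"
    and i: "i < length r"
  shows "size (loop_state r i) \<le> state_bound (num_cols k)"
proof -
  define N where "N = num_cols k"
  define e where "e = N * (N + 1)"
  have pair: "size (enc_pair s) \<le> e + e + 1" if "s \<in> set r" for s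
  proof -
    obtain B D where s: "s = (B, D)" by (cases s)
    then have "B \<subseteq> {..<N}" "D \<subseteq> {..<N}" using r(1) that N_def by auto
    then show ?thesis using size_enc_set_le[of B N] size_enc_set_le[of D N] by (simp add: s enc_pair_def e_def)
  qed
  have H: "size (tlist (map enc_pair (rev (take i r)))) \<le> (N + 2) * (e + e + 1 + 1)"
    unfolding enc_list_tlist[of enc_pair, symmetric]
    by (rule size_enc_list_le) (use pair r(2) N_def in \<open>auto dest: in_set_takeD\<close>)
  have K: "size tK \<le> e" unfolding tK_def e_def
    by (rule size_enc_list_le) (auto simp: size_enc_nat N_def)
  have R: "size tR \<le> e" unfolding tR_def e_def
    by (rule size_enc_list_le) (auto simp: size_enc_nat N_def num_cols_def)
  have AC: "size (Node tA tC) \<le> input_bound N"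
    using size_input(2,3) unfolding input_bound_def N_def by simp
  have "size (enc_pair (r ! i)) \<le> e + e + 1" using pair i by simp
  then show ?thesis unfolding loop_state_def tG_def state_bound_def N_def[symmetric] e_def[symmetric]
    using K R AC H by simp
qed

text \<open>Monotone bounds are evaluated at the bounds for the input and for the visited states;
  the loop makes at most one round per pair of the run, including the final test.\<close>

lemma exec_program:
  assumes run: "good_run r \<mu>" "scarf_initial (ordinal_mat k mp wp) (hd r)" "length r \<le> k\<^sup>2 + 2"
    and init: "\<forall>x. \<exists>t\<le>bi (size x). exec P0 x t (t_init x)" "mono bi"
    and cnd: "\<forall>x. \<exists>t\<le>bc (size x). exec Pc x t (t_cond x)" "mono bc"
    and bdy: "\<forall>x. \<exists>t\<le>bb (size x). exec Pb x t (t_body x)" "mono bb"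
    and fin: "\<forall>x. \<exists>t\<le>bf (size x). exec Pf x t (t_final x)" "mono bf"
  defines "N \<equiv> num_cols k"
  shows "\<exists>t \<le> bi (input_bound N) + ((N + 2) * (2 * (bc (state_bound N) + bb (state_bound N)) + 1) + bf (state_bound N) + 1) + 1.
    exec (Then P0 (Then (Loop Pc Pb) Pf)) (enc_input (incidence_mat k mp) (ones_vec k) (ordinal_mat k mp wp)) t
      (enc_output r (char_vec k mp \<mu>))"
proof -
  define Z where "Z = state_bound N"
  define M where "M = bc Z + bb Z"
  let ?x = "enc_input (incidence_mat k mp) (ones_vec k) (ordinal_mat k mp wp)"
  have r: "r \<noteq> []" "fst (last r) = snd (last r)"
    "\<forall>(B, D)\<in>set r. B \<subseteq> {..<num_cols k} \<and> D \<subseteq> {..<num_cols k}"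
    "(char_vec k mp \<mu> :: nat vec) =
       vec (num_cols k) (\<lambda>j. if selected (2 * k) inc c (fst (last r)) j then 1 else 0)"
    using run(1) unfolding good_run_def by auto
  have len: "length r \<le> N + 2" using run(3) by (simp add: N_def num_cols_def)
  have size: "size (loop_state r i) \<le> Z" if "i < length r" for i
    unfolding Z_def N_def by (rule size_loop_state[OF r(3) _ that]) (use len N_def in simp)
  define ss where "ss = map (loop_state r) [0..<length r]"
  have ss: "ss \<noteq> []" "hd ss = loop_state r 0" "last ss = loop_state r (length r - 1)" "length ss = length r"
    using r(1) unfolding ss_def by (auto simp: hd_map last_map)
  have subs: "fst (r ! i) \<subseteq> {..<num_cols k}" "snd (r ! i) \<subseteq> {..<num_cols k}" if "i < length r" for i
    using bspec[OF r(3) nth_mem[OF that]] by (simp_all add: case_prod_beta)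
  have tc: "t_cond (loop_state r i) = tbool (fst (r ! i) \<noteq> snd (r ! i))" if "i < length r" for i
  proof -
    have "finite (fst (r ! i))" "finite (snd (r ! i))" using subs[OF that] finite_subset by blast+
    then show ?thesis unfolding t_cond_def loop_state_def
      by (simp add: enc_pair_def t_seteq_enc_set case_prod_beta)
  qed
  have succ: "successively (\<lambda>s s'. t_cond s \<noteq> Null \<and> t_body s = s') ss"
    unfolding successively_conv_nth
  proof (intro allI impI)
    fix i assume "Suc i < length ss"
    then have i: "Suc i < length r" "i < length r" using ss(4) by auto
    have step: "scarf_iteration (incidence_mat k mp) (ones_vec k) (ordinal_mat k mp wp)
         (proposal_rule (incidence_mat k mp) (ones_vec k) (ordinal_mat k mp wp)) (r ! i) (r ! Suc i)"
       "r ! Suc i = step (2 * k) (num_cols k) inc c (r ! i)"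
      using run(1) i(1) unfolding good_run_def successively_conv_nth by blast+
    obtain B D where BD: "r ! i = (B, D)" by (cases "r ! i")
    have "B \<noteq> D" using step(1) unfolding scarf_iteration_def BD by (auto split: prod.splits)
    then have "t_cond (loop_state r i) \<noteq> Null" using tc[OF i(2)] BD by (simp add: tbool_def)
    moreover have "t_body (loop_state r i) = loop_state r (Suc i)"
    proof -
      have "t_pair tK tR tA tC (enc_set B) (enc_set D) = enc_pair (r ! Suc i)"
        by (rule pair_enc[OF step(1)[unfolded BD] step(2)[unfolded BD]]) (use subs[OF i(2)] BD in auto)
      moreover have "rev (take (Suc i) r) = r ! i # rev (take i r)" using i by (simp add: take_Suc_conv_app_nth)
      ultimately show ?thesis unfolding t_body_def loop_state_def tG_def
        by (simp add: BD enc_pair_def)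
    qed
    ultimately show "t_cond (ss ! i) \<noteq> Null \<and> t_body (ss ! i) = ss ! Suc i"
      using i unfolding ss_def by simp
  qed
  have ex: "\<exists>t\<le>M. exec Pc s t (t_cond s)" "\<exists>t\<le>M. exec Pb s t (t_body s)" if s: "s \<in> set ss" for s
  proof -
    have "size s \<le> Z" using s size unfolding ss_def by auto
    then have "bc (size s) \<le> M" "bb (size s) \<le> M"
      using monoD[OF cnd(2)] monoD[OF bdy(2)] unfolding M_def by (auto intro: trans_le_add1 trans_le_add2)
    then show "\<exists>t\<le>M. exec Pc s t (t_cond s)" "\<exists>t\<le>M. exec Pb s t (t_body s)"
      using cnd(1) bdy(1) by (meson order_trans)+
  qed
  have last: "t_cond (last ss) = Null"
    unfolding ss(3) using tc[of "length r - 1"] r(1,2) by (simp add: last_conv_nth tbool_def)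
  obtain t2 where t2: "t2 \<le> length ss * (2 * M + 1)" "exec (Loop Pc Pb) (hd ss) t2 (last ss)"
    using exec_Loop_states[OF ss(1) _ _ succ last, of M Pc Pb] ex by blast
  obtain t1 where t1: "t1 \<le> bi (size ?x)" "exec P0 ?x t1 (t_init ?x)" using init(1) by blast
  have "t_init ?x = hd ss"
  proof -
    obtain B D where BD: "hd r = (B, D)" by (cases "hd r")
    then show ?thesis using init_enc[of B D] run(2) r(1)
      unfolding ss(2) loop_state_def by (simp add: hd_conv_nth)
  qed
  with t1(2) have t1': "exec P0 ?x t1 (hd ss)" by simp
  obtain t3 where t3: "t3 \<le> bf (size (last ss))" "exec Pf (last ss) t3 (t_final (last ss))" using fin(1) by blast
  have "t_final (last ss) = enc_output r (char_vec k mp \<mu>)"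
    unfolding ss(3)
  proof (rule final_enc[OF r(1) _ _ r(4)])
    show "last r = (fst (last r), fst (last r))" using r(2) by (simp add: prod_eq_iff)
    show "fst (last r) \<subseteq> {..<num_cols k}" using subs(1)[of "length r - 1"] r(1) by (simp add: last_conv_nth)
  qed
  with t3(2) have t3': "exec Pf (last ss) t3 (enc_output r (char_vec k mp \<mu>))" by simp
  have "exec (Then P0 (Then (Loop Pc Pb) Pf)) ?x (t1 + (t2 + t3 + 1) + 1) (enc_output r (char_vec k mp \<mu>))"
    by (rule exec.intros(8)[OF t1' exec.intros(8)[OF t2(2) t3']])
  moreover have "t1 + (t2 + t3 + 1) + 1 \<le> bi (input_bound N) + ((N + 2) * (2 * M + 1) + bf Z + 1) + 1"
  proof -
    have "t1 \<le> bi (input_bound N)" using t1(1) monoD[OF init(2) size_input(1)] unfolding N_def by linarith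
    moreover have "t2 \<le> (N + 2) * (2 * M + 1)"
      using order_trans[OF t2(1) mult_le_mono1[of "length ss" "N + 2"]] len ss(4) by simp
    moreover have "size (last ss) \<le> Z" unfolding ss(3) using size[of "length r - 1"] r(1) by simp
    then have "t3 \<le> bf Z" using t3(1) monoD[OF fin(2)] by (meson order_trans)
    ultimately show ?thesis by linarith
  qed
  ultimately show ?thesis unfolding M_def Z_def by blast
qed

end

theorem theorem3:
  shows "\<exists>(\<rho> :: real mat \<Rightarrow> real vec \<Rightarrow> nat mat \<Rightarrow> pivoting_rule) (P :: prog)
            (p :: nat poly) (q :: nat poly).
    \<forall>(k :: nat) (mp :: nat \<Rightarrow> nat list) (wp :: nat \<Rightarrow> nat list) n A b C.
      k \<ge> 1 \<and> complete_instance k mp wp \<and> n = 2 * k \<and>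
      A = incidence_mat k mp \<and> b = ones_vec k \<and> C = ordinal_mat k mp wp \<longrightarrow>
        cardinal_pivoting_rule A b (\<rho> A b C) \<and>
        (\<exists>r \<mu>. scarf_run A b C (\<rho> A b C) r \<and>
               length r - 1 \<le> poly p n \<and>
               stable_matching k mp wp \<mu> \<and>
               basic_solution A b (fst (last r)) (char_vec k mp \<mu>) \<and>
               (\<exists>t \<le> poly q n.
                  exec P (enc_input (incidence_mat k mp) (ones_vec k) C) t
                         (enc_output r (char_vec k mp \<mu>))))"
proof -
  obtain bi P0 where i: "nat_poly bi" "mono bi" "\<forall>x. size (t_init x) \<le> bi (size x)"
    "\<forall>x. \<exists>t\<le>bi (size x). exec P0 x t (t_init x)" using ptime_t_init by (rule ptimeE) blast
  obtain bc Pc where c: "nat_poly bc" "mono bc" "\<forall>x. size (t_cond x) \<le> bc (size x)"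
    "\<forall>x. \<exists>t\<le>bc (size x). exec Pc x t (t_cond x)" using ptime_t_cond by (rule ptimeE) blast
  obtain bb Pb where b: "nat_poly bb" "mono bb" "\<forall>x. size (t_body x) \<le> bb (size x)"
    "\<forall>x. \<exists>t\<le>bb (size x). exec Pb x t (t_body x)" using ptime_t_body by (rule ptimeE) blast
  obtain bf Pf where f: "nat_poly bf" "mono bf" "\<forall>x. size (t_final x) \<le> bf (size x)"
    "\<forall>x. \<exists>t\<le>bf (size x). exec Pf x t (t_final x)" using ptime_t_final by (rule ptimeE) blast
  define time where "time N = bi (input_bound N) +
    ((N + 2) * (2 * (bc (state_bound N) + bb (state_bound N)) + 1) + bf (state_bound N) + 1) + 1" for N
  have time: "nat_poly time" unfolding time_def
    by (intro nat_poly_intros nat_poly_compose[OF i(1)] nat_poly_compose[OF c(1)]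
        nat_poly_compose[OF b(1)] nat_poly_compose[OF f(1)] nat_poly_bounds)
  \<comment> \<open>With \<open>n = 2 * k\<close> the number of columns
    \<open>2 * k + k\<^sup>2\<close> is at most \<open>n + n\<^sup>2\<close>.\<close>
  have "nat_poly (\<lambda>n. n + n\<^sup>2)" by (intro nat_poly_intros)
  with time have "nat_poly (\<lambda>n. time (n + n\<^sup>2))" by (rule nat_poly_compose)
  then obtain q :: "nat poly" where q: "(\<lambda>n. time (n + n\<^sup>2)) = poly q" unfolding nat_poly_def by blast
  \<comment> \<open>A list of at most \<open>k\<^sup>2 + 2\<close> pairs records at most
    \<open>k\<^sup>2 + 1\<close> iterations.\<close>
  have "nat_poly (\<lambda>n. n\<^sup>2 + 1)" by (intro nat_poly_intros)
  then obtain p :: "nat poly" where p: "(\<lambda>n. n\<^sup>2 + 1) = poly p" unfolding nat_poly_def by blast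
  let ?P = "Then P0 (Then (Loop Pc Pb) Pf)"
  show ?thesis
  proof (rule exI[of _ proposal_rule], rule exI[of _ ?P], rule exI[of _ p], rule exI[of _ q], intro allI impI)
    fix k :: nat and mp wp :: "nat \<Rightarrow> nat list" and n :: nat and A :: "real mat" and b :: "real vec" and C :: "nat mat"
    assume *: "1 \<le> k \<and> complete_instance k mp wp \<and> n = 2 * k \<and>
      A = incidence_mat k mp \<and> b = ones_vec k \<and> C = ordinal_mat k mp wp"
    interpret marriage k mp wp by unfold_locales (use * in auto)
    have eqs: "n = 2 * k" "A = incidence_mat k mp" "b = ones_vec k" "C = ordinal_mat k mp wp" using * by auto
    obtain r \<mu> where r: "good_run r \<mu>" "scarf_initial C (hd r)" "length r \<le> k\<^sup>2 + 2"
      using ex_run unfolding eqs by blast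
    have good: "r \<noteq> []" "fst (last r) = snd (last r)" "stable_matching k mp wp \<mu>"
      "basic_solution A b (fst (last r)) (char_vec k mp \<mu>)"
      "successively (\<lambda>x y. scarf_iteration A b C (proposal_rule A b C) x y \<and>
        y = step (2 * k) (num_cols k) inc c x) r"
      using r(1) unfolding good_run_def eqs by auto
    have "successively (scarf_iteration A b C (proposal_rule A b C)) r"
      using good(5) by (rule successively_mono) simp
    then have run: "scarf_run A b C (proposal_rule A b C) r"
      unfolding scarf_run_def using good r(2) by simp
    have kn: "k\<^sup>2 \<le> n\<^sup>2" unfolding eqs by (intro power_mono) auto
    then have len: "length r - 1 \<le> poly p n" unfolding p[symmetric] using r(3) by linarith
    have "num_cols k \<le> n + n\<^sup>2" unfolding num_cols_def eqs(1)[symmetric] using kn by linarith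
    then have "time (num_cols k) \<le> poly q n"
      unfolding q[symmetric] by (rule monoD[OF nat_poly_mono[OF time]])
    moreover obtain t where t: "t \<le> time (num_cols k)" "exec ?P
        (enc_input (incidence_mat k mp) (ones_vec k) C) t (enc_output r (char_vec k mp \<mu>))"
      using exec_program[OF r(1) r(2)[unfolded eqs] r(3) i(4,2) c(4,2) b(4,2) f(4,2)]
      unfolding time_def eqs by blast
    ultimately have "\<exists>t\<le>poly q n. exec ?P (enc_input (incidence_mat k mp) (ones_vec k) C) t
        (enc_output r (char_vec k mp \<mu>))" by (meson order_trans)
    moreover have "cardinal_pivoting_rule A b (proposal_rule A b C)"
      unfolding eqs(2) by (rule cardinal_pivoting_rule_proposal_rule)
    ultimately show "cardinal_pivoting_rule A b (proposal_rule A b C) \<and>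
        (\<exists>r \<mu>. scarf_run A b C (proposal_rule A b C) r \<and> length r - 1 \<le> poly p n \<and>
          stable_matching k mp wp \<mu> \<and> basic_solution A b (fst (last r)) (char_vec k mp \<mu>) \<and>
          (\<exists>t\<le>poly q n. exec ?P (enc_input (incidence_mat k mp) (ones_vec k) C) t
            (enc_output r (char_vec k mp \<mu>))))"
      using run len good(3,4) by blast
  qed
qed

end
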